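(* Let $n\geq 1$ and let $q$ be a nonzero complex number with $q^2\neq 1$. The elements $$ s_{2n,1}^{k_{2n,1}}\cdots s_{2n,2n-2}^{k_{2n,2n-2}}\, s_{2n,2n}^{k_{2n,2n}}\ \cdots\ s_{41}^{k_{41}}\, s_{42}^{k_{42}}\, s_{44}^{k_{44}}\ s_{22}^{k_{22}} \ \times\ s_{11}^{k_{11}}\, s_{12}^{k_{12}}\ s_{31}^{k_{31}}\, s_{32}^{k_{32}}\, s_{33}^{k_{33}}\, s_{34}^{k_{34}}\ \cdots\ s_{2n-1,1}^{k_{2n-1,1}}\cdots s_{2n-1,2n}^{k_{2n-1,2n}}, $$ where the exponents $k_{i,i+1}$ for odd $i$ run over all integers and the remaining exponents $k_{rj}$ run over all non-negative integers, form a basis (over $\mathbb{C}$) of the algebra $\mathrm{U}'_q(\mathfrak{sp}_{2n})$. (In the displayed product, the first part contains, for $i=2n,2n-2,\dots,2$ in this order, the powers of $s_{i1},s_{i2},\dots,s_{i,i-2},s_{ii}$, with $s_{i,i-1}$ omitted; the second part contains, for $i=1,3,\dots,2n-1$ in this order, the powers of $s_{i1},s_{i2},\dots,s_{ii},s_{i,i+1}$.)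
   Context: $\mathrm{U}'_q(\mathfrak{sp}_{2n})$ is the unital associative $\mathbb{C}$-algebra generated by elements $s_{ij}$, $i,j\in\{1,\dots,2n\}$, and $s_{i,i+1}^{-1}$, $i=1,3,\dots,2n-1$, subject to the following relations. (1) $s_{ij}=0$ for $j=i+1$ with $i$ even, and for $j\geq i+2$ and all $i$. (2) $s_{i,i+1}s_{i,i+1}^{-1}=s_{i,i+1}^{-1}s_{i,i+1}=1$ for $i=1,3,\dots,2n-1$. (3) $s_{i+1,i+1}s_{ii}-q^2 s_{i+1,i}s_{i,i+1}=q^3$ for $i=1,3,\dots,2n-1$. (4) For all $i,a,j,b\in\{1,\dots,2n\}$, $$ \begin{aligned} q^{\delta_{aj}+\delta_{ij}} s_{ia}s_{jb}-q^{\delta_{ab}+\delta_{ib}} s_{jb}s_{ia} &=(q-q^{-1})\,q^{\delta_{ai}}(\delta_{b<a}-\delta_{i<j})\,s_{ja}s_{ib}\\ &\quad+(q-q^{-1})\big(q^{\delta_{ab}}\delta_{b<i}\,s_{ji}s_{ba}-q^{\delta_{ij}}\delta_{a<j}\,s_{ij}s_{ab}\big)\\ &\quad+(q-q^{-1})^2(\delta_{b<a<i}-\delta_{a<i<j})\,s_{ji}s_{ab}, \end{aligned} $$ where $\delta_{ij}$ is the Kronecker delta and $\delta_{i<j}$ (respectively $\delta_{i<j<k}$) equals $1$ if the subscript inequality holds and $0$ otherwise. Negative powers of $s_{i,i+1}$, $i$ odd, are powers of $s_{i,i+1}^{-1}$. *)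

theory Defs
  imports
    "HOL-Library.Poly_Mapping"
    "HOL-Algebra.Algebraic_Closure_Type"
    "Jordan_Normal_Form.Missing_VectorSpace"
begin

section \<open>Free associative algebras over the complex numbers\<close>

text \<open>Words form a type of their own so that concatenation can be the addition of a
  \<^class>\<open>monoid_add\<close>; the product on \<open>'g word \<Rightarrow>\<^sub>0 complex\<close> is then the
  convolution product of the monoid algebra.\<close>

datatype 'g word = Word (letters: "'g list")

instantiation word :: (type) monoid_add
begin

definition zero_word :: "'a word" where
  "0 = Word []"

definition plus_word :: "'a word \<Rightarrow> 'a word \<Rightarrow> 'a word" where
  "u + v = Word (letters u @ letters v)"

instance
  by standard (simp_all add: zero_word_def plus_word_def)

end

definition scalar :: "complex \<Rightarrow> 'g word \<Rightarrow>\<^sub>0 complex" where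
  "scalar c = Poly_Mapping.single 0 c"

definition letter :: "'g \<Rightarrow> 'g word \<Rightarrow>\<^sub>0 complex" where
  "letter g = Poly_Mapping.single (Word [g]) 1"

definition free_algebra :: "'g set \<Rightarrow> (complex, 'g word \<Rightarrow>\<^sub>0 complex) module" where
  "free_algebra G =
    \<lparr>carrier = {p. \<forall>w\<in>Poly_Mapping.keys p. set (letters w) \<subseteq> G},
     monoid.mult = (*), one = 1, ring.zero = 0, add = (+),
     module.smult = (\<lambda>c p. scalar c * p)\<rparr>"

text \<open>The scalar action on cosets follows the pattern of \<^const>\<open>rcoset_mult\<close>.\<close>

definition quotient_algebra ::
    "('a, 'b, 'c) module_scheme \<Rightarrow> 'b set \<Rightarrow> ('a, 'b set) module" where
  "quotient_algebra A I =
    \<lparr>carrier = carrier (A Quot I),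
     monoid.mult = monoid.mult (A Quot I), one = one (A Quot I),
     ring.zero = ring.zero (A Quot I), add = add (A Quot I),
     module.smult = (\<lambda>c C. \<Union>x\<in>C. I +>\<^bsub>A\<^esub> (c \<odot>\<^bsub>A\<^esub> x))\<rparr>"

abbreviation complex_field :: "complex ring" where
  "complex_field \<equiv> ring_of_type_algebra"


section \<open>The algebra \<open>U'\<^sub>q(sp\<^sub>2\<^sub>n)\<close>\<close>

text \<open>\<open>S i j\<close> stands for $s_{ij}$ and \<open>Sinv i\<close> for $s_{i,i+1}^{-1}$.\<close>

datatype gen = S nat nat | Sinv nat

type_synonym free_elem = "gen word \<Rightarrow>\<^sub>0 complex"

abbreviation s :: "nat \<Rightarrow> nat \<Rightarrow> free_elem" where
  "s i j \<equiv> letter (S i j)"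

abbreviation sinv :: "nat \<Rightarrow> free_elem" where
  "sinv i \<equiv> letter (Sinv i)"

definition odd_indices :: "nat \<Rightarrow> nat set" where
  "odd_indices n = {i \<in> {1..2*n}. odd i}"

definition gens :: "nat \<Rightarrow> gen set" where
  "gens n = {S i j | i j. i \<in> {1..2*n} \<and> j \<in> {1..2*n}} \<union> {Sinv i | i. i \<in> odd_indices n}"

definition reflection_lhs :: "complex \<Rightarrow> nat \<Rightarrow> nat \<Rightarrow> nat \<Rightarrow> nat \<Rightarrow> free_elem" where
  "reflection_lhs q i a j b =
     scalar (q ^ (of_bool (a = j) + of_bool (i = j))) * s i a * s j b
   - scalar (q ^ (of_bool (a = b) + of_bool (i = b))) * s j b * s i a"

definition reflection_rhs :: "complex \<Rightarrow> nat \<Rightarrow> nat \<Rightarrow> nat \<Rightarrow> nat \<Rightarrow> free_elem" where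
  "reflection_rhs q i a j b =
     scalar ((q - inverse q) * q ^ of_bool (a = i) * (of_bool (b < a) - of_bool (i < j)))
       * s j a * s i b
   + scalar (q - inverse q)
       * (scalar (q ^ of_bool (a = b) * of_bool (b < i)) * s j i * s b a
          - scalar (q ^ of_bool (i = j) * of_bool (a < j)) * s i j * s a b)
   + scalar ((q - inverse q)^2 * (of_bool (b < a \<and> a < i) - of_bool (a < i \<and> i < j)))
       * s j i * s a b"

text \<open>A relation \<open>l = r\<close> is represented by the element \<open>l - r\<close> of the free algebra.\<close>

definition relators :: "nat \<Rightarrow> complex \<Rightarrow> free_elem set" where
  "relators n q =
     {s i j | i j. i \<in> {1..2*n} \<and> j \<in> {1..2*n} \<and> (even i \<and> j = i + 1 \<or> j \<ge> i + 2)}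
   \<union> {s i (i+1) * sinv i - 1 | i. i \<in> odd_indices n}
   \<union> {sinv i * s i (i+1) - 1 | i. i \<in> odd_indices n}
   \<union> {s (i+1) (i+1) * s i i - scalar (q^2) * s (i+1) i * s i (i+1) - scalar (q^3) | i.
        i \<in> odd_indices n}
   \<union> {reflection_lhs q i a j b - reflection_rhs q i a j b | i a j b.
        i \<in> {1..2*n} \<and> a \<in> {1..2*n} \<and> j \<in> {1..2*n} \<and> b \<in> {1..2*n}}"

definition relation_ideal :: "nat \<Rightarrow> complex \<Rightarrow> free_elem set" where
  "relation_ideal n q = Idl\<^bsub>free_algebra (gens n)\<^esub> (relators n q)"

definition U_sp :: "nat \<Rightarrow> complex \<Rightarrow> (complex, free_elem set) module" where
  "U_sp n q = quotient_algebra (free_algebra (gens n)) (relation_ideal n q)"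


section \<open>Ordered monomials\<close>

text \<open>The index pairs in the order in which the powers occur: first the rows
  \<open>2n, 2n-2, \<dots>, 2\<close>, with row \<open>i\<close> running through \<open>1, \<dots>, i-2, i\<close>; then the rows
  \<open>1, 3, \<dots>, 2n-1\<close>, with row \<open>i\<close> running through \<open>1, \<dots>, i+1\<close>.\<close>

definition pbw_positions :: "nat \<Rightarrow> (nat \<times> nat) list" where
  "pbw_positions n =
     [(i, j). i \<leftarrow> map (\<lambda>m. 2*m) (rev [1..<n+1]), j \<leftarrow> [1..<i-1] @ [i]]
   @ [(i, j). i \<leftarrow> map (\<lambda>m. 2*m - 1) [1..<n+1], j \<leftarrow> [1..<i+2]]"

text \<open>Exponents are required to vanish off the positions, so that distinct admissible
  functions are distinct exponent tuples.\<close>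

definition pbw_exponents :: "nat \<Rightarrow> (nat \<times> nat \<Rightarrow> int) set" where
  "pbw_exponents n =
     {k. (\<forall>p. p \<notin> set (pbw_positions n) \<longrightarrow> k p = 0) \<and>
         (\<forall>(i, j) \<in> set (pbw_positions n). odd i \<and> j = i + 1 \<or> k (i, j) \<ge> 0)}"

text \<open>The second branch is used only for odd \<open>i\<close> and \<open>j = i + 1\<close>.\<close>

definition s_power :: "nat \<Rightarrow> nat \<Rightarrow> int \<Rightarrow> free_elem" where
  "s_power i j k = (if k \<ge> 0 then s i j ^ nat k else sinv i ^ nat (- k))"

text \<open>The product is formed in the free algebra and then projected to the quotient.\<close>

definition pbw_monomial :: "nat \<Rightarrow> complex \<Rightarrow> (nat \<times> nat \<Rightarrow> int) \<Rightarrow> free_elem set" where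
  "pbw_monomial n q k =
     relation_ideal n q +>\<^bsub>free_algebra (gens n)\<^esub>
       prod_list (map (\<lambda>(i, j). s_power i j (k (i, j))) (pbw_positions n))"


section \<open>The algebra is a ring and a complex vector space\<close>

lemma letters_plus: "letters (u + v) = letters u @ letters v"
  by (simp add: plus_word_def)

lemma scalar_simps:
  "scalar 0 = 0" "scalar 1 = 1" "scalar (c + d) = scalar c + scalar d"
  "scalar (c * d) = scalar c * scalar d"
  by (simp_all add: scalar_def single_add mult_single)

lemma scalar_commute: "scalar c * p = p * scalar c"
proof (induction p rule: update_induct)
  case const
  then show ?case by simp
next
  case (update p w v)
  have "Poly_Mapping.update w v p = p + Poly_Mapping.single w v"
    using update(1) by (intro poly_mapping_eqI)
      (auto simp: lookup_update lookup_add lookup_single when_def in_keys_iff)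
  then show ?case
    using update(3) by (simp add: distrib_left distrib_right)
      (simp add: scalar_def mult_single mult.commute)
qed

lemma free_algebra_ops:
  "p \<in> carrier (free_algebra G) \<longleftrightarrow> (\<forall>w\<in>Poly_Mapping.keys p. set (letters w) \<subseteq> G)"
  "p \<otimes>\<^bsub>free_algebra G\<^esub> r = p * r" "\<one>\<^bsub>free_algebra G\<^esub> = 1"
  "\<zero>\<^bsub>free_algebra G\<^esub> = 0" "p \<oplus>\<^bsub>free_algebra G\<^esub> r = p + r"
  "c \<odot>\<^bsub>free_algebra G\<^esub> p = scalar c * p"
  by (simp_all add: free_algebra_def)

lemma free_algebra_closed:
  "0 \<in> carrier (free_algebra G)" "1 \<in> carrier (free_algebra G)"
  "scalar c \<in> carrier (free_algebra G)"
  "p \<in> carrier (free_algebra G) \<Longrightarrow> - p \<in> carrier (free_algebra G)"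
  "\<lbrakk>p \<in> carrier (free_algebra G); r \<in> carrier (free_algebra G)\<rbrakk>
     \<Longrightarrow> p + r \<in> carrier (free_algebra G)"
  "\<lbrakk>p \<in> carrier (free_algebra G); r \<in> carrier (free_algebra G)\<rbrakk>
     \<Longrightarrow> p - r \<in> carrier (free_algebra G)"
  "\<lbrakk>p \<in> carrier (free_algebra G); r \<in> carrier (free_algebra G)\<rbrakk>
     \<Longrightarrow> p * r \<in> carrier (free_algebra G)"
proof -
  show add: "p + r \<in> carrier (free_algebra G)"
    if "p \<in> carrier (free_algebra G)" "r \<in> carrier (free_algebra G)" for p r
    using that Poly_Mapping.keys_add[of p r] unfolding free_algebra_ops by blast
  show neg: "- p \<in> carrier (free_algebra G)" if "p \<in> carrier (free_algebra G)" for p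
    using that by (simp add: free_algebra_ops)
  show "p - r \<in> carrier (free_algebra G)"
    if "p \<in> carrier (free_algebra G)" "r \<in> carrier (free_algebra G)" for p r
    using add[OF that(1) neg[OF that(2)]] by simp
  show "p * r \<in> carrier (free_algebra G)"
    if "p \<in> carrier (free_algebra G)" "r \<in> carrier (free_algebra G)"
    using that keys_mult[of p r] unfolding free_algebra_ops
    by (fastforce simp: letters_plus)
  show "scalar c \<in> carrier (free_algebra G)"
    by (auto simp: free_algebra_ops scalar_def zero_word_def)
  show "1 \<in> carrier (free_algebra G)"
    by (auto simp: free_algebra_ops single_one[symmetric] zero_word_def)
qed (simp add: free_algebra_ops)

lemma letter_closed: "g \<in> G \<Longrightarrow> letter g \<in> carrier (free_algebra G)"
  by (auto simp: free_algebra_ops letter_def)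

lemma ring_free_algebra: "ring (free_algebra G)"
proof (rule ringI)
  show "abelian_group (free_algebra G)"
    by (rule abelian_groupI)
      (auto simp: free_algebra_ops(2-) free_algebra_closed add_ac
            intro!: bexI[where x = "- _"])
  show "Group.monoid (free_algebra G)"
    by (rule monoidI) (auto simp: free_algebra_ops(2-) free_algebra_closed mult.assoc)
qed (auto simp: free_algebra_ops(2-) distrib_left distrib_right)

lemma relators_subset: "relators n q \<subseteq> carrier (free_algebra (gens n))"
proof -
  have S: "s i j \<in> carrier (free_algebra (gens n))"
    if "i \<in> {1..2*n}" "j \<in> {1..2*n}" for i j
    using that by (intro letter_closed) (simp add: gens_def)
  have Sinv: "sinv i \<in> carrier (free_algebra (gens n))" if "i \<in> odd_indices n" for i
    using that by (intro letter_closed) (simp add: gens_def)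
  have odd: "i \<in> {1..2*n}" "i + 1 \<in> {1..2*n}" if "i \<in> odd_indices n" for i
    using that by (auto simp: odd_indices_def elim!: oddE) presburger
  show ?thesis
    unfolding relators_def reflection_lhs_def reflection_rhs_def
    by (intro Un_least subsetI; elim CollectE exE conjE; hypsubst;
        (assumption | rule free_algebra_closed S Sinv odd)+)
qed

lemma ideal_relation_ideal: "ideal (relation_ideal n q) (free_algebra (gens n))"
  unfolding relation_ideal_def
  by (intro ring.genideal_ideal ring_free_algebra relators_subset)

lemma ring_U_sp: "ring (U_sp n q)"
proof -
  interpret R: ring "free_algebra (gens n) Quot relation_ideal n q"
    by (rule ideal.quotient_is_ring[OF ideal_relation_ideal])
  show ?thesis
  proof (rule ringI)
    show "abelian_group (U_sp n q)"
      using R.a_comm_group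
      by (intro abelian_groupI)
        (auto simp: U_sp_def quotient_algebra_def R.a_ac intro: R.l_neg R.a_inv_closed)
    show "Group.monoid (U_sp n q)"
      by (rule monoidI) (auto simp: U_sp_def quotient_algebra_def R.m_assoc)
  qed (auto simp: U_sp_def quotient_algebra_def R.l_distr R.r_distr)
qed

lemma smult_U_sp_coset:
  assumes "p \<in> carrier (free_algebra (gens n))"
  shows "c \<odot>\<^bsub>U_sp n q\<^esub> (relation_ideal n q +>\<^bsub>free_algebra (gens n)\<^esub> p) =
         relation_ideal n q +>\<^bsub>free_algebra (gens n)\<^esub> (scalar c * p)"
proof -
  define A where "A = free_algebra (gens n)"
  define I where "I = relation_ideal n q"
  interpret ideal I A unfolding A_def I_def by (rule ideal_relation_ideal)
  have p: "p \<in> carrier A" using assms by (simp add: A_def)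
  have "I +>\<^bsub>A\<^esub> (scalar c * x) = I +>\<^bsub>A\<^esub> (scalar c * p)" if x: "x \<in> I +>\<^bsub>A\<^esub> p" for x
  proof -
    from x obtain h where h: "h \<in> I" "x = h + p"
      by (auto simp: a_r_coset_def' A_def free_algebra_ops)
    have "scalar c * h \<in> I"
      using I_l_closed[OF h(1), of "scalar c"] by (simp add: A_def free_algebra_ops(2) free_algebra_closed)
    then have "scalar c * x \<in> I +>\<^bsub>A\<^esub> (scalar c * p)"
      using h by (auto simp: a_r_coset_def' A_def free_algebra_ops distrib_left)
    moreover have "scalar c * p \<in> carrier A"
      using p by (simp add: A_def free_algebra_closed)
    ultimately show ?thesis
      using a_repr_independence' by metis
  qed
  moreover have "I +>\<^bsub>A\<^esub> p \<noteq> {}"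
    using a_rcos_self[OF p] by blast
  ultimately have "(\<Union>x\<in>I +>\<^bsub>A\<^esub> p. I +>\<^bsub>A\<^esub> (scalar c * x)) = I +>\<^bsub>A\<^esub> (scalar c * p)"
    by auto
  then show ?thesis
    by (simp add: U_sp_def quotient_algebra_def A_def I_def free_algebra_ops)
qed

lemma carrier_U_spE:
  assumes "C \<in> carrier (U_sp n q)"
  obtains p where "p \<in> carrier (free_algebra (gens n))"
    "C = relation_ideal n q +>\<^bsub>free_algebra (gens n)\<^esub> p"
  using assms by (auto simp: U_sp_def quotient_algebra_def FactRing_simps)

lemma U_sp_coset_ops:
  assumes "p \<in> carrier (free_algebra (gens n))" "r \<in> carrier (free_algebra (gens n))"
  shows "relation_ideal n q +>\<^bsub>free_algebra (gens n)\<^esub> p \<in> carrier (U_sp n q)"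
    and "(relation_ideal n q +>\<^bsub>free_algebra (gens n)\<^esub> p) \<oplus>\<^bsub>U_sp n q\<^esub>
         (relation_ideal n q +>\<^bsub>free_algebra (gens n)\<^esub> r) =
         relation_ideal n q +>\<^bsub>free_algebra (gens n)\<^esub> (p + r)"
    and "(relation_ideal n q +>\<^bsub>free_algebra (gens n)\<^esub> p) \<otimes>\<^bsub>U_sp n q\<^esub>
         (relation_ideal n q +>\<^bsub>free_algebra (gens n)\<^esub> r) =
         relation_ideal n q +>\<^bsub>free_algebra (gens n)\<^esub> (p * r)"
proof -
  interpret ideal "relation_ideal n q" "free_algebra (gens n)"
    by (rule ideal_relation_ideal)
  show "relation_ideal n q +>\<^bsub>free_algebra (gens n)\<^esub> p \<in> carrier (U_sp n q)"
    using assms by (auto simp: U_sp_def quotient_algebra_def FactRing_simps)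
  show "(relation_ideal n q +>\<^bsub>free_algebra (gens n)\<^esub> p) \<oplus>\<^bsub>U_sp n q\<^esub>
         (relation_ideal n q +>\<^bsub>free_algebra (gens n)\<^esub> r) =
         relation_ideal n q +>\<^bsub>free_algebra (gens n)\<^esub> (p + r)"
    using a_rcos_sum[OF assms]
    by (simp add: U_sp_def quotient_algebra_def FactRing_def free_algebra_ops)
  show "(relation_ideal n q +>\<^bsub>free_algebra (gens n)\<^esub> p) \<otimes>\<^bsub>U_sp n q\<^esub>
         (relation_ideal n q +>\<^bsub>free_algebra (gens n)\<^esub> r) =
         relation_ideal n q +>\<^bsub>free_algebra (gens n)\<^esub> (p * r)"
    using rcoset_mult_add[OF assms]
    by (simp add: U_sp_def quotient_algebra_def FactRing_def free_algebra_ops)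
qed

lemma vectorspace_U_sp: "vectorspace complex_field (U_sp n q)"
proof -
  interpret U: ring "U_sp n q" by (rule ring_U_sp)
  have "module complex_field (U_sp n q)"
    using cring_from_type_algebra[where 'a = complex]
    by (intro moduleI)
      (auto simp: U.abelian_group_axioms ring_of_type_algebra_def
          smult_U_sp_coset U_sp_coset_ops free_algebra_closed scalar_simps
          distrib_left distrib_right mult.assoc elim!: carrier_U_spE)
  then show ?thesis
    by (intro vectorspace.intro field_from_type_algebra)
qed

lemma smult_U_sp_mult:
  assumes "C \<in> carrier (U_sp n q)" "D \<in> carrier (U_sp n q)"
  shows "(c \<odot>\<^bsub>U_sp n q\<^esub> C) \<otimes>\<^bsub>U_sp n q\<^esub> D = c \<odot>\<^bsub>U_sp n q\<^esub> (C \<otimes>\<^bsub>U_sp n q\<^esub> D)"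
    and "C \<otimes>\<^bsub>U_sp n q\<^esub> (c \<odot>\<^bsub>U_sp n q\<^esub> D) = c \<odot>\<^bsub>U_sp n q\<^esub> (C \<otimes>\<^bsub>U_sp n q\<^esub> D)"
proof -
  have "p * (scalar c * r) = scalar c * (p * r)" for p r :: free_elem
    by (metis mult.assoc scalar_commute)
  then show "(c \<odot>\<^bsub>U_sp n q\<^esub> C) \<otimes>\<^bsub>U_sp n q\<^esub> D = c \<odot>\<^bsub>U_sp n q\<^esub> (C \<otimes>\<^bsub>U_sp n q\<^esub> D)"
    and "C \<otimes>\<^bsub>U_sp n q\<^esub> (c \<odot>\<^bsub>U_sp n q\<^esub> D) = c \<odot>\<^bsub>U_sp n q\<^esub> (C \<otimes>\<^bsub>U_sp n q\<^esub> D)"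
    using assms
    by (auto simp: smult_U_sp_coset U_sp_coset_ops free_algebra_closed mult.assoc
          elim!: carrier_U_spE)
qed

end

theory Submission
  imports Defs
begin

text \<open>The ordered monomials span because a suitable weight makes the generators commute up
  to invertible scalars and lighter words, while the determinant relation and the inverses
  eliminate the remaining unordered letters; this works over any ring in which \<open>q\<close> is a unit.

  For independence let \<open>q\<close> be the variable \<open>z\<close> of the Laurent polynomials. The group algebra
  of a Heisenberg group contains triangular matrices \<open>T\<close>, \<open>U\<close> satisfying the exchange
  relations of the quantum general linear group, and \<open>S = T G U\<^sup>t\<close> for a skew block matrix
  \<open>G\<close> satisfies the defining relations. At \<open>z = 1\<close> this group algebra becomes commutative, and
  its points give the generators occurring in the ordered monomials arbitrary nonzero values, so
  that these monomials become linearly independent functions. In a linear relation over the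
  Laurent polynomials all coefficients are therefore divisible by \<open>z - 1\<close>, arbitrarily often,
  and vanish. So the ordered monomials form a basis of the image of the algebra over the Laurent
  polynomials, and this survives the reduction modulo \<open>z - q\<close> for every nonzero \<open>q\<close>.\<close>

section \<open>Monoid algebras\<close>

text \<open>For a fixed number \<open>q\<close>, which may be a root of unity, there is no classical
  limit to compare with; hence the detour over the Laurent polynomials, where divisibility by
  \<open>z - 1\<close> takes the place of a limit. The return to the number \<open>q\<close> needs
  more than independence: the image of the relation ideal has to consist of \<open>z - q\<close>
  times combinations of ordered monomials. So the spanning argument is required over the Laurent
  polynomials too, and \<open>sp_relations\<close> is stated for an arbitrary coefficient ring and
  instantiated twice.

  The obstacle to a filtration by weight is the product s_{i+1,i+1} s_ii of two diagonal letters.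
  The determinant relation trades s_{i+1,i} for this product, so s_{i+1,i} must be the heavier one;
  but then exchanging the two diagonal letters produces a heavier term. The determinant relation is
  used a second time to remove it.

  The Heisenberg group algebra suits both ends: \<open>z\<close> translates supports, so
  \<open>z - 1\<close> can be cancelled, and at \<open>z = 1\<close> prescribing values reduces to
  factoring triangular matrices.\<close>

definition const_alg :: "'k::comm_ring_1 \<Rightarrow> ('m::monoid_add \<Rightarrow>\<^sub>0 'k)" where
  "const_alg c = Poly_Mapping.single 0 c"

lemma const_alg_simps [simp]:
  "const_alg 0 = 0" "const_alg 1 = 1"
  by (simp_all add: const_alg_def)

lemma const_alg_add: "const_alg (c + d) = const_alg c + const_alg d"
  and const_alg_mult: "const_alg (c * d) = const_alg c * const_alg d"
  by (simp_all add: const_alg_def single_add mult_single)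

lemma const_alg_single: "const_alg c * Poly_Mapping.single w d = Poly_Mapping.single w (c * d)"
  "Poly_Mapping.single w d * const_alg c = Poly_Mapping.single w (c * d)"
  by (simp_all add: const_alg_def mult_single mult.commute)

lemma poly_mapping_single_induct [case_names zero single add]:
  fixes p :: "'m \<Rightarrow>\<^sub>0 'k::ab_group_add"
  assumes "P 0" "\<And>w c. P (Poly_Mapping.single w c)" "\<And>p r. P p \<Longrightarrow> P r \<Longrightarrow> P (p + r)"
  shows "P p"
proof (induction p rule: update_induct)
  case const
  then show ?case using assms(1) by simp
next
  case (update p w v)
  have "Poly_Mapping.update w v p = p + Poly_Mapping.single w v"
    using update(1) by (intro poly_mapping_eqI)
      (auto simp: lookup_update lookup_add lookup_single when_def in_keys_iff)
  then show ?case
    using update assms(2,3) by simp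
qed

lemma const_alg_commute: "const_alg c * p = p * const_alg c"
  by (induction p rule: poly_mapping_single_induct)
    (simp_all add: const_alg_single distrib_left distrib_right)

definition extend_linear ::
    "('k::comm_ring_1 \<Rightarrow> 'r::ring_1) \<Rightarrow> ('m \<Rightarrow> 'r) \<Rightarrow> ('m \<Rightarrow>\<^sub>0 'k) \<Rightarrow> 'r" where
  "extend_linear \<zeta> f p = (\<Sum>w\<in>Poly_Mapping.keys p. \<zeta> (Poly_Mapping.lookup p w) * f w)"

text \<open>A ring homomorphism into the centre makes \<open>'r\<close> an algebra over
  \<open>'k\<close>. Instances are \<open>scalar\<close> on the free algebra,
  \<open>laurent_heis\<close> and \<open>const_alg\<close> on group algebras, and the identity of
  the complex numbers.\<close>

locale coefficient_hom =
  fixes \<zeta> :: "'k::comm_ring_1 \<Rightarrow> 'r::ring_1"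
  assumes hom_add: "\<zeta> (c + d) = \<zeta> c + \<zeta> d"
    and hom_mult: "\<zeta> (c * d) = \<zeta> c * \<zeta> d"
    and hom_1 [simp]: "\<zeta> 1 = 1"
    and hom_central: "\<zeta> c * x = x * \<zeta> c"
begin

lemma hom_0 [simp]: "\<zeta> 0 = 0"
  using hom_add[of 0 0] by simp

lemma hom_minus: "\<zeta> (- c) = - \<zeta> c"
  using hom_add[of c "- c"] by (simp add: eq_neg_iff_add_eq_0 add.commute)

lemma hom_diff: "\<zeta> (c - d) = \<zeta> c - \<zeta> d"
  using hom_add[of c "- d"] by (simp add: hom_minus)

lemma extend_linear_superset:
  assumes "finite K" "Poly_Mapping.keys p \<subseteq> K"
  shows "extend_linear \<zeta> f p = (\<Sum>w\<in>K. \<zeta> (Poly_Mapping.lookup p w) * f w)"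
  unfolding extend_linear_def
  using assms by (intro sum.mono_neutral_left) (auto simp: in_keys_iff)

lemma extend_linear_add: "extend_linear \<zeta> f (p + r) = extend_linear \<zeta> f p + extend_linear \<zeta> f r"
proof -
  define K where "K = Poly_Mapping.keys p \<union> Poly_Mapping.keys r"
  have K: "finite K" "Poly_Mapping.keys p \<subseteq> K" "Poly_Mapping.keys r \<subseteq> K"
    "Poly_Mapping.keys (p + r) \<subseteq> K"
    using Poly_Mapping.keys_add[of p r] by (auto simp: K_def)
  show ?thesis
    by (simp add: extend_linear_superset[OF K(1)] K lookup_add hom_add distrib_right sum.distrib)
qed

lemma extend_linear_0 [simp]: "extend_linear \<zeta> f 0 = 0"
  by (simp add: extend_linear_def)

lemma extend_linear_single [simp]: "extend_linear \<zeta> f (Poly_Mapping.single w c) = \<zeta> c * f w"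
  by (cases "c = 0") (simp_all add: extend_linear_def)

lemma extend_linear_minus: "extend_linear \<zeta> f (- p) = - extend_linear \<zeta> f p"
  using extend_linear_add[of f p "- p"] by (simp add: eq_neg_iff_add_eq_0 add.commute)

lemma extend_linear_diff: "extend_linear \<zeta> f (p - r) = extend_linear \<zeta> f p - extend_linear \<zeta> f r"
  using extend_linear_add[of f p "- r"] by (simp add: extend_linear_minus)

lemma extend_linear_sum: "extend_linear \<zeta> f (sum g A) = (\<Sum>a\<in>A. extend_linear \<zeta> f (g a))"
  by (induction A rule: infinite_finite_induct) (simp_all add: extend_linear_add)

end

text \<open>The universal property of a monoid algebra: a multiplicative map on the monoid together
  with a central map on the coefficients determines a ring homomorphism.\<close>

locale algebra_hom = coefficient_hom \<zeta> for \<zeta> :: "'k::comm_ring_1 \<Rightarrow> 'r::ring_1" +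
  fixes f :: "'m::monoid_add \<Rightarrow> 'r"
  assumes f_0: "f 0 = 1" and f_add: "f (u + v) = f u * f v"
begin

lemma extend_mult: "extend_linear \<zeta> f (p * r) = extend_linear \<zeta> f p * extend_linear \<zeta> f r"
proof (induction p rule: poly_mapping_single_induct)
  case (single w c)
  show ?case
  proof (induction r rule: poly_mapping_single_induct)
    case (single w' c')
    have "\<zeta> c * \<zeta> c' * (f w * f w') = \<zeta> c * f w * (\<zeta> c' * f w')"
      by (metis hom_central mult.assoc)
    then show ?case by (simp add: mult_single hom_mult f_add)
  qed (simp_all add: extend_linear_add distrib_left)
qed (simp_all add: extend_linear_add distrib_right)

lemma extend_1 [simp]: "extend_linear \<zeta> f 1 = 1"
  using extend_linear_single[of f 0 1] f_0 by (simp del: extend_linear_single)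

lemma extend_const [simp]: "extend_linear \<zeta> f (const_alg c) = \<zeta> c"
  by (simp add: const_alg_def f_0)

lemma extend_prod_list: "extend_linear \<zeta> f (prod_list ps) = prod_list (map (extend_linear \<zeta> f) ps)"
  by (induction ps) (simp_all add: extend_mult)

end

lemma coefficient_hom_const_alg: "coefficient_hom (const_alg :: 'k::comm_ring_1 \<Rightarrow> ('m::monoid_add \<Rightarrow>\<^sub>0 'k))"
  by standard (simp_all add: const_alg_add const_alg_mult, rule const_alg_commute)

section \<open>The reflection equation\<close>

text \<open>Matrices are functions on all indices, and only the summation is restricted to
  \<open>P\<close>. Associativity then holds without membership conditions, so that long products
  can be rewritten.\<close>

definition mat_mult :: "'p set \<Rightarrow> ('p \<Rightarrow> 'p \<Rightarrow> 'r::semiring_0) \<Rightarrow> ('p \<Rightarrow> 'p \<Rightarrow> 'r) \<Rightarrow> 'p \<Rightarrow> 'p \<Rightarrow> 'r" where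
  "mat_mult P Xm Y = (\<lambda>p r. \<Sum>s\<in>P. Xm p s * Y s r)"

lemma mat_mult_assoc:
  "mat_mult P (mat_mult P Xm Y) Z = mat_mult P Xm (mat_mult P Y Z)"
proof (intro ext)
  fix p r
  have "mat_mult P (mat_mult P Xm Y) Z p r = (\<Sum>s\<in>P. \<Sum>t\<in>P. Xm p t * (Y t s * Z s r))"
    by (simp add: mat_mult_def sum_distrib_right mult.assoc)
  also have "\<dots> = (\<Sum>t\<in>P. \<Sum>s\<in>P. Xm p t * (Y t s * Z s r))"
    by (rule sum.swap)
  also have "\<dots> = mat_mult P Xm (mat_mult P Y Z) p r"
    by (simp add: mat_mult_def sum_distrib_left)
  finally show "mat_mult P (mat_mult P Xm Y) Z p r = mat_mult P Xm (mat_mult P Y Z) p r" .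
qed

section \<open>The R-matrix and the two tensor legs of a matrix\<close>

locale r_matrix = coefficient_hom sc for sc :: "'k::comm_ring_1 \<Rightarrow> 'r::ring_1" +
  fixes I :: "nat set" and q h :: 'k
  assumes finite_I: "finite I"
begin

abbreviation pair_mult (infixr "\<diamondop>" 70) where
  "pair_mult \<equiv> mat_mult (I \<times> I)"

abbreviation entry_mult (infixr "\<triangleleft>" 70) where
  "entry_mult \<equiv> mat_mult I"

text \<open>In tensor notation this is T \<otimes> 1, and \<open>leg2 T\<close> is 1 \<otimes> T,
  with row (i, j) and column (k, l). Entries with an index outside \<open>I\<close> are set to zero,
  so that identities between products hold as equations of functions.\<close>

definition leg1 :: "(nat \<Rightarrow> nat \<Rightarrow> 'r) \<Rightarrow> nat \<times> nat \<Rightarrow> nat \<times> nat \<Rightarrow> 'r" where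
  "leg1 T = (\<lambda>(i, j) (k, l). if i \<in> I \<and> j \<in> I \<and> k \<in> I \<and> j = l then T i k else 0)"

definition leg2 :: "(nat \<Rightarrow> nat \<Rightarrow> 'r) \<Rightarrow> nat \<times> nat \<Rightarrow> nat \<times> nat \<Rightarrow> 'r" where
  "leg2 T = (\<lambda>(i, j) (k, l). if i \<in> I \<and> j \<in> I \<and> l \<in> I \<and> i = k then T j l else 0)"

text \<open>For h = q - q^{-1} this is the R-matrix of the quantum general linear group: the sum of
  q^{\<delta>_ij} E_ii \<otimes> E_jj plus h times the sum of E_ij \<otimes> E_ji over i <
  j.\<close>

definition R_mat :: "nat \<times> nat \<Rightarrow> nat \<times> nat \<Rightarrow> 'r" where
  "R_mat = (\<lambda>(i, j) (k, l). if i \<in> I \<and> j \<in> I \<and> k \<in> I \<and> l \<in> I then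
     (if i = k \<and> j = l then sc (q ^ of_bool (i = j)) else 0)
     + (if j = k \<and> i = l then sc (h * of_bool (i < j)) else 0) else 0)"

text \<open>\<open>R_mat\<close> with the first tensor factor transposed: E_ij \<otimes> E_ji
  becomes E_ji \<otimes> E_ji, whose row is (j, j) and whose column is (i, i).\<close>

definition R_transposed :: "nat \<times> nat \<Rightarrow> nat \<times> nat \<Rightarrow> 'r" where
  "R_transposed = (\<lambda>(i, j) (k, l). if i \<in> I \<and> j \<in> I \<and> k \<in> I \<and> l \<in> I then
     (if i = k \<and> j = l then sc (q ^ of_bool (i = j)) else 0)
     + (if i = j \<and> k = l then sc (h * of_bool (k < i)) else 0) else 0)"

abbreviation (input) flip :: "(nat \<Rightarrow> nat \<Rightarrow> 'r) \<Rightarrow> nat \<Rightarrow> nat \<Rightarrow> 'r" where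
  "flip T \<equiv> \<lambda>i j. T j i"

lemma sum_pairs: "(\<Sum>p\<in>I \<times> I. f p) = (\<Sum>k\<in>I. \<Sum>l\<in>I. f (k, l))"
  by (simp add: sum.cartesian_product)

lemma sum_only:
  assumes "k \<in> A" "finite A" "\<And>l. l \<in> A \<Longrightarrow> l \<noteq> k \<Longrightarrow> f l = 0"
  shows "sum f A = f k"
  using assms sum.remove[of A k f] by (simp add: sum.neutral)

lemma outside:
  assumes "\<not> (i \<in> I \<and> j \<in> I \<and> k \<in> I \<and> l \<in> I)"
  shows "leg1 T (i, j) (k, l) = 0" "leg2 T (i, j) (k, l) = 0" "R_mat (i, j) (k, l) = 0"
    "R_transposed (i, j) (k, l) = 0"
proof -
  show "leg1 T (i, j) (k, l) = 0"
    using assms by (auto simp: leg1_def)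
  show "leg2 T (i, j) (k, l) = 0"
    using assms by (auto simp: leg2_def)
  show "R_mat (i, j) (k, l) = 0" "R_transposed (i, j) (k, l) = 0"
    unfolding R_mat_def R_transposed_def prod.case by (rule if_not_P[OF assms])+
qed

lemma leg1_mult:
  assumes "i \<in> I" "j \<in> I"
  shows "(leg1 T \<diamondop> Xm) (i, j) r = (\<Sum>m\<in>I. T i m * Xm (m, j) r)"
  unfolding mat_mult_def sum_pairs
proof (rule sum.cong[OF refl])
  fix k assume "k \<in> I"
  then show "(\<Sum>l\<in>I. leg1 T (i, j) (k, l) * Xm (k, l) r) = T i k * Xm (k, j) r"
    using assms finite_I by (subst sum_only[of j]) (auto simp: leg1_def)
qed

lemma leg2_mult:
  assumes "i \<in> I" "j \<in> I"
  shows "(leg2 T \<diamondop> Xm) (i, j) r = (\<Sum>m\<in>I. T j m * Xm (i, m) r)"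
proof -
  have "(leg2 T \<diamondop> Xm) (i, j) r = (\<Sum>l\<in>I. leg2 T (i, j) (i, l) * Xm (i, l) r)"
    using assms finite_I unfolding mat_mult_def sum_pairs
    by (subst sum_only[of i]) (auto simp: leg2_def)
  then show ?thesis using assms by (simp add: leg2_def)
qed

lemma leg12:
  assumes "i \<in> I" "j \<in> I" "a \<in> I" "b \<in> I"
  shows "(leg1 T \<diamondop> leg2 U) (i, j) (a, b) = T i a * U j b"
    and "(leg2 U \<diamondop> leg1 T) (i, j) (a, b) = U j b * T i a"
proof -
  show "(leg1 T \<diamondop> leg2 U) (i, j) (a, b) = T i a * U j b"
    unfolding leg1_mult[OF assms(1,2)] using assms finite_I
    by (subst sum_only[of a]) (auto simp: leg2_def)
  show "(leg2 U \<diamondop> leg1 T) (i, j) (a, b) = U j b * T i a"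
    unfolding leg2_mult[OF assms(1,2)] using assms finite_I
    by (subst sum_only[of b]) (auto simp: leg1_def)
qed

lemma sum_if_mult_left:
  fixes f :: "'p \<Rightarrow> 'r"
  assumes "c \<in> A" "finite A"
  shows "(\<Sum>p\<in>A. (if p = c then y else 0) * f p) = y * f c"
proof -
  have "(\<Sum>p\<in>A. (if p = c then y else 0) * f p) = (\<Sum>p\<in>A. if p = c then y * f c else 0)"
    by (rule sum.cong) auto
  then show ?thesis using assms by simp
qed

lemma sum_if_mult_right:
  fixes f :: "'p \<Rightarrow> 'r"
  assumes "c \<in> A" "finite A"
  shows "(\<Sum>p\<in>A. f p * (if p = c then y else 0)) = f c * y"
proof -
  have "(\<Sum>p\<in>A. f p * (if p = c then y else 0)) = (\<Sum>p\<in>A. if p = c then f c * y else 0)"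
    by (rule sum.cong) auto
  then show ?thesis using assms by simp
qed

lemma R_row:
  assumes "i \<in> I" "j \<in> I"
  shows "R_mat (i, j) p
    = (if p = (i, j) then sc (q ^ of_bool (i = j)) else 0) + (if p = (j, i) then sc (h * of_bool (i < j)) else 0)"
proof -
  obtain k l where p: "p = (k, l)" by (cases p)
  have c1: "(k, l) = (i, j) \<longleftrightarrow> i = k \<and> j = l" and c2: "(k, l) = (j, i) \<longleftrightarrow> j = k \<and> i = l"
    by blast+
  show ?thesis
  proof (cases "k \<in> I \<and> l \<in> I")
    case True
    then show ?thesis unfolding p c1 c2 R_mat_def prod.case using assms by (simp only: if_True simp_thms)
  next
    case False
    then have "\<not> (i = k \<and> j = l)" "\<not> (j = k \<and> i = l)" using assms by blast+
    moreover have "R_mat (i, j) (k, l) = 0" using outside(3)[of i j k l] False by blast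
    ultimately show ?thesis unfolding p c1 c2 by (simp only: if_False add_0_left)
  qed
qed

lemma R_column:
  assumes "a \<in> I" "b \<in> I"
  shows "R_mat p (a, b)
    = (if p = (a, b) then sc (q ^ of_bool (a = b)) else 0) + (if p = (b, a) then sc (h * of_bool (b < a)) else 0)"
proof -
  obtain k l where p: "p = (k, l)" by (cases p)
  have c1: "(k, l) = (a, b) \<longleftrightarrow> k = a \<and> l = b" and c2: "(k, l) = (b, a) \<longleftrightarrow> l = a \<and> k = b"
    by blast+
  have 1: "(if k = a \<and> l = b then sc (q ^ of_bool (k = l)) else 0)
      = (if k = a \<and> l = b then sc (q ^ of_bool (a = b)) else 0)"
    by (cases "k = a \<and> l = b") (simp_all only: if_True if_False)
  have 2: "(if l = a \<and> k = b then sc (h * of_bool (k < l)) else 0)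
      = (if l = a \<and> k = b then sc (h * of_bool (b < a)) else 0)"
    by (cases "l = a \<and> k = b") (simp_all only: if_True if_False)
  show ?thesis
  proof (cases "k \<in> I \<and> l \<in> I")
    case True
    then show ?thesis unfolding p c1 c2 R_mat_def prod.case using assms
      by (simp only: if_True simp_thms 1 2)
  next
    case False
    then have "\<not> (k = a \<and> l = b)" "\<not> (l = a \<and> k = b)" using assms by blast+
    moreover have "R_mat (k, l) (a, b) = 0" using outside(3)[of k l a b] False by blast
    ultimately show ?thesis unfolding p c1 c2 by (simp only: if_False add_0_left)
  qed
qed

lemma sc_left: "x * (sc c * y) = sc c * (x * y)"
  by (metis hom_central mult.assoc)

lemma R_mult:
  assumes "i \<in> I" "j \<in> I"
  shows "(R_mat \<diamondop> Xm) (i, j) r = sc (q ^ of_bool (i = j)) * Xm (i, j) r + sc (h * of_bool (i < j)) * Xm (j, i) r"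
  unfolding mat_mult_def R_row[OF assms] distrib_right sum.distrib
  using assms finite_I by (simp add: sum_if_mult_left)

lemma mult_R:
  assumes "a \<in> I" "b \<in> I"
  shows "(Xm \<diamondop> R_mat) p (a, b) = Xm p (a, b) * sc (q ^ of_bool (a = b)) + Xm p (b, a) * sc (h * of_bool (b < a))"
  unfolding mat_mult_def R_column[OF assms] distrib_left sum.distrib
  using assms finite_I by (simp add: sum_if_mult_right)

lemma R_transposed_leg2:
  assumes I: "i \<in> I" "j \<in> I" "a \<in> I" "b \<in> I"
  shows "(R_transposed \<diamondop> leg2 U) (i, j) (a, b)
    = (if i = a then sc (q ^ of_bool (i = j)) * U j b else 0)
      + (if i = j then sc (h * of_bool (a < i)) * U a b else 0)"
proof -
  define y where "y = (if i = a then sc (q ^ of_bool (i = j)) else 0)"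
  define z where "z = (if i = j then sc (h * of_bool (a < i)) else 0)"
  have "(R_transposed \<diamondop> leg2 U) (i, j) (a, b) = (\<Sum>l\<in>I. R_transposed (i, j) (a, l) * leg2 U (a, l) (a, b))"
    unfolding mat_mult_def sum_pairs using I finite_I
    by (subst sum_only[of a]) (simp_all add: leg2_def)
  also have "\<dots> = (\<Sum>l\<in>I. ((if l = j then y else 0) + (if l = a then z else 0)) * U l b)"
  proof (rule sum.cong[OF refl])
    fix l assume "l \<in> I"
    with I have "R_transposed (i, j) (a, l) = (if l = j then y else 0) + (if l = a then z else 0)"
      by (simp add: R_transposed_def y_def z_def eq_commute[of j l] eq_commute[of a l])
    then show "R_transposed (i, j) (a, l) * leg2 U (a, l) (a, b)
        = ((if l = j then y else 0) + (if l = a then z else 0)) * U l b"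
      using I \<open>l \<in> I\<close> by (simp add: leg2_def)
  qed
  also have "\<dots> = y * U j b + z * U a b"
    unfolding distrib_right sum.distrib using I finite_I by (simp add: sum_if_mult_left)
  finally show ?thesis by (simp add: y_def z_def)
qed

lemma R_transposed_leg1:
  assumes I: "i \<in> I" "j \<in> I" "a \<in> I" "b \<in> I"
  shows "(R_transposed \<diamondop> leg1 U) (i, j) (a, b)
    = (if j = b then sc (q ^ of_bool (i = j)) * U i a else 0)
      + (if i = j then sc (h * of_bool (b < i)) * U b a else 0)"
proof -
  define y where "y = (if j = b then sc (q ^ of_bool (i = j)) else 0)"
  define z where "z = (if i = j then sc (h * of_bool (b < i)) else 0)"
  have "(R_transposed \<diamondop> leg1 U) (i, j) (a, b) = (\<Sum>k\<in>I. R_transposed (i, j) (k, b) * leg1 U (k, b) (a, b))"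
    unfolding mat_mult_def sum_pairs
  proof (rule sum.cong[OF refl])
    fix k assume "k \<in> I"
    then show "(\<Sum>l\<in>I. R_transposed (i, j) (k, l) * leg1 U (k, l) (a, b))
        = R_transposed (i, j) (k, b) * leg1 U (k, b) (a, b)"
      using I finite_I by (subst sum_only[of b]) (simp_all add: leg1_def)
  qed
  also have "\<dots> = (\<Sum>k\<in>I. ((if k = i then y else 0) + (if k = b then z else 0)) * U k a)"
  proof (rule sum.cong[OF refl])
    fix k assume "k \<in> I"
    with I have "R_transposed (i, j) (k, b) = (if k = i then y else 0) + (if k = b then z else 0)"
      by (simp add: R_transposed_def y_def z_def eq_commute[of i k])
    then show "R_transposed (i, j) (k, b) * leg1 U (k, b) (a, b)
        = ((if k = i then y else 0) + (if k = b then z else 0)) * U k a"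
      using I \<open>k \<in> I\<close> by (simp add: leg1_def)
  qed
  also have "\<dots> = y * U i a + z * U b a"
    unfolding distrib_right sum.distrib using I finite_I by (simp add: sum_if_mult_left)
  finally show ?thesis by (simp add: y_def z_def)
qed

lemma leg1_Rt_leg2:
  assumes I: "i \<in> I" "j \<in> I" "a \<in> I" "b \<in> I"
  shows "(leg1 T \<diamondop> R_transposed \<diamondop> leg2 U) (i, j) (a, b)
    = sc (q ^ of_bool (a = j)) * (T i a * U j b) + sc (h * of_bool (a < j)) * (T i j * U a b)"
proof -
  define y where "y = sc (q ^ of_bool (a = j)) * U j b"
  define z where "z = sc (h * of_bool (a < j)) * U a b"
  have "(leg1 T \<diamondop> R_transposed \<diamondop> leg2 U) (i, j) (a, b)
     = (\<Sum>m\<in>I. T i m * ((if m = a then y else 0) + (if m = j then z else 0)))"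
    unfolding leg1_mult[OF I(1,2)]
  proof (rule sum.cong[OF refl])
    fix m assume "m \<in> I"
    then show "T i m * (R_transposed \<diamondop> leg2 U) (m, j) (a, b)
        = T i m * ((if m = a then y else 0) + (if m = j then z else 0))"
      using I by (simp add: R_transposed_leg2 y_def z_def)
  qed
  also have "\<dots> = T i a * y + T i j * z"
    unfolding distrib_left sum.distrib using I finite_I by (simp add: sum_if_mult_right)
  also have "\<dots> = sc (q ^ of_bool (a = j)) * (T i a * U j b) + sc (h * of_bool (a < j)) * (T i j * U a b)"
    by (simp only: y_def z_def sc_left)
  finally show ?thesis .
qed

lemma leg2_Rt_leg1:
  assumes I: "i \<in> I" "j \<in> I" "a \<in> I" "b \<in> I"
  shows "(leg2 T \<diamondop> R_transposed \<diamondop> leg1 U) (i, j) (a, b)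
    = sc (q ^ of_bool (i = b)) * (T j b * U i a) + sc (h * of_bool (b < i)) * (T j i * U b a)"
proof -
  define y where "y = sc (q ^ of_bool (i = b)) * U i a"
  define z where "z = sc (h * of_bool (b < i)) * U b a"
  have "(leg2 T \<diamondop> R_transposed \<diamondop> leg1 U) (i, j) (a, b)
     = (\<Sum>m\<in>I. T j m * ((if m = b then y else 0) + (if m = i then z else 0)))"
    unfolding leg2_mult[OF I(1,2)]
  proof (rule sum.cong[OF refl])
    fix m assume "m \<in> I"
    then show "T j m * (R_transposed \<diamondop> leg1 U) (i, m) (a, b)
        = T j m * ((if m = b then y else 0) + (if m = i then z else 0))"
      using I by (simp add: R_transposed_leg1 y_def z_def eq_commute[of i m])
  qed
  also have "\<dots> = T j b * y + T j i * z"
    unfolding distrib_left sum.distrib using I finite_I by (simp add: sum_if_mult_right)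
  also have "\<dots> = sc (q ^ of_bool (i = b)) * (T j b * U i a) + sc (h * of_bool (b < i)) * (T j i * U b a)"
    by (simp only: y_def z_def sc_left)
  finally show ?thesis .
qed

lemma supported_eqI:
  assumes "\<And>i j a b. \<lbrakk>i \<in> I; j \<in> I; a \<in> I; b \<in> I\<rbrakk> \<Longrightarrow> Xm (i, j) (a, b) = Y (i, j) (a, b)"
    and "\<And>i j a b. \<not> (i \<in> I \<and> j \<in> I \<and> a \<in> I \<and> b \<in> I) \<Longrightarrow> Xm (i, j) (a, b) = 0"
    and "\<And>i j a b. \<not> (i \<in> I \<and> j \<in> I \<and> a \<in> I \<and> b \<in> I) \<Longrightarrow> Y (i, j) (a, b) = 0"
  shows "Xm = Y"
proof (intro ext)
  fix p r show "Xm p r = Y p r"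
    using assms by (cases p, cases r) metis
qed

lemma mult_outside:
  assumes "\<And>i j k l. \<not> (i \<in> I \<and> j \<in> I \<and> k \<in> I \<and> l \<in> I) \<Longrightarrow> Xm (i, j) (k, l) = 0"
    and "\<And>i j k l. \<not> (i \<in> I \<and> j \<in> I \<and> k \<in> I \<and> l \<in> I) \<Longrightarrow> Y (i, j) (k, l) = 0"
    and "\<not> (i \<in> I \<and> j \<in> I \<and> a \<in> I \<and> b \<in> I)"
  shows "(Xm \<diamondop> Y) (i, j) (a, b) = 0"
  unfolding mat_mult_def using assms by (intro sum.neutral) (auto split: prod.splits)

section \<open>Exchange relations and the reflection equation in matrix form\<close>

definition exchange :: "(nat \<Rightarrow> nat \<Rightarrow> 'r) \<Rightarrow> (nat \<Rightarrow> nat \<Rightarrow> 'r) \<Rightarrow> bool" where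
  "exchange T U \<longleftrightarrow> (\<forall>i\<in>I. \<forall>a\<in>I. \<forall>j\<in>I. \<forall>b\<in>I.
     sc (q ^ of_bool (i = j)) * (T i a * U j b) + sc (h * of_bool (i < j)) * (T j a * U i b)
     = sc (q ^ of_bool (a = b)) * (U j b * T i a) + sc (h * of_bool (b < a)) * (U j a * T i b))"

lemmas outside_rules = mult_outside outside

text \<open>The matrix form R T_1 U_2 = U_2 T_1 R is the one that composes; the form by entries is
  the one that can be checked for oscillators.\<close>

lemma exchange_matrix: "exchange T U \<longleftrightarrow> R_mat \<diamondop> leg1 T \<diamondop> leg2 U = leg2 U \<diamondop> leg1 T \<diamondop> R_mat"
proof
  assume ex: "exchange T U"
  show "R_mat \<diamondop> leg1 T \<diamondop> leg2 U = leg2 U \<diamondop> leg1 T \<diamondop> R_mat"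
  proof (rule supported_eqI)
    fix i j a b assume I: "i \<in> I" "j \<in> I" "a \<in> I" "b \<in> I"
    have "(R_mat \<diamondop> leg1 T \<diamondop> leg2 U) (i, j) (a, b)
        = sc (q ^ of_bool (i = j)) * (T i a * U j b) + sc (h * of_bool (i < j)) * (T j a * U i b)"
      using I by (simp add: R_mult leg12)
    also have "\<dots> = sc (q ^ of_bool (a = b)) * (U j b * T i a) + sc (h * of_bool (b < a)) * (U j a * T i b)"
      using ex I unfolding exchange_def by blast
    also have "\<dots> = (leg2 U \<diamondop> leg1 T \<diamondop> R_mat) (i, j) (a, b)"
      unfolding mat_mult_assoc[symmetric] using I by (simp add: mult_R leg12 hom_central)
    finally show "(R_mat \<diamondop> leg1 T \<diamondop> leg2 U) (i, j) (a, b) = (leg2 U \<diamondop> leg1 T \<diamondop> R_mat) (i, j) (a, b)" .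
  qed (intro outside_rules; assumption)+
next
  assume eq: "R_mat \<diamondop> leg1 T \<diamondop> leg2 U = leg2 U \<diamondop> leg1 T \<diamondop> R_mat"
  show "exchange T U"
    unfolding exchange_def
  proof (intro ballI)
    fix i a j b assume I: "i \<in> I" "a \<in> I" "j \<in> I" "b \<in> I"
    have "sc (q ^ of_bool (i = j)) * (T i a * U j b) + sc (h * of_bool (i < j)) * (T j a * U i b)
        = (R_mat \<diamondop> leg1 T \<diamondop> leg2 U) (i, j) (a, b)"
      using I by (simp add: R_mult leg12)
    also have "\<dots> = ((leg2 U \<diamondop> leg1 T) \<diamondop> R_mat) (i, j) (a, b)"
      by (simp add: eq mat_mult_assoc)
    also have "\<dots> = sc (q ^ of_bool (a = b)) * (U j b * T i a) + sc (h * of_bool (b < a)) * (U j a * T i b)"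
      using I by (simp add: mult_R leg12 hom_central)
    finally show "sc (q ^ of_bool (i = j)) * (T i a * U j b) + sc (h * of_bool (i < j)) * (T j a * U i b)
        = sc (q ^ of_bool (a = b)) * (U j b * T i a) + sc (h * of_bool (b < a)) * (U j a * T i b)" .
  qed
qed

lemma leg1_comp: "leg1 (T \<triangleleft> U) = leg1 T \<diamondop> leg1 U"
proof (rule supported_eqI)
  fix i j a b assume "i \<in> I" "j \<in> I" "a \<in> I" "b \<in> I"
  then show "leg1 (T \<triangleleft> U) (i, j) (a, b) = (leg1 T \<diamondop> leg1 U) (i, j) (a, b)"
    by (cases "j = b") (simp_all add: leg1_mult, simp_all add: leg1_def mat_mult_def)
qed (intro outside_rules; assumption)+

lemma leg2_comp: "leg2 (T \<triangleleft> U) = leg2 T \<diamondop> leg2 U"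
proof (rule supported_eqI)
  fix i j a b assume "i \<in> I" "j \<in> I" "a \<in> I" "b \<in> I"
  then show "leg2 (T \<triangleleft> U) (i, j) (a, b) = (leg2 T \<diamondop> leg2 U) (i, j) (a, b)"
    by (cases "i = a") (simp_all add: leg2_mult, simp_all add: leg2_def mat_mult_def)
qed (intro outside_rules; assumption)+

definition entries_commute :: "(nat \<Rightarrow> nat \<Rightarrow> 'r) \<Rightarrow> (nat \<Rightarrow> nat \<Rightarrow> 'r) \<Rightarrow> bool" where
  "entries_commute T U \<longleftrightarrow> (\<forall>i\<in>I. \<forall>a\<in>I. \<forall>j\<in>I. \<forall>b\<in>I. T i a * U j b = U j b * T i a)"

lemma leg12_commute:
  assumes "entries_commute T U"
  shows "leg1 T \<diamondop> leg2 U = leg2 U \<diamondop> leg1 T"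
proof (rule supported_eqI)
  fix i j a b assume "i \<in> I" "j \<in> I" "a \<in> I" "b \<in> I"
  then show "(leg1 T \<diamondop> leg2 U) (i, j) (a, b) = (leg2 U \<diamondop> leg1 T) (i, j) (a, b)"
    using assms by (simp add: leg12 entries_commute_def)
qed (intro outside_rules; assumption)+

lemma mult_left_cong: "Xm = Y \<Longrightarrow> Xm \<diamondop> Z = Y \<diamondop> Z"
  by simp

text \<open>Matrix multiplication is the coproduct of the quantum group. Commuting entries allow the
  inner legs to be interchanged, R T_1 U_1 T'_2 U'_2 = R T_1 T'_2 U_1 U'_2, after which the two
  relations are applied in turn.\<close>

lemma exchange_comp:
  assumes T: "exchange T T'" and U: "exchange U U'"
    and c1: "entries_commute U T'" and c2: "entries_commute T U'"
  shows "exchange (T \<triangleleft> U) (T' \<triangleleft> U')"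
proof -
  note T = T[unfolded exchange_matrix, THEN mult_left_cong, unfolded mat_mult_assoc]
    and U = U[unfolded exchange_matrix]
    and c1 = leg12_commute[OF c1, THEN mult_left_cong, unfolded mat_mult_assoc]
    and c2 = leg12_commute[OF c2, THEN mult_left_cong, unfolded mat_mult_assoc]
  show ?thesis
    unfolding exchange_matrix leg1_comp leg2_comp mat_mult_assoc
    by (simp only: c1 T U c2)
qed

text \<open>An entry of this equation is the quadratic defining relation before the products common
  to both sides are combined.\<close>

definition reflection :: "(nat \<Rightarrow> nat \<Rightarrow> 'r) \<Rightarrow> bool" where
  "reflection Sm \<longleftrightarrow> R_mat \<diamondop> leg1 Sm \<diamondop> R_transposed \<diamondop> leg2 Sm = leg2 Sm \<diamondop> R_transposed \<diamondop> leg1 Sm \<diamondop> R_mat"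

lemma reflection_left:
  assumes "i \<in> I" "j \<in> I" "a \<in> I" "b \<in> I"
  shows "(R_mat \<diamondop> leg1 Sm \<diamondop> R_transposed \<diamondop> leg2 Sm) (i, j) (a, b)
    = sc (q ^ of_bool (i = j)) * (sc (q ^ of_bool (a = j)) * (Sm i a * Sm j b) + sc (h * of_bool (a < j)) * (Sm i j * Sm a b))
      + sc (h * of_bool (i < j)) * (sc (q ^ of_bool (a = i)) * (Sm j a * Sm i b) + sc (h * of_bool (a < i)) * (Sm j i * Sm a b))"
  using assms by (simp add: R_mult leg1_Rt_leg2)

lemma reflection_right:
  assumes "i \<in> I" "j \<in> I" "a \<in> I" "b \<in> I"
  shows "(leg2 Sm \<diamondop> R_transposed \<diamondop> leg1 Sm \<diamondop> R_mat) (i, j) (a, b)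
    = sc (q ^ of_bool (a = b)) * (sc (q ^ of_bool (i = b)) * (Sm j b * Sm i a) + sc (h * of_bool (b < i)) * (Sm j i * Sm b a))
      + sc (h * of_bool (b < a)) * (sc (q ^ of_bool (i = a)) * (Sm j a * Sm i b) + sc (h * of_bool (a < i)) * (Sm j i * Sm a b))"
proof -
  have "leg2 Sm \<diamondop> R_transposed \<diamondop> leg1 Sm \<diamondop> R_mat = (leg2 Sm \<diamondop> R_transposed \<diamondop> leg1 Sm) \<diamondop> R_mat"
    by (simp only: mat_mult_assoc)
  then show ?thesis
    using assms by (simp add: mult_R leg2_Rt_leg1 hom_central)
qed

text \<open>The coideal construction of solutions of the reflection equation. The legs of T and of
  the transpose of U are moved through R and its partial transpose until the equation for
  \<open>G\<close> stands alone in the middle.\<close>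

lemma reflection_twist:
  assumes TT: "exchange T T" and UU: "exchange U U" and UT: "exchange U T"
    and G: "reflection G"
    and GT: "entries_commute G T" "entries_commute T G" and GU: "entries_commute (flip U) G" "entries_commute G (flip U)"
  shows "reflection (T \<triangleleft> G \<triangleleft> flip U)"
proof -
  \<comment> \<open>Transposing the first leg turns the exchange relation of U and T into
    commutation through \<open>R_transposed\<close>; \<open>b\<close> is the same relation read with
    the tensor factors interchanged.\<close>
  have a: "leg1 (flip U) \<diamondop> R_transposed \<diamondop> leg2 T = leg2 T \<diamondop> R_transposed \<diamondop> leg1 (flip U)"
  proof (rule supported_eqI)
    fix i j a b assume "i \<in> I" "j \<in> I" "a \<in> I" "b \<in> I"
    then show "(leg1 (flip U) \<diamondop> R_transposed \<diamondop> leg2 T) (i, j) (a, b) = (leg2 T \<diamondop> R_transposed \<diamondop> leg1 (flip U)) (i, j) (a, b)"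
      using UT unfolding exchange_def by (simp add: leg1_Rt_leg2 leg2_Rt_leg1)
  qed (intro outside_rules; assumption)+
  have b: "leg1 T \<diamondop> R_transposed \<diamondop> leg2 (flip U) = leg2 (flip U) \<diamondop> R_transposed \<diamondop> leg1 T"
  proof (rule supported_eqI)
    fix i j a b assume "i \<in> I" "j \<in> I" "a \<in> I" "b \<in> I"
    then show "(leg1 T \<diamondop> R_transposed \<diamondop> leg2 (flip U)) (i, j) (a, b) = (leg2 (flip U) \<diamondop> R_transposed \<diamondop> leg1 T) (i, j) (a, b)"
      using UT[unfolded exchange_def, rule_format, of b j i a]
      by (simp add: leg1_Rt_leg2 leg2_Rt_leg1 eq_commute)
  qed (intro outside_rules; assumption)+
  \<comment> \<open>Replacing U by its transpose exchanges the two sides of its own relation,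
    because R transposed in both factors is R with the factors interchanged.\<close>
  have c: "R_mat \<diamondop> leg1 (flip U) \<diamondop> leg2 (flip U) = leg2 (flip U) \<diamondop> leg1 (flip U) \<diamondop> R_mat"
  proof (rule supported_eqI)
    fix i j a b assume I: "i \<in> I" "j \<in> I" "a \<in> I" "b \<in> I"
    have "(R_mat \<diamondop> leg1 (flip U) \<diamondop> leg2 (flip U)) (i, j) (a, b)
        = sc (q ^ of_bool (i = j)) * (U a i * U b j) + sc (h * of_bool (i < j)) * (U a j * U b i)"
      using I by (simp add: R_mult leg12)
    also have "\<dots> = sc (q ^ of_bool (a = b)) * (U b j * U a i) + sc (h * of_bool (b < a)) * (U a j * U b i)"
      using UU[unfolded exchange_def, rule_format, of b j a i] I by (simp add: eq_commute)
    also have "\<dots> = ((leg2 (flip U) \<diamondop> leg1 (flip U)) \<diamondop> R_mat) (i, j) (a, b)"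
      using I by (simp add: mult_R leg12 hom_central)
    finally show "(R_mat \<diamondop> leg1 (flip U) \<diamondop> leg2 (flip U)) (i, j) (a, b) = (leg2 (flip U) \<diamondop> leg1 (flip U) \<diamondop> R_mat) (i, j) (a, b)"
      by (simp only: mat_mult_assoc)
  qed (intro outside_rules; assumption)+
  define T1 T2 where "T1 = leg1 T" and "T2 = leg2 T"
  define G1 G2 where "G1 = leg1 G" and "G2 = leg2 G"
  define U1 U2 where "U1 = leg1 (flip U)" and "U2 = leg2 (flip U)"
  note legs = T1_def T2_def G1_def G2_def U1_def U2_def
  have *: "Xm \<diamondop> Y = Z \<Longrightarrow> Xm \<diamondop> Y \<diamondop> W = Z \<diamondop> W" for Xm Y Z W
    unfolding mat_mult_assoc[symmetric] by simp
  have **: "Xm \<diamondop> Y \<diamondop> V = Z \<Longrightarrow> Xm \<diamondop> Y \<diamondop> V \<diamondop> W = Z \<diamondop> W" for Xm Y Z V W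
    unfolding mat_mult_assoc[symmetric] by simp
  have ***: "Xm \<diamondop> Y \<diamondop> V \<diamondop> V' = Z \<Longrightarrow> Xm \<diamondop> Y \<diamondop> V \<diamondop> V' \<diamondop> W = Z \<diamondop> W" for Xm Y Z V V' W
    unfolding mat_mult_assoc[symmetric] by simp
  have a': "U1 \<diamondop> R_transposed \<diamondop> T2 \<diamondop> W = T2 \<diamondop> R_transposed \<diamondop> U1 \<diamondop> W" for W
    using **[OF a[folded legs], of W] by (simp only: mat_mult_assoc)
  have b': "T1 \<diamondop> R_transposed \<diamondop> U2 \<diamondop> W = U2 \<diamondop> R_transposed \<diamondop> T1 \<diamondop> W" for W
    using **[OF b[folded legs], of W] by (simp only: mat_mult_assoc)
  have c': "R_mat \<diamondop> U1 \<diamondop> U2 = U2 \<diamondop> U1 \<diamondop> R_mat"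
    using c[folded legs] .
  have t: "R_mat \<diamondop> T1 \<diamondop> T2 \<diamondop> W = T2 \<diamondop> T1 \<diamondop> R_mat \<diamondop> W" for W
    using **[OF TT[unfolded exchange_matrix, folded legs], of W] by (simp only: mat_mult_assoc)
  have g: "R_mat \<diamondop> G1 \<diamondop> R_transposed \<diamondop> G2 \<diamondop> W = G2 \<diamondop> R_transposed \<diamondop> G1 \<diamondop> R_mat \<diamondop> W" for W
    using ***[OF G[unfolded reflection_def, folded legs], of W] by (simp only: mat_mult_assoc)
  have g1t2: "G1 \<diamondop> T2 \<diamondop> W = T2 \<diamondop> G1 \<diamondop> W" for W
    using *[OF leg12_commute[OF GT(1), folded legs], of W] by (simp only: mat_mult_assoc)
  have t1g2: "T1 \<diamondop> G2 \<diamondop> W = G2 \<diamondop> T1 \<diamondop> W" for W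
    using *[OF leg12_commute[OF GT(2), folded legs], of W] by (simp only: mat_mult_assoc)
  have u1g2: "U1 \<diamondop> G2 \<diamondop> W = G2 \<diamondop> U1 \<diamondop> W" for W
    using *[OF leg12_commute[OF GU(1), folded legs], of W] by (simp only: mat_mult_assoc)
  have g1u2: "G1 \<diamondop> U2 \<diamondop> W = U2 \<diamondop> G1 \<diamondop> W" for W
    using *[OF leg12_commute[OF GU(2), folded legs], of W] by (simp only: mat_mult_assoc)
  \<comment> \<open>\<open>a'\<close> carries T_2 to the left and U_1 to the right of
    \<open>R_transposed\<close>; the commuting entries of \<open>G\<close> then let both pass, which
    assembles the left side of the reflection equation for \<open>G\<close>.\<close>
  have "R_mat \<diamondop> T1 \<diamondop> G1 \<diamondop> U1 \<diamondop> R_transposed \<diamondop> T2 \<diamondop> G2 \<diamondop> U2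
      = R_mat \<diamondop> T1 \<diamondop> T2 \<diamondop> G1 \<diamondop> R_transposed \<diamondop> G2 \<diamondop> U1 \<diamondop> U2"
    by (simp only: a' g1t2 u1g2)
  also have "\<dots> = T2 \<diamondop> T1 \<diamondop> R_mat \<diamondop> G1 \<diamondop> R_transposed \<diamondop> G2 \<diamondop> U1 \<diamondop> U2"
    by (simp only: t)
  also have "\<dots> = T2 \<diamondop> T1 \<diamondop> G2 \<diamondop> R_transposed \<diamondop> G1 \<diamondop> U2 \<diamondop> U1 \<diamondop> R_mat"
    by (simp only: g c')
  also have "\<dots> = T2 \<diamondop> G2 \<diamondop> U2 \<diamondop> R_transposed \<diamondop> T1 \<diamondop> G1 \<diamondop> U1 \<diamondop> R_mat"
    by (simp only: t1g2 g1u2 b')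
  finally show ?thesis
    unfolding reflection_def leg1_comp leg2_comp legs mat_mult_assoc .
qed

end

section \<open>Oscillator solutions of the exchange relations\<close>

text \<open>By \<open>xi_eta\<close> the products xi_i eta_j form a rank-one matrix with diagonal
  a_i - a_i^{-1}. It is the difference of the lower and the upper triangular solution defined below.
  The factors in \<open>eta_xi\<close> come from moving \<open>xi i\<close> past \<open>a i\<close>
  and \<open>ai i\<close>.\<close>

locale q_oscillator = coefficient_hom sc for sc :: "'k::comm_ring_1 \<Rightarrow> 'r::ring_1" +
  fixes q qi :: 'k and a ai xi eta :: "nat \<Rightarrow> 'r"
  assumes q_qi: "q * qi = 1"
    and a_ai: "a i * ai i = 1" "ai i * a i = 1"
    and a_a: "a i * a j = a j * a i"
    and a_xi: "a i * xi j = sc (if i = j then q else 1) * (xi j * a i)"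
    and a_eta: "a i * eta j = sc (if i = j then qi else 1) * (eta j * a i)"
    and xi_xi: "i < j \<Longrightarrow> xi j * xi i = sc q * (xi i * xi j)"
    and eta_eta: "i < j \<Longrightarrow> eta j * eta i = sc q * (eta i * eta j)"
    and xi_eta_less: "i < j \<Longrightarrow> xi i * eta j = sc q * (eta j * xi i)"
    and xi_eta_greater: "j < i \<Longrightarrow> xi i * eta j = sc qi * (eta j * xi i)"
    and xi_eta: "xi i * eta i = a i - ai i"
    and eta_xi: "eta i * xi i = sc q * a i - sc qi * ai i"
begin

text \<open>\<open>entry True\<close> is the lower triangular solution, \<open>entry False\<close> the upper triangular one.\<close>

definition coef :: "bool \<Rightarrow> nat \<Rightarrow> nat \<Rightarrow> 'k" where
  "coef u i j = (if u then of_bool (j < i) else - of_bool (i < j))"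

definition diag :: "bool \<Rightarrow> nat \<Rightarrow> 'r" where
  "diag u i = (if u then a i else ai i)"

definition entry :: "bool \<Rightarrow> nat \<Rightarrow> nat \<Rightarrow> 'r" where
  "entry u i j = (if i = j then diag u i else sc (coef u i j) * (xi i * eta j))"

text \<open>The factor in the reordering xi_j xi_i = \<open>kap i j\<close> xi_i xi_j, and likewise
  for \<open>eta\<close>.\<close>

definition kap :: "nat \<Rightarrow> nat \<Rightarrow> 'k" where
  "kap i j = (if i < j then q else if i = j then 1 else qi)"

definition qpow :: "bool \<Rightarrow> 'k" where
  "qpow u = (if u then q else qi)"

lemma qi_q: "qi * q = 1"
  using q_qi by (simp add: mult.commute)

lemma q_cancel: "q * (qi * x) = x" "qi * (q * x) = x" "x * q * qi = x" "x * qi * q = x"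
  using q_qi qi_q by (simp_all add: mult.assoc[symmetric]) (simp_all add: mult.assoc)

lemma sc_left: "x * (sc c * y) = sc c * (x * y)"
  by (metis hom_central mult.assoc)

lemmas sc_gen = sc_left[of "xi i" for i] sc_left[of "eta i" for i] sc_left[of "a i" for i]
  sc_left[of "ai i" for i] sc_left[of "diag u i" for u i] sc_left[of "xi i * eta j" for i j]

lemma sc_sc: "sc c * (sc d * y) = sc (c * d) * y"
  by (simp add: hom_mult mult.assoc)

lemma sc_unit: "sc q * (sc qi * y) = y" "sc qi * (sc q * y) = y"
  by (simp_all add: sc_sc q_qi qi_q)

lemma ai_commute:
  assumes "a i * x = sc c * (x * a i)" "c * d = 1"
  shows "ai i * x = sc d * (x * ai i)"
proof -
  have "ai i * (a i * x) * ai i = ai i * (sc c * (x * a i)) * ai i"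
    by (simp only: assms(1))
  then have "x * ai i = sc c * (ai i * x)"
    by (simp add: sc_gen mult.assoc a_ai) (simp add: mult.assoc[symmetric] a_ai)
  then have "sc d * (x * ai i) = sc (d * c) * (ai i * x)"
    by (simp add: sc_sc)
  then show ?thesis using assms(2) by (simp add: mult.commute)
qed

lemma ai_xi: "ai i * xi j = sc (if i = j then qi else 1) * (xi j * ai i)"
  by (rule ai_commute[OF a_xi]) (simp add: q_qi)

lemma ai_eta: "ai i * eta j = sc (if i = j then q else 1) * (eta j * ai i)"
  by (rule ai_commute[OF a_eta]) (simp add: qi_q)

lemma a_ai_commute: "ai i * a j = a j * ai i"
  using ai_commute[of i "a j" 1 1] a_a by simp

lemma ai_ai: "ai i * ai j = ai j * ai i"
  using ai_commute[of i "ai j" 1 1] a_ai_commute[of j i] by simp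

lemma diag_diag: "diag u i * diag t j = diag t j * diag u i"
  by (simp add: diag_def a_a ai_ai a_ai_commute)

lemma diag_xi: "diag u i * xi j = sc (if i = j then qpow u else 1) * (xi j * diag u i)"
  by (simp add: diag_def qpow_def a_xi ai_xi)

lemma diag_eta: "diag u i * eta j = sc (if i = j then qpow (\<not> u) else 1) * (eta j * diag u i)"
  by (simp add: diag_def qpow_def a_eta ai_eta)

section \<open>Reordering and contracting products of oscillators\<close>

lemma eta_xi_neq: "i \<noteq> j \<Longrightarrow> eta j * xi i = sc (kap j i) * (xi i * eta j)"
  using xi_eta_less[of i j] xi_eta_greater[of j i]
  by (cases "i < j") (simp_all add: kap_def sc_unit)

lemma xi_swap: "xi j * xi i = sc (kap i j) * (xi i * xi j)"
  using xi_xi[of i j] xi_xi[of j i]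
  by (cases i j rule: linorder_cases) (simp_all add: kap_def sc_unit)

lemma eta_swap: "eta j * eta i = sc (kap i j) * (eta i * eta j)"
  using eta_eta[of i j] eta_eta[of j i]
  by (cases i j rule: linorder_cases) (simp_all add: kap_def sc_unit)

lemma pair_product:
  assumes "k \<noteq> j"
  shows "(xi i * eta k) * (xi j * eta b) = sc (kap k j) * (xi i * (xi j * (eta k * eta b)))"
proof -
  have "(xi i * eta k) * (xi j * eta b) = xi i * ((eta k * xi j) * eta b)"
    by (simp only: mult.assoc)
  then show ?thesis
    using assms by (simp add: eta_xi_neq[of j k] sc_gen mult.assoc)
qed

lemma swap_pairs_xi:
  "xi j * (xi i * y) = sc (kap i j) * (xi i * (xi j * y))"
  by (simp add: mult.assoc[symmetric] xi_swap[of j i])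

lemma pair_contract: "(xi i * eta k) * (xi k * eta b) = xi i * (sc q * a k - sc qi * ai k) * eta b"
  by (simp add: eta_xi[symmetric] mult.assoc)

lemma a_pair: "\<lbrakk>k \<noteq> i; k \<noteq> b\<rbrakk> \<Longrightarrow> xi i * (a k * eta b) = (xi i * eta b) * a k"
    "\<lbrakk>k \<noteq> i; k \<noteq> b\<rbrakk> \<Longrightarrow> xi i * (ai k * eta b) = (xi i * eta b) * ai k"
  by (simp_all add: a_eta ai_eta mult.assoc)

lemma diag_pair:
  "diag u k * (xi i * eta b) = sc ((if k = i then qpow u else 1) * (if k = b then qpow (\<not> u) else 1)) * ((xi i * eta b) * diag u k)"
proof -
  have "diag u k * (xi i * eta b) = (diag u k * xi i) * eta b"
    by (simp only: mult.assoc)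
  also have "\<dots> = sc (if k = i then qpow u else 1) * (xi i * (diag u k * eta b))"
    by (simp only: diag_xi mult.assoc)
  also have "\<dots> = sc (if k = i then qpow u else 1) * (sc (if k = b then qpow (\<not> u) else 1) * ((xi i * eta b) * diag u k))"
    by (simp only: diag_eta sc_gen mult.assoc)
  finally show ?thesis by (simp only: sc_sc)
qed

lemma contract_left:
  assumes "k \<noteq> i" "k \<noteq> b"
  shows "(xi i * eta k) * (xi k * eta b) = (xi i * eta b) * (sc q * a k - sc qi * ai k)"
  unfolding pair_contract using assms
  by (simp add: left_diff_distrib right_diff_distrib mult.assoc sc_gen a_pair)

text \<open>Here xi_k and eta_k stand at the two ends. Three reorderings bring them together and
  cost the three factors \<open>kap\<close>.\<close>

lemma contract_right:
  assumes "k \<noteq> i" "k \<noteq> b" "b \<noteq> i"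
  shows "(xi k * eta b) * (xi i * eta k) = sc (kap b i * kap i k * kap k b) * ((xi i * eta b) * (a k - ai k))"
proof -
  have "(xi k * eta b) * (xi i * eta k) = sc (kap b i) * (xi k * (xi i * (eta b * eta k)))"
    using assms by (simp add: pair_product)
  also have "\<dots> = sc (kap b i) * (sc (kap i k) * (xi i * (xi k * (sc (kap k b) * (eta k * eta b)))))"
    by (simp only: swap_pairs_xi[of k i] eta_swap[of b k])
  also have "\<dots> = sc (kap b i * kap i k * kap k b) * (xi i * ((xi k * eta k) * eta b))"
    by (simp only: sc_gen sc_sc mult.assoc)
  also have "xi i * ((xi k * eta k) * eta b) = (xi i * eta b) * (a k - ai k)"
    using assms by (simp add: xi_eta left_diff_distrib right_diff_distrib a_pair)
  finally show ?thesis .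
qed

section \<open>The exchange relations of the triangular matrices, by coincidences of indices\<close>

definition exchanged :: "bool \<Rightarrow> bool \<Rightarrow> nat \<Rightarrow> nat \<Rightarrow> nat \<Rightarrow> nat \<Rightarrow> bool" where
  "exchanged u t i k j b \<longleftrightarrow>
     sc (q ^ of_bool (i = j)) * (entry u i k * entry t j b) + sc ((q - qi) * of_bool (i < j)) * (entry u j k * entry t i b)
     = sc (q ^ of_bool (k = b)) * (entry t j b * entry u i k) + sc ((q - qi) * of_bool (b < k)) * (entry t j k * entry u i b)"

lemma entry_diag: "entry u i i = diag u i"
  and entry_off: "i \<noteq> j \<Longrightarrow> entry u i j = sc (coef u i j) * (xi i * eta j)"
  by (simp_all add: entry_def)

lemma product_off: "(sc c * x) * (sc d * y) = sc (c * d) * (x * y)"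
  by (simp add: sc_left[of x] sc_sc mult.assoc)

lemma product_off_left: "(sc c * x) * diag t j = sc c * (x * diag t j)"
  by (simp add: mult.assoc)

lemmas off_simps = entry_diag entry_off product_off product_off_left sc_gen sc_sc

lemma combine: "sc c * w + sc d * w = sc (c + d) * w"
  by (simp add: hom_add distrib_right)

text \<open>The tensor square of \<open>xi\<close> is an eigenvector of the braiding attached to R:
  the two terms of a row of R merge into q times the reordering factor. \<open>kap_sum_right\<close>
  is the same fact for \<open>eta\<close>.\<close>

lemma kap_sum_left: "q ^ of_bool (i = j) + (q - qi) * of_bool (i < j) * kap i j = q * kap i j"
  by (cases i j rule: linorder_cases) (simp_all add: kap_def q_qi left_diff_distrib qi_q)

lemma kap_sum_right: "q ^ of_bool (k = b) * kap k b + (q - qi) * of_bool (b < k) = q"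
  by (cases k b rule: linorder_cases) (simp_all add: kap_def)

lemma kap_less: "i < j \<Longrightarrow> kap i j = q" "j < i \<Longrightarrow> kap i j = qi"
  by (simp_all add: kap_def)

text \<open>The coefficients depend only on which entries lie in the triangles of the two matrices.
  Where a side can carry both of its terms, \<open>kap_sum_left\<close> or
  \<open>kap_sum_right\<close> merges them; in the other sign patterns the surviving terms match
  directly.\<close>

lemma kap_identity:
  assumes neq: "i \<noteq> k" "j \<noteq> b" "j \<noteq> k" "i \<noteq> b" and ut: "u \<Longrightarrow> t"
  shows "q ^ of_bool (i = j) * (coef u i k * coef t j b * kap k j)
      + (q - qi) * of_bool (i < j) * (coef u j k * coef t i b * (kap k i * kap i j))
    = q ^ of_bool (k = b) * (coef t j b * coef u i k * (kap b i * kap i j * kap k b))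
      + (q - qi) * of_bool (b < k) * (coef t j k * coef u i b * (kap k i * kap i j))" (is "?L = ?R")
proof -
  define h where "h = q - qi"
  note sl = kap_sum_left[of i j, folded h_def] and sr = kap_sum_right[of k b, folded h_def]
  have sl': "x * q ^ of_bool (i = j) + h * (of_bool (i < j) * (x * kap i j)) = x * (q * kap i j)" for x
    unfolding sl[symmetric] by (simp add: algebra_simps)
  have sr': "x * (q ^ of_bool (k = b) * kap k b) + h * (of_bool (b < k) * x) = x * q" for x
    by (subst (3) sr[symmetric]) (simp add: algebra_simps)
  consider (uu) u t | (ll) "\<not> u" "\<not> t" | (lu) "\<not> u" t using ut by blast
  then show ?thesis
  proof cases
    case uu
    consider "k < i" "b < j" "k < j" "b < i" | "k < i" "b < j" "j < k" | "k < i" "b < j" "i < b" | "i < k \<or> j < b"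
      using neq by linarith
    then show ?thesis
    proof cases
      case 1
      have "?L = q * q ^ of_bool (i = j) + h * (of_bool (i < j) * (q * kap i j))"
        using uu 1 by (simp add: coef_def kap_less h_def mult_ac)
      also have "\<dots> = (q * kap i j) * (q ^ of_bool (k = b) * kap k b) + h * (of_bool (b < k) * (q * kap i j))"
        unfolding sl' sr' by (simp add: mult_ac)
      also have "\<dots> = ?R"
        using uu 1 by (simp add: coef_def kap_less h_def mult_ac)
      finally show ?thesis .
    next
      case 2
      then show ?thesis using uu by (simp add: coef_def kap_less q_cancel q_qi)
    next
      case 3
      then show ?thesis using uu by (simp add: coef_def kap_less q_cancel qi_q)
    next
      case 4
      then have "of_bool (i < j) * (coef u j k * coef t i b) = of_bool (b < k) * (coef t j k * coef u i b)"
        using uu neq by (auto simp: coef_def)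
      then have "of_bool (i < j) * (coef u j k * coef t i b) * y = of_bool (b < k) * (coef t j k * coef u i b) * y" for y
        by simp
      moreover have "coef u i k * coef t j b = 0" using 4 uu by (auto simp: coef_def)
      ultimately show ?thesis by (simp add: mult.assoc mult.commute[of "coef t j b"])
    qed
  next
    case ll
    consider "i < k" "j < b" "j < k" "i < b" | "i < k" "j < b" "k < j" | "i < k" "j < b" "b < i" | "k < i \<or> b < j"
      using neq by linarith
    then show ?thesis
    proof cases
      case 1
      have "?L = qi * q ^ of_bool (i = j) + h * (of_bool (i < j) * (qi * kap i j))"
        using ll 1 by (simp add: coef_def kap_less h_def mult_ac)
      also have "\<dots> = (qi * kap i j) * (q ^ of_bool (k = b) * kap k b) + h * (of_bool (b < k) * (qi * kap i j))"
        unfolding sl' sr' by (simp add: mult_ac)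
      also have "\<dots> = ?R"
        using ll 1 by (simp add: coef_def kap_less h_def mult_ac)
      finally show ?thesis .
    next
      case 2
      then show ?thesis using ll by (simp add: coef_def kap_less q_cancel qi_q)
    next
      case 3
      then show ?thesis using ll by (simp add: coef_def kap_less q_cancel q_qi)
    next
      case 4
      then have "of_bool (i < j) * (coef u j k * coef t i b) = of_bool (b < k) * (coef t j k * coef u i b)"
        using ll neq by (auto simp: coef_def)
      then have "of_bool (i < j) * (coef u j k * coef t i b) * y = of_bool (b < k) * (coef t j k * coef u i b) * y" for y
        by simp
      moreover have "coef u i k * coef t j b = 0" using 4 ll by (auto simp: coef_def)
      ultimately show ?thesis by (simp add: mult.assoc mult.commute[of "coef t j b"])
    qed
  next
    case lu
    consider "i < k" "b < j" "b < i" "j < k" | "i < k" "b < j" "b < i" "k < j" | "i < k" "b < j" "i < b" "j < k"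
      | "i < k" "b < j" "i < b" "k < j" | "k < i \<or> j < b"
      using neq by linarith
    then show ?thesis
    proof cases
      case 1
      have "?L = - (qi * q ^ of_bool (i = j) + h * (of_bool (i < j) * (qi * kap i j)))"
        using lu 1 by (simp add: coef_def kap_less h_def mult_ac)
      also have "\<dots> = ?R"
        unfolding sl' using lu 1 by (simp add: coef_def kap_less mult_ac q_cancel)
      finally show ?thesis .
    next
      case 2
      then show ?thesis using lu by (simp add: coef_def kap_less q_cancel q_qi)
    next
      case 3
      then show ?thesis using lu by (simp add: coef_def kap_less q_cancel q_qi qi_q)
    next
      case 4
      have "?R = - (1 * (q ^ of_bool (k = b) * kap k b) + h * (of_bool (b < k) * 1))"
        using lu 4 by (simp add: coef_def kap_less h_def mult_ac q_cancel q_qi)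
      also have "\<dots> = ?L"
        unfolding sr' using lu 4 by (simp add: coef_def kap_less)
      finally show ?thesis ..
    next
      case 5
      then have "coef u i k * coef t j b = 0" "coef t j b * coef u i k = 0"
        "\<not> i < j \<or> coef u j k * coef t i b = 0" "\<not> b < k \<or> coef t j k * coef u i b = 0"
        using lu neq by (auto simp: coef_def)
      then show ?thesis by auto
    qed
  qed
qed

text \<open>Without diagonal entries and without a neighbouring pair \<open>eta\<close>,
  \<open>xi\<close> of equal index, every product is a scalar multiple of the one word
  \<open>w\<close>, and only \<open>kap_identity\<close> remains.\<close>

lemma exchanged_generic:
  assumes "i \<noteq> k" "j \<noteq> b" "j \<noteq> k" "i \<noteq> b" and st: "u \<Longrightarrow> t"
  shows "exchanged u t i k j b"
proof -
  define w where "w = xi i * (xi j * (eta k * eta b))"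
  have w1: "(xi i * eta k) * (xi j * eta b) = sc (kap k j) * w"
    using assms by (simp add: pair_product w_def)
  have w2: "(xi j * eta k) * (xi i * eta b) = sc (kap k i * kap i j) * w"
    using assms by (simp add: pair_product swap_pairs_xi[of j i] sc_sc w_def)
  have "(xi j * eta b) * (xi i * eta k) = sc (kap b i) * (xi j * (xi i * (eta b * eta k)))"
    using assms by (simp add: pair_product)
  also have "\<dots> = sc (kap b i) * (sc (kap i j) * (xi i * (xi j * (sc (kap k b) * (eta k * eta b)))))"
    by (simp only: swap_pairs_xi[of j i] eta_swap[of b k])
  also have "\<dots> = sc (kap b i * kap i j * kap k b) * w"
    by (simp only: sc_gen sc_sc w_def mult.assoc)
  finally have w3: "(xi j * eta b) * (xi i * eta k) = sc (kap b i * kap i j * kap k b) * w" .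
  note kap_identity[OF assms]
  then show ?thesis
    unfolding exchanged_def using assms by (simp only: off_simps w1 w2 w3 combine not_False_eq_True simp_thms)
qed

lemma exchanged_row_diag:
  assumes "j \<noteq> b" "j \<noteq> i" "i \<noteq> b" and st: "u \<Longrightarrow> t"
  shows "exchanged u t i i j b"
proof -
  have "of_bool (i < j) * (coef u j i * coef t i b) = of_bool (b < i) * (coef t j i * coef u i b)"
    using assms by (cases u; cases t) (auto simp: coef_def)
  then have "sc ((q - qi) * of_bool (i < j) * (coef u j i * coef t i b))
      = sc ((q - qi) * of_bool (b < i) * (coef t j i * coef u i b))"
    by (simp add: mult.assoc)
  then show ?thesis
    using assms by (simp add: exchanged_def off_simps diag_pair)
qed

lemma exchanged_column_diag:
  assumes "i \<noteq> k" "i \<noteq> j" "k \<noteq> j" and st: "u \<Longrightarrow> t"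
  shows "exchanged u t i k j j"
proof -
  have "of_bool (i < j) * (coef u j k * coef t i j) = of_bool (j < k) * (coef t j k * coef u i j)"
    using assms by (cases u; cases t) (auto simp: coef_def)
  then have "sc ((q - qi) * of_bool (i < j) * (coef u j k * coef t i j))
      = sc ((q - qi) * of_bool (j < k) * (coef t j k * coef u i j))"
    by (simp add: mult.assoc)
  then show ?thesis
    using assms by (simp add: exchanged_def off_simps diag_pair)
qed

lemma exchanged_two_diag:
  assumes st: "u \<Longrightarrow> t"
  shows "exchanged u t i i j j"
proof (cases "i = j")
  case True
  then show ?thesis by (simp add: exchanged_def entry_diag diag_diag)
next
  case False
  have "of_bool (i < j) * (coef u j i * coef t i j) = 0" "of_bool (j < i) * (coef t j i * coef u i j) = 0"
    using assms by (cases u; cases t; auto simp: coef_def)+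
  then have "(q - qi) * of_bool (i < j) * (coef u j i * coef t i j) = 0"
    "(q - qi) * of_bool (j < i) * (coef t j i * coef u i j) = 0"
    by (simp_all only: mult.assoc mult_zero_right)
  then show ?thesis
    using False by (simp add: exchanged_def off_simps diag_diag)
qed

lemmas three_simps = exchanged_def off_simps diag_pair combine coef_def qpow_def q_qi qi_q q_cancel

lemma exchanged_row_corner:
  assumes "i \<noteq> b" and st: "u \<Longrightarrow> t"
  shows "exchanged u t i i i b"
  using assms
  by (cases u; cases t; cases i b rule: linorder_cases) (simp_all add: three_simps left_diff_distrib right_diff_distrib hom_diff)

lemma exchanged_column_corner:
  assumes "i \<noteq> j" and st: "u \<Longrightarrow> t"
  shows "exchanged u t i i j i"
  using assms
  by (cases u; cases t; cases i j rule: linorder_cases) (simp_all add: three_simps left_diff_distrib right_diff_distrib hom_diff)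

lemma exchanged_row_corner':
  assumes "i \<noteq> k" and st: "u \<Longrightarrow> t"
  shows "exchanged u t i k i i"
  using assms
  by (cases u; cases t; cases i k rule: linorder_cases) (simp_all add: three_simps left_diff_distrib right_diff_distrib hom_diff)

lemma exchanged_column_corner':
  assumes "i \<noteq> j" and st: "u \<Longrightarrow> t"
  shows "exchanged u t i j j j"
  using assms
  by (cases u; cases t; cases i j rule: linorder_cases) (simp_all add: three_simps left_diff_distrib right_diff_distrib hom_diff)

text \<open>In the first product eta_j and xi_j are neighbours and contract to diagonal letters; in
  the opposite order they must be brought together. All terms become multiples of \<open>w\<close>
  times \<open>a j\<close> or \<open>ai j\<close>.\<close>

lemma exchanged_chain:
  assumes "i \<noteq> j" "j \<noteq> b" "i \<noteq> b" and st: "u \<Longrightarrow> t"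
  shows "exchanged u t i j j b"
proof -
  define w where "w = xi i * eta b"
  have w1: "(xi i * eta j) * (xi j * eta b) = sc q * (w * a j) - sc qi * (w * ai j)"
    using assms by (simp add: contract_left w_def right_diff_distrib sc_gen)
  have w2: "(xi j * eta b) * (xi i * eta j) = sc (kap b i * kap i j * kap j b) * (w * a j) - sc (kap b i * kap i j * kap j b) * (w * ai j)"
    using assms by (simp add: contract_right w_def right_diff_distrib)
  have w3: "a j * w = w * a j" "ai j * w = w * ai j"
    using assms diag_pair[of True j i b] diag_pair[of False j i b] by (simp_all add: diag_def w_def)
  show ?thesis
    using assms
    by (cases u; cases t; cases "i < j"; cases "j < b"; cases "i < b")
      (simp_all add: exchanged_def off_simps w1 w2 w3 w_def[symmetric] coef_def kap_def q_qi qi_q q_cancel diag_def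
        right_diff_distrib left_diff_distrib hom_diff hom_minus)
qed

lemma exchanged_chain':
  assumes "i \<noteq> k" "i \<noteq> j" "j \<noteq> k" and st: "u \<Longrightarrow> t"
  shows "exchanged u t i k j i"
proof -
  define w where "w = xi j * eta k"
  have w1: "(xi j * eta i) * (xi i * eta k) = sc q * (w * a i) - sc qi * (w * ai i)"
    using assms by (simp add: contract_left w_def right_diff_distrib sc_gen)
  have w2: "(xi i * eta k) * (xi j * eta i) = sc (kap k j * kap j i * kap i k) * (w * a i) - sc (kap k j * kap j i * kap i k) * (w * ai i)"
    using assms by (simp add: contract_right w_def right_diff_distrib)
  have w3: "a i * w = w * a i" "ai i * w = w * ai i"
    using assms diag_pair[of True i j k] diag_pair[of False i j k] by (simp_all add: diag_def w_def)
  show ?thesis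
    using assms
    by (cases u; cases t; cases "i < j"; cases "i < k"; cases "j < k")
      (simp_all add: exchanged_def off_simps w1 w2 w3 w_def[symmetric] coef_def kap_def q_qi qi_q q_cancel diag_def
        right_diff_distrib left_diff_distrib hom_diff hom_minus)
qed

lemma exchanged_double:
  assumes "i \<noteq> j" and st: "u \<Longrightarrow> t"
  shows "exchanged u t i j j i"
proof -
  have w1: "(xi i * eta j) * (xi j * eta i) = (a i - ai i) * (sc q * a j - sc qi * ai j)"
    using assms by (simp add: contract_left xi_eta)
  have w2: "(xi j * eta i) * (xi i * eta j) = (a j - ai j) * (sc q * a i - sc qi * ai i)"
    using assms by (simp add: contract_left xi_eta)
  have comm: "a j * a i = a i * a j" "ai j * ai i = ai i * ai j" "ai j * a i = a i * ai j" "ai i * a j = a j * ai i"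
    by (rule a_a ai_ai a_ai_commute)+
  show ?thesis
    using assms
    by (cases i j rule: linorder_cases; cases u; cases t)
      (simp_all add: exchanged_def off_simps w1 w2 coef_def diag_def hom_minus hom_diff
        right_diff_distrib left_diff_distrib comm)
qed

text \<open>The hypothesis admits the pairs lower-lower, upper-upper and upper-lower. The
  coincidences i = k, j = b, j = k and i = b decide which entries are diagonal and which pairs
  contract; away from these, i = j and k = b are absorbed by \<open>kap\<close>.\<close>

theorem exchanged_all:
  assumes st: "u \<Longrightarrow> t"
  shows "exchanged u t i k j b"
proof -
  consider "i = k" "j = b" | "i = k" "j \<noteq> b" "i = j" | "i = k" "j \<noteq> b" "i = b"
    | "i = k" "j \<noteq> b" "i \<noteq> j" "i \<noteq> b" | "i \<noteq> k" "j = b" "i = j" | "i \<noteq> k" "j = b" "j = k"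
    | "i \<noteq> k" "j = b" "i \<noteq> j" "j \<noteq> k" | "i \<noteq> k" "j \<noteq> b" "j = k" "i = b"
    | "i \<noteq> k" "j \<noteq> b" "j = k" "i \<noteq> b" | "i \<noteq> k" "j \<noteq> b" "j \<noteq> k" "i = b"
    | "i \<noteq> k" "j \<noteq> b" "j \<noteq> k" "i \<noteq> b"
    by blast
  then show ?thesis
  proof cases
    case 1 then show ?thesis using exchanged_two_diag[OF st] by simp
  next
    case 2 then show ?thesis using exchanged_row_corner[OF _ st] by simp
  next
    case 3 then show ?thesis using exchanged_column_corner[OF _ st] by simp
  next
    case 4 then show ?thesis using exchanged_row_diag[OF _ _ _ st] by simp
  next
    case 5 then show ?thesis using exchanged_row_corner'[OF _ st] by simp
  next
    case 6 then show ?thesis using exchanged_column_corner'[OF _ st] by simp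
  next
    case 7 then show ?thesis using exchanged_column_diag[OF _ _ _ st] by simp
  next
    case 8 then show ?thesis using exchanged_double[OF _ st] by simp
  next
    case 9 then show ?thesis using exchanged_chain[OF _ _ _ st] by simp
  next
    case 10 then show ?thesis using exchanged_chain'[OF _ _ _ st] by simp
  next
    case 11 then show ?thesis using exchanged_generic[OF _ _ _ _ st] by simp
  qed
qed

end

section \<open>A Heisenberg group and its group algebra\<close>

text \<open>The power of \<open>z\<close> produced by moving a^v past x^u, that is, the cocycle of
  the group law below.\<close>

definition dot :: "('i \<Rightarrow>\<^sub>0 int) \<Rightarrow> ('i \<Rightarrow>\<^sub>0 int) \<Rightarrow> int" where
  "dot v u = (\<Sum>k\<in>Poly_Mapping.keys v. Poly_Mapping.lookup v k * Poly_Mapping.lookup u k)"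

lemma dot_superset:
  assumes "finite K" "Poly_Mapping.keys v \<subseteq> K"
  shows "dot v u = (\<Sum>k\<in>K. Poly_Mapping.lookup v k * Poly_Mapping.lookup u k)"
  unfolding dot_def using assms by (intro sum.mono_neutral_left) (auto simp: in_keys_iff)

lemma dot_add_left: "dot (v + v') u = dot v u + dot v' u"
proof -
  define K where "K = Poly_Mapping.keys v \<union> Poly_Mapping.keys v'"
  have K: "finite K" "Poly_Mapping.keys v \<subseteq> K" "Poly_Mapping.keys v' \<subseteq> K"
    "Poly_Mapping.keys (v + v') \<subseteq> K"
    using Poly_Mapping.keys_add[of v v'] by (auto simp: K_def)
  show ?thesis
    by (simp add: dot_superset[OF K(1)] K lookup_add distrib_right sum.distrib)
qed

lemma dot_add_right: "dot v (u + u') = dot v u + dot v u'"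
  by (simp add: dot_def lookup_add distrib_left sum.distrib)

lemma dot_zero [simp]: "dot 0 u = 0" "dot v 0 = 0"
  by (simp_all add: dot_def)

lemma dot_minus_left: "dot (- v) u = - dot v u"
  using dot_add_left[of v "- v" u] by simp

lemma dot_minus_right: "dot v (- u) = - dot v u"
  using dot_add_right[of v u "- u"] by simp

lemma dot_diff_left: "dot (v - v') u = dot v u - dot v' u"
  using dot_add_left[of v "- v'" u] by (simp add: dot_minus_left)

lemma dot_diff_right: "dot v (u - u') = dot v u - dot v u'"
  using dot_add_right[of v u "- u'"] by (simp add: dot_minus_right)

lemma dot_single: "dot (Poly_Mapping.single k 1) (Poly_Mapping.single l 1) = of_bool (k = l)"
  by (simp add: dot_def lookup_single)

text \<open>\<open>Heis v u c\<close> stands for \<open>x\<^sup>u a\<^sup>v z\<^sup>c\<close> with \<open>a\<^sub>k x\<^sub>k = z x\<^sub>k a\<^sub>k\<close> and \<open>z\<close> central.\<close>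

datatype heis = Heis "nat \<times> nat \<Rightarrow>\<^sub>0 int" "nat \<times> nat \<Rightarrow>\<^sub>0 int" int

instantiation heis :: monoid_add
begin

definition zero_heis :: heis where
  "0 = Heis 0 0 0"

fun plus_heis :: "heis \<Rightarrow> heis \<Rightarrow> heis" where
  "Heis v u c + Heis v' u' c' = Heis (v + v') (u + u') (c + c' + dot v u')"

instance
proof
  fix g h k :: heis
  show "g + h + k = g + (h + k)"
    by (cases g; cases h; cases k) (simp add: dot_add_left dot_add_right add.assoc)
  show "0 + g = g" "g + 0 = g"
    by (cases g; simp add: zero_heis_def)+
qed

end

type_synonym laurent = "int \<Rightarrow>\<^sub>0 complex"
type_synonym heis_alg = "heis \<Rightarrow>\<^sub>0 complex"

definition hmono :: "(nat \<times> nat \<Rightarrow>\<^sub>0 int) \<Rightarrow> (nat \<times> nat \<Rightarrow>\<^sub>0 int) \<Rightarrow> int \<Rightarrow> heis_alg" where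
  "hmono v u c = Poly_Mapping.single (Heis v u c) 1"

lemma hmono_mult: "hmono v u c * hmono v' u' c' = hmono (v + v') (u + u') (c + c' + dot v u')"
  by (simp add: hmono_def mult_single)

lemma hmono_one: "hmono 0 0 0 = 1"
  by (simp add: hmono_def zero_heis_def[symmetric])

definition zl :: laurent where "zl = Poly_Mapping.single 1 1"
definition zli :: laurent where "zli = Poly_Mapping.single (- 1) 1"

lemma zl_zli: "zl * zli = 1"
  by (simp add: zl_def zli_def mult_single)

text \<open>The variable of the Laurent polynomials goes to the central group element, which makes
  the complex group algebra an algebra over the Laurent polynomials.\<close>

definition laurent_heis :: "laurent \<Rightarrow> heis_alg" where
  "laurent_heis = extend_linear const_alg (\<lambda>c. hmono 0 0 c)"

lemma algebra_hom_laurent_heis: "algebra_hom (const_alg :: complex \<Rightarrow> heis_alg) (\<lambda>c. hmono 0 0 c)"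
  by (intro algebra_hom.intro coefficient_hom_const_alg algebra_hom_axioms.intro)
    (simp_all add: hmono_one hmono_mult)

lemma laurent_heis_single: "laurent_heis (Poly_Mapping.single c d) = const_alg d * hmono 0 0 c"
  unfolding laurent_heis_def by (rule coefficient_hom.extend_linear_single[OF coefficient_hom_const_alg])

interpretation laurent_heis: coefficient_hom laurent_heis
proof -
  interpret algebra_hom "const_alg :: complex \<Rightarrow> heis_alg" "\<lambda>c. hmono 0 0 c"
    by (rule algebra_hom_laurent_heis)
  show "coefficient_hom laurent_heis"
  proof
    show "laurent_heis (p + r) = laurent_heis p + laurent_heis r" for p r
      unfolding laurent_heis_def by (rule extend_linear_add)
    show "laurent_heis (p * r) = laurent_heis p * laurent_heis r" for p r
      unfolding laurent_heis_def by (rule extend_mult)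
    show "laurent_heis 1 = 1"
      unfolding laurent_heis_def by (rule extend_1)
    show "laurent_heis p * y = y * laurent_heis p" for p y
    proof (induction p rule: poly_mapping_single_induct)
      case (single c d)
      have "hmono 0 0 c * y = y * hmono 0 0 c"
      proof (induction y rule: poly_mapping_single_induct)
        case (single g e)
        then show ?case by (cases g) (simp add: hmono_def mult_single add.commute)
      qed (simp_all add: distrib_left distrib_right)
      then have "const_alg d * hmono 0 0 c * y = (const_alg d * y) * hmono 0 0 c"
        by (simp only: mult.assoc)
      also have "\<dots> = y * (const_alg d * hmono 0 0 c)"
        by (simp only: const_alg_commute[of d y] mult.assoc)
      finally show ?case by (simp only: laurent_heis_single)
    qed (simp_all only: laurent_heis_def extend_linear_add extend_linear_0 distrib_left distrib_right mult_zero_left mult_zero_right)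
  qed
qed

lemma laurent_heis_zl: "laurent_heis zl = hmono 0 0 1" "laurent_heis zli = hmono 0 0 (- 1)"
  by (simp_all add: zl_def zli_def laurent_heis_single)

lemma hmono_shift: "laurent_heis zl * hmono v u c = hmono v u (c + 1)"
    "laurent_heis zli * hmono v u c = hmono v u (c - 1)"
  by (simp_all add: laurent_heis_zl hmono_mult add.commute)

section \<open>Commuting copies of the oscillator relations\<close>

definition unit_vec :: "nat \<Rightarrow> nat \<Rightarrow> (nat \<times> nat \<Rightarrow>\<^sub>0 int)" where
  "unit_vec m i = Poly_Mapping.single (m, i) 1"

text \<open>Exponent of the factor a_0 ... a_i of \<open>osc_xi\<close>. Because of it, forming xi_j
  xi_i yields a power of \<open>z\<close> exactly when i \<le> j, which is the order dependence
  demanded by \<open>xi_xi\<close>.\<close>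

definition partial_sum :: "nat \<Rightarrow> nat \<Rightarrow> (nat \<times> nat \<Rightarrow>\<^sub>0 int)" where
  "partial_sum m i = (\<Sum>k\<le>i. unit_vec m k)"

lemma dot_unit: "dot (unit_vec m i) (unit_vec m' j) = of_bool (m = m' \<and> i = j)"
  by (simp add: unit_vec_def dot_single)

lemma dot_sum_left: "dot (sum f A) u = (\<Sum>k\<in>A. dot (f k) u)"
  by (induction A rule: infinite_finite_induct) (simp_all add: dot_add_left)

lemma dot_partial: "dot (partial_sum m i) (unit_vec m' j) = of_bool (m = m' \<and> j \<le> i)"
  by (cases "m = m'"; cases "j \<le> i") (auto simp: partial_sum_def dot_sum_left dot_unit of_bool_def sum.delta)

definition osc_a :: "nat \<Rightarrow> nat \<Rightarrow> heis_alg" where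
  "osc_a m i = hmono (unit_vec m i) 0 0"

definition osc_ai :: "nat \<Rightarrow> nat \<Rightarrow> heis_alg" where
  "osc_ai m i = hmono (- unit_vec m i) 0 0"

definition osc_xi :: "nat \<Rightarrow> nat \<Rightarrow> heis_alg" where
  "osc_xi m i = hmono (partial_sum m i) (unit_vec m i) 0"

text \<open>The last exponent is 1 because multiplying by \<open>osc_xi\<close> contributes the
  power -1 of \<open>z\<close>.\<close>

definition osc_xi_inv :: "nat \<Rightarrow> nat \<Rightarrow> heis_alg" where
  "osc_xi_inv m i = hmono (- partial_sum m i) (- unit_vec m i) 1"

text \<open>Forced by \<open>xi_eta\<close>, since \<open>osc_xi\<close> is invertible.\<close>

definition osc_eta :: "nat \<Rightarrow> nat \<Rightarrow> heis_alg" where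
  "osc_eta m i = osc_xi_inv m i * (osc_a m i - osc_ai m i)"

lemmas osc_defs = osc_a_def osc_ai_def osc_xi_def osc_xi_inv_def
lemmas dot_simps = dot_add_left dot_add_right dot_minus_left dot_minus_right dot_diff_left dot_diff_right dot_unit dot_partial

lemma osc_eta_expand:
  "osc_eta m i = hmono (- partial_sum m i + unit_vec m i) (- unit_vec m i) 1
    - hmono (- partial_sum m i - unit_vec m i) (- unit_vec m i) 1"
  by (simp add: osc_eta_def osc_defs right_diff_distrib hmono_mult)

lemmas hmono_rules = osc_defs osc_eta_expand hmono_mult dot_simps hmono_shift left_diff_distrib right_diff_distrib
  distrib_left

lemma osc_inverse: "osc_a m i * osc_ai m i = 1" "osc_ai m i * osc_a m i = 1"
  by (simp_all add: osc_defs hmono_mult hmono_one)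

lemma osc_a_a: "osc_a m i * osc_a m j = osc_a m j * osc_a m i"
  by (simp add: osc_defs hmono_mult add.commute)

lemma osc_a_xi: "osc_a m i * osc_xi m j = laurent_heis (if i = j then zl else 1) * (osc_xi m j * osc_a m i)"
  by (simp add: hmono_rules add.commute)

lemma osc_a_eta: "osc_a m i * osc_eta m j = laurent_heis (if i = j then zli else 1) * (osc_eta m j * osc_a m i)"
  by (simp add: hmono_rules algebra_simps)

lemma osc_xi_xi: "i < j \<Longrightarrow> osc_xi m j * osc_xi m i = laurent_heis zl * (osc_xi m i * osc_xi m j)"
  by (simp add: hmono_rules add.commute)

lemma osc_eta_eta: "i < j \<Longrightarrow> osc_eta m j * osc_eta m i = laurent_heis zl * (osc_eta m i * osc_eta m j)"
  by (simp add: hmono_rules algebra_simps)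

lemma osc_xi_eta_less: "i < j \<Longrightarrow> osc_xi m i * osc_eta m j = laurent_heis zl * (osc_eta m j * osc_xi m i)"
  by (simp add: hmono_rules algebra_simps)

lemma osc_xi_eta_greater: "j < i \<Longrightarrow> osc_xi m i * osc_eta m j = laurent_heis zli * (osc_eta m j * osc_xi m i)"
  by (simp add: hmono_rules algebra_simps)

lemma osc_xi_eta: "osc_xi m i * osc_eta m i = osc_a m i - osc_ai m i"
  by (simp add: hmono_rules algebra_simps)

lemma osc_eta_xi: "osc_eta m i * osc_xi m i = laurent_heis zl * osc_a m i - laurent_heis zli * osc_ai m i"
  by (simp add: hmono_rules algebra_simps)

lemma q_oscillator_osc:
  "q_oscillator laurent_heis zl zli (osc_a m) (osc_ai m) (osc_xi m) (osc_eta m)"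
  by (intro q_oscillator.intro laurent_heis.coefficient_hom_axioms q_oscillator_axioms.intro zl_zli osc_inverse
      osc_a_a osc_a_xi osc_a_eta osc_xi_xi osc_eta_eta osc_xi_eta_less osc_xi_eta_greater osc_xi_eta osc_eta_xi)

lemma osc_commute:
  assumes "m \<noteq> m'" "f \<in> {osc_a m, osc_ai m, osc_xi m, osc_eta m}" "g \<in> {osc_a m', osc_ai m', osc_xi m', osc_eta m'}"
  shows "f i * g j = g j * f i"
  using assms by (elim insertE emptyE) (simp_all add: hmono_rules algebra_simps)

section \<open>A homomorphism from the algebra to the Heisenberg group algebra\<close>

text \<open>Block diagonal with blocks (0, q; -1, 0), a deformation of the standard symplectic form.
  It is the value of the matrix of the s_ij when T and U are the identity.\<close>

definition gamma :: "'k::comm_ring_1 \<Rightarrow> nat \<Rightarrow> nat \<Rightarrow> 'k" where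
  "gamma q i j = (if odd i \<and> j = i + 1 then q else if even i \<and> i = j + 1 then - 1 else 0)"

lemma gamma_blocks:
  "gamma q (2 * x + 1) (2 * y + 2) = (if x = y then q else 0)"
  "gamma q (2 * x + 2) (2 * y + 1) = (if x = y then - 1 else 0)"
  "gamma q (2 * x + 1) (2 * y + 1) = 0"
  "gamma q (2 * x + 2) (2 * y + 2) = 0"
proof -
  show "gamma q (2 * x + 1) (2 * y + 2) = (if x = y then q else 0)"
    "gamma q (2 * x + 2) (2 * y + 1) = (if x = y then - 1 else 0)"
    by (auto simp: gamma_def)
  have "2 * y + 1 \<noteq> 2 * x + 1 + 1" "odd (2 * x + 1)" "2 * x + 2 \<noteq> 2 * y + 2 + 1" "even (2 * x + 2)"
    by presburger+
  then show "gamma q (2 * x + 1) (2 * y + 1) = 0" "gamma q (2 * x + 2) (2 * y + 2) = 0"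
    by (simp_all only: gamma_def simp_thms if_False)
qed

lemma block_order:
  fixes x y :: nat
  shows "2 * x + 1 = 2 * y + 1 \<longleftrightarrow> x = y" "2 * x + 2 = 2 * y + 2 \<longleftrightarrow> x = y"
    "2 * x + 1 = 2 * y + 2 \<longleftrightarrow> False" "2 * x + 2 = 2 * y + 1 \<longleftrightarrow> False"
    "2 * x + 1 < 2 * y + 1 \<longleftrightarrow> x < y" "2 * x + 2 < 2 * y + 2 \<longleftrightarrow> x < y"
    "2 * x + 1 < 2 * y + 2 \<longleftrightarrow> x \<le> y" "2 * x + 2 < 2 * y + 1 \<longleftrightarrow> x < y"
  by presburger+

text \<open>A product of two entries survives only if its indices pair up within blocks. This leaves
  the three ways of pairing four indices, and the case of a single block.\<close>

lemma gamma_reflection: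
  fixes q qi :: "'k::comm_ring_1"
  assumes q_qi: "q * qi = 1" and "i \<ge> 1" "j \<ge> 1" "a \<ge> 1" "b \<ge> 1"
  defines "h \<equiv> q - qi" and "\<gamma> \<equiv> gamma q"
  shows "q ^ of_bool (i = j) * (q ^ of_bool (a = j) * (\<gamma> i a * \<gamma> j b) + h * of_bool (a < j) * (\<gamma> i j * \<gamma> a b))
      + h * of_bool (i < j) * (q ^ of_bool (a = i) * (\<gamma> j a * \<gamma> i b) + h * of_bool (a < i) * (\<gamma> j i * \<gamma> a b))
    = q ^ of_bool (a = b) * (q ^ of_bool (i = b) * (\<gamma> j b * \<gamma> i a) + h * of_bool (b < i) * (\<gamma> j i * \<gamma> b a))
      + h * of_bool (b < a) * (q ^ of_bool (i = a) * (\<gamma> j a * \<gamma> i b) + h * of_bool (a < i) * (\<gamma> j i * \<gamma> a b))"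
proof -
  have hq: "h * q = q * q - 1" "q * h = q * q - 1"
    using q_qi by (simp_all add: h_def algebra_simps)
  have rep: "\<exists>x. i = 2 * x + 1 \<or> i = 2 * x + 2" if "i \<ge> 1" for i :: nat
    using that by presburger
  from rep[OF assms(2)] obtain x where i: "i = 2 * x + 1 \<or> i = 2 * x + 2" ..
  from rep[OF assms(3)] obtain y where j: "j = 2 * y + 1 \<or> j = 2 * y + 2" ..
  from rep[OF assms(4)] obtain z where a: "a = 2 * z + 1 \<or> a = 2 * z + 2" ..
  from rep[OF assms(5)] obtain w where b: "b = 2 * w + 1 \<or> b = 2 * w + 2" ..
  note ijab = i j a b
  note rules = gamma_blocks block_order
  have zero: "\<gamma> k l = 0" if "k = 2 * u + 1 \<or> k = 2 * u + 2" "l = 2 * v + 1 \<or> l = 2 * v + 2" "u \<noteq> v" for k l u v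
    using that unfolding \<gamma>_def by (elim disjE; simp only: rules if_False)
  have less: "k < l \<longleftrightarrow> u < v" if "k = 2 * u + 1 \<or> k = 2 * u + 2" "l = 2 * v + 1 \<or> l = 2 * v + 2" "u \<noteq> v" for k l u v :: nat
    using that by (elim disjE; simp only: rules; linarith)
  have neq: "k \<noteq> l" if "k = 2 * u + 1 \<or> k = 2 * u + 2" "l = 2 * v + 1 \<or> l = 2 * v + 2" "u \<noteq> v" for k l u v :: nat
    using that by (elim disjE; simp only: rules; simp)
  note zeros = zero[OF i a] zero[OF j b] zero[OF i j] zero[OF j i] zero[OF j a] zero[OF i b] zero[OF a b] zero[OF b a]
  consider (all) "x = y" "z = y" "w = y" | (1) "z = x" "w = y" "x \<noteq> y" | (2) "y = x" "w = z" "x \<noteq> z"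
    | (3) "w = x" "z = y" "x \<noteq> y" | (none) "x \<noteq> z \<or> y \<noteq> w" "x \<noteq> y \<or> z \<noteq> w" "x \<noteq> w \<or> y \<noteq> z"
    by blast
  then show ?thesis
  proof cases
    case all
    show ?thesis
      using ijab unfolding all \<gamma>_def
      by (elim disjE; simp only: rules; simp add: hq algebra_simps)
  next
    case 1
    have "\<gamma> i j = 0" "\<gamma> j i = 0" "\<gamma> j a = 0" "\<gamma> i b = 0" "\<gamma> a b = 0"
      using 1 by (simp_all add: zeros)
    moreover have "i \<noteq> j" "a \<noteq> j" "a \<noteq> b" "i \<noteq> b"
      using 1 neq[OF i j] neq[OF a j] neq[OF a b] neq[OF i b] by simp_all
    ultimately show ?thesis by (simp add: mult.commute)
  next
    case 2
    have z: "\<gamma> i a = 0" "\<gamma> j b = 0" "\<gamma> j a = 0" "\<gamma> i b = 0"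
      using 2 by (simp_all add: zeros)
    show ?thesis
    proof (cases "x < z")
      case True
      then have "\<not> a < j" "\<not> a < i" "\<not> b < i"
        using 2 less[OF a j] less[OF a i] less[OF b i] by simp_all
      then show ?thesis using z by simp
    next
      case False
      then have lt: "z < x" using 2 by simp
      then have "a < j" "a < i" "b < i"
        using 2 less[OF a j] less[OF a i] less[OF b i] by simp_all
      \<comment> \<open>The mixed terms are all active here. For i < j and a < b the equation is q^2
        - h q = 1, so the choice of the block entries q and -1 matters.\<close>
      then show ?thesis
        using lt ijab unfolding \<gamma>_def 2
        by (elim disjE; simp only: rules; simp add: hq algebra_simps)
    qed
  next
    case 3
    have "\<gamma> i j = 0" "\<gamma> j i = 0" "\<gamma> i a = 0" "\<gamma> j b = 0" "\<gamma> a b = 0"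
      using 3 by (simp_all add: zeros)
    moreover have "i < j \<longleftrightarrow> b < a" using 3 less[OF i j] less[OF b a] by simp
    ultimately show ?thesis by (simp add: eq_commute[of i a])
  next
    case none
    then have "\<gamma> i a * \<gamma> j b = 0" "\<gamma> j b * \<gamma> i a = 0" "\<gamma> i j * \<gamma> a b = 0" "\<gamma> j i * \<gamma> a b = 0" "\<gamma> j i * \<gamma> b a = 0"
      "\<gamma> j a * \<gamma> i b = 0"
      using zeros by auto
    then show ?thesis by simp
  qed
qed

text \<open>A pair of triangular L-operators with mutually inverse diagonals; the relations for S =
  T G U^t use nothing else about the oscillators.\<close>

locale twisted_matrices = r_matrix sc "{1..2*n}" q "q - qi" for sc :: "'k::comm_ring_1 \<Rightarrow> 'r::ring_1" and n q qi +
  fixes T U :: "nat \<Rightarrow> nat \<Rightarrow> 'r"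
  assumes q_qi: "q * qi = 1"
    and TT: "exchange T T" and UU: "exchange U U" and UT: "exchange U T"
    and T_lower: "i < j \<Longrightarrow> T i j = 0" and U_upper: "j < i \<Longrightarrow> U i j = 0"
    and TU_diag: "i \<in> {1..2*n} \<Longrightarrow> T i i * U i i = 1"
begin

abbreviation "rows \<equiv> {1..2*n}"

definition G_mat :: "nat \<Rightarrow> nat \<Rightarrow> 'r" where
  "G_mat i j = sc (gamma q i j)"

definition S_mat :: "nat \<Rightarrow> nat \<Rightarrow> 'r" where
  "S_mat = mat_mult rows T (mat_mult rows G_mat (\<lambda>i j. U j i))"

text \<open>Inverse of S_{i,i+1} = q T_ii U_{i+1,i+1}, as T and U have mutually inverse and
  commuting diagonal entries.\<close>

definition S_inv :: "nat \<Rightarrow> 'r" where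
  "S_inv i = sc qi * (T (Suc i) (Suc i) * U i i)"

lemma qi_q: "qi * q = 1" using q_qi by (simp add: mult.commute)

lemma reflection_S: "reflection S_mat"
  unfolding S_mat_def
proof (rule reflection_twist[OF TT UU UT])
  show "reflection G_mat"
    unfolding reflection_def
  proof (rule supported_eqI)
    fix i j a b assume "i \<in> rows" "j \<in> rows" "a \<in> rows" "b \<in> rows"
    then show "mat_mult (rows \<times> rows) R_mat (mat_mult (rows \<times> rows) (leg1 G_mat)
          (mat_mult (rows \<times> rows) R_transposed (leg2 G_mat))) (i, j) (a, b)
        = mat_mult (rows \<times> rows) (leg2 G_mat) (mat_mult (rows \<times> rows) R_transposed
          (mat_mult (rows \<times> rows) (leg1 G_mat) R_mat)) (i, j) (a, b)"
      using arg_cong[where f = sc, OF gamma_reflection[OF q_qi, of i j a b]]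
      by (simp only: reflection_left reflection_right G_mat_def hom_mult[symmetric] hom_add[symmetric]) simp
  qed (intro outside_rules; assumption)+
qed (simp_all only: entries_commute_def G_mat_def, (intro ballI, metis hom_central)+)

text \<open>The (k, j) entry of G U^t; each row of G has a single nonzero entry.\<close>

definition V_entry :: "nat \<Rightarrow> nat \<Rightarrow> 'r" where
  "V_entry j k = (if odd k then sc q * U j (Suc k) else - U j (k - 1))"

lemma S_mat_sum: "S_mat i j = (\<Sum>k\<in>rows. T i k * V_entry j k)"
proof -
  have "(\<Sum>l\<in>rows. G_mat k l * U j l) = V_entry j k" if k: "k \<in> rows" for k
  proof (cases "odd k")
    case True
    then have "Suc k \<in> rows" using k by simp presburger
    then show ?thesis using True
      by (subst sum_only[of "Suc k"]) (auto simp: G_mat_def gamma_def V_entry_def)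
  next
    case False
    then have "k - 1 \<in> rows" "k = Suc (k - 1)" using k by (auto elim!: evenE)
    then show ?thesis using False
      by (subst sum_only[of "k - 1"]) (auto simp: G_mat_def gamma_def V_entry_def hom_minus)
  qed
  then show ?thesis by (simp add: S_mat_def mat_mult_def)
qed

lemma V_zero: "odd k \<Longrightarrow> Suc k < j \<Longrightarrow> V_entry j k = 0" "even k \<Longrightarrow> k > 0 \<Longrightarrow> k \<le> j \<Longrightarrow> V_entry j k = 0"
  by (simp_all add: V_entry_def U_upper)


lemma S_zero:
  assumes "even i \<and> j = i + 1 \<or> j \<ge> i + 2"
  shows "S_mat i j = 0"
  unfolding S_mat_sum
proof (rule sum.neutral, rule ballI)
  fix k assume k: "k \<in> rows"
  show "T i k * V_entry j k = 0"
  proof (cases "i < k")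
    case True
    then show ?thesis by (simp add: T_lower)
  next
    case False
    have "V_entry j k = 0"
    proof (cases "odd k")
      case True
      then have "Suc k < j" using assms False by (auto elim!: oddE evenE) presburger
      then show ?thesis using True by (intro V_zero(1))
    next
      case even: False
      then show ?thesis using V_zero(2)[of k j] k False assms by auto
    qed
    then show ?thesis by simp
  qed
qed

text \<open>Triangularity of T removes the later blocks and that of U the earlier ones, so only the
  block of i contributes.\<close>

lemma S_sum_pair:
  assumes "odd i" "i \<in> rows" "Suc i \<in> rows" "r \<le> Suc i" "i \<le> j"
  shows "S_mat r j = T r i * V_entry j i + T r (Suc i) * V_entry j (Suc i)"
proof -
  have "S_mat r j = (\<Sum>k\<in>{i, Suc i}. T r k * V_entry j k)"
    unfolding S_mat_sum
  proof (rule sum.mono_neutral_right)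
    show "\<forall>k\<in>rows - {i, Suc i}. T r k * V_entry j k = 0"
    proof
      fix k assume k: "k \<in> rows - {i, Suc i}"
      show "T r k * V_entry j k = 0"
      proof (cases "r < k")
        case True
        then show ?thesis by (simp add: T_lower)
      next
        case False
        then have "k < i" using k assms by auto
        have "V_entry j k = 0"
        proof (cases "odd k")
          case True
          then have "Suc k < i" using \<open>k < i\<close> \<open>odd i\<close> by (auto elim!: oddE)
          then show ?thesis using True assms by (intro V_zero(1)) auto
        next
          case even: False
          then show ?thesis using k \<open>k < i\<close> assms by (intro V_zero(2)) auto
        qed
        then show ?thesis by simp
      qed
    qed
  qed (use assms in auto)
  then show ?thesis by simp
qed

lemma S_block:
  assumes "odd i" "i \<in> rows" "Suc i \<in> rows"
  shows "S_mat i i = sc q * (T i i * U i (Suc i))"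
    and "S_mat i (Suc i) = sc q * (T i i * U (Suc i) (Suc i))"
    and "S_mat (Suc i) (Suc i) = sc q * (T (Suc i) i * U (Suc i) (Suc i))"
    and "S_mat (Suc i) i = sc q * (T (Suc i) i * U i (Suc i)) - T (Suc i) (Suc i) * U i i"
proof -
  have [simp]: "T i (Suc i) = 0" "U (Suc i) i = 0"
    by (simp_all add: T_lower U_upper)
  have *: "x * (sc q * y) = sc q * (x * y)" for x y
    by (rule sc_left)
  show "S_mat i i = sc q * (T i i * U i (Suc i))"
    "S_mat i (Suc i) = sc q * (T i i * U (Suc i) (Suc i))"
    "S_mat (Suc i) (Suc i) = sc q * (T (Suc i) i * U (Suc i) (Suc i))"
    "S_mat (Suc i) i = sc q * (T (Suc i) i * U i (Suc i)) - T (Suc i) (Suc i) * U i i"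
    using assms S_sum_pair[of i i i] S_sum_pair[of i i "Suc i"] S_sum_pair[of i "Suc i" "Suc i"] S_sum_pair[of i "Suc i" i]
    by (simp_all add: V_entry_def *)
qed

text \<open>These are exchange relations at indices for which triangularity kills the terms with q -
  q^{-1}.\<close>

lemma diag_commute:
  assumes "i \<in> rows" "j \<in> rows"
  shows "T i i * T j j = T j j * T i i" "U i i * U j j = U j j * U i i" "U i i * T j j = T j j * U i i"
proof -
  have cancel: "sc q * x = sc q * y \<Longrightarrow> x = y" for x y
    using qi_q by (metis hom_mult hom_1 mult.assoc mult_1)
  have "T i i * T j j = T j j * T i i" if "i \<le> j" "i \<in> rows" "j \<in> rows" for i j
    using TT[unfolded exchange_def, rule_format, of j j i i] that
    by (cases "i = j") (auto simp: T_lower dest: cancel)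
  then show "T i i * T j j = T j j * T i i"
    using assms by (metis linear)
  have "U i i * U j j = U j j * U i i" if "i \<le> j" "i \<in> rows" "j \<in> rows" for i j
    using UU[unfolded exchange_def, rule_format, of i i j j] that
    by (cases "i = j") (auto simp: U_upper dest: cancel)
  then show "U i i * U j j = U j j * U i i"
    using assms by (metis linear)
  show "U i i * T j j = T j j * U i i"
    using UT[unfolded exchange_def, rule_format, of i i j j] assms
    by (cases i j rule: linorder_cases) (auto simp: T_lower U_upper dest: cancel)
qed

lemma UT_diag: "i \<in> rows \<Longrightarrow> U i i * T i i = 1"
  using diag_commute(3)[of i i] TU_diag by simp

lemma S_inverse:
  assumes "odd i" "i \<in> rows" "Suc i \<in> rows"
  shows "S_mat i (Suc i) * S_inv i = 1" "S_inv i * S_mat i (Suc i) = 1"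
proof -
  define p where "p = T i i * U (Suc i) (Suc i)"
  define r where "r = T (Suc i) (Suc i) * U i i"
  have "p * r = T i i * (U (Suc i) (Suc i) * T (Suc i) (Suc i)) * U i i"
    by (simp only: p_def r_def mult.assoc)
  then have pr: "p * r = 1" using UT_diag[of "Suc i"] TU_diag[of i] assms by simp
  have "r * p = T (Suc i) (Suc i) * (U i i * T i i) * U (Suc i) (Suc i)"
    by (simp only: p_def r_def mult.assoc)
  then have rp: "r * p = 1" using UT_diag[of i] TU_diag[of "Suc i"] assms by simp
  have "sc q * p * (sc qi * r) = sc (q * qi) * (p * r)" "sc qi * r * (sc q * p) = sc (qi * q) * (r * p)"
    by (simp_all only: hom_mult sc_left[of p] sc_left[of r] mult.assoc)
  then show "S_mat i (Suc i) * S_inv i = 1" "S_inv i * S_mat i (Suc i) = 1"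
    using pr rp q_qi qi_q S_block(2)[OF assms] by (simp_all add: S_inv_def p_def r_def)
qed

text \<open>Both products are brought to the order f e t v', with f = T_{i+1,i} and e = U_{i,i+1}.
  The terms with q^4 cancel, and t' v t v' = 1 leaves the constant q^3.\<close>

lemma S_determinant:
  assumes "odd i" "i \<in> rows" "Suc i \<in> rows"
  shows "S_mat (Suc i) (Suc i) * S_mat i i - sc (q^2) * S_mat (Suc i) i * S_mat i (Suc i) = sc (q^3)"
proof -
  define t where "t = T i i" define t' where "t' = T (Suc i) (Suc i)" define f where "f = T (Suc i) i"
  define v where "v = U i i" define v' where "v' = U (Suc i) (Suc i)" define e where "e = U i (Suc i)"
  have vt: "v' * t = t * v'" "t' * t = t * t'"
    using diag_commute[of "Suc i" i] assms by (simp_all add: v'_def t_def t'_def)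
  have te: "t * e = sc q * (e * t)"
    using UT[unfolded exchange_def, rule_format, of i "Suc i" i i] assms T_lower[of i "Suc i"]
    by (simp add: t_def e_def)
  have "sc qi * (sc q * (v' * e)) = sc qi * (e * v' + sc (q - qi) * (v' * e))"
    using UU[unfolded exchange_def, rule_format, of i "Suc i" "Suc i" "Suc i"] assms
    by (simp add: v'_def e_def)
  have "e * v' + sc (q - qi) * (v' * e) = sc q * (v' * e)"
    using UU[unfolded exchange_def, rule_format, of i "Suc i" "Suc i" "Suc i"] assms
    by (simp add: v'_def e_def)
  then have "e * v' = sc qi * (v' * e)"
    by (simp add: hom_diff left_diff_distrib)
  then have ve: "v' * e = sc q * (e * v')"
    using q_qi by (simp add: mult.assoc[symmetric] hom_mult[symmetric])
  have inv: "t * v = 1" "t' * v' = 1"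
    using TU_diag assms by (simp_all add: t_def v_def t'_def v'_def)
  have "v * t = 1" using UT_diag assms by (simp add: t_def v_def)
  have left: "(sc q * (f * v')) * (sc q * (t * e)) = sc (q^4) * (f * (e * (t * v')))"
  proof -
    have "v' * (t * e) = sc q * (v' * (e * t))"
      by (simp only: te sc_left)
    also have "\<dots> = sc q * ((v' * e) * t)" by (simp only: mult.assoc)
    also have "\<dots> = sc (q * q) * (e * (t * v'))"
      by (simp only: ve hom_mult mult.assoc vt)
    finally have "v' * (t * e) = sc (q * q) * (e * (t * v'))" .
    then have "f * (v' * (t * e)) = sc (q * q) * (f * (e * (t * v')))"
      by (simp only: sc_left)
    then show ?thesis
      by (simp add: sc_left[of f] sc_left[of v'] mult.assoc hom_mult power4_eq_xxxx)
  qed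
  have "t' * v * (t * v') = t' * (v * t) * v'" by (simp only: mult.assoc)
  then have one: "t' * v * (t * v') = 1" using \<open>v * t = 1\<close> inv by simp
  have "(sc q * (f * e) - t' * v) * (sc q * (t * v')) = sc (q^2) * (f * (e * (t * v'))) - sc q"
    using one
    by (simp add: left_diff_distrib sc_left[of "f * e"] sc_left[of "t' * v"] sc_left[of f] sc_left[of e] sc_left[of t'] sc_left[of v]
        mult.assoc hom_mult power2_eq_square)
  then have "sc (q^2) * ((sc q * (f * e) - t' * v) * (sc q * (t * v'))) = sc (q^4) * (f * (e * (t * v'))) - sc (q^3)"
    by (simp add: right_diff_distrib hom_mult power4_eq_xxxx power3_eq_cube power2_eq_square mult.assoc)
  then show ?thesis
    using left S_block[OF assms] unfolding t_def[symmetric] t'_def[symmetric] f_def[symmetric] v_def[symmetric] v'_def[symmetric] e_def[symmetric]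
    by (simp add: mult.assoc)
qed

text \<open>The products x3 and x4 occur on both sides of an entry of the matrix equation; the
  defining relation lists each once, with the difference of its coefficients.\<close>

lemma expand_reflection:
  fixes x1 x2 x3 x4 x5 x6 :: 'r and h A B A' B' d d' e e' z f :: 'k
  assumes "sc A * (sc B * x1 + sc (h * d) * x2) + sc (h * e) * (sc z * x3 + sc (h * f) * x4)
    = sc A' * (sc B' * x5 + sc (h * d') * x6) + sc (h * e') * (sc z * x3 + sc (h * f) * x4)"
  shows "sc (B * A) * x1 - sc (A' * B') * x5
    - (sc (h * z * (e' - e)) * x3 + sc h * (sc (A' * d') * x6 - sc (A * d) * x2) + sc (h^2 * (e' * f - e * f)) * x4) = 0"
proof -
  have sc_sc: "sc c * (sc d * y) = sc (c * d) * y" for c d y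
    by (simp add: hom_mult mult.assoc)
  have "sc (B * A) * x1 = sc (A * B) * x1" by (simp add: mult.commute)
  moreover have "sc (h * z * (e' - e)) * x3 = sc (h * e' * z) * x3 - sc (h * e * z) * x3"
    unfolding left_diff_distrib[symmetric] hom_diff[symmetric] by (simp only: algebra_simps)
  moreover have "sc h * (sc (A' * d') * x6 - sc (A * d) * x2) = sc (A' * (h * d')) * x6 - sc (A * (h * d)) * x2"
    by (simp add: right_diff_distrib sc_sc mult.left_commute)
  moreover have "sc (h^2 * (e' * f - e * f)) * x4 = sc (h * e' * (h * f)) * x4 - sc (h * e * (h * f)) * x4"
    unfolding left_diff_distrib[symmetric] hom_diff[symmetric] power2_eq_square by (simp only: algebra_simps)
  moreover have "sc (A * B) * x1 + sc (A * (h * d)) * x2 + (sc (h * e * z) * x3 + sc (h * e * (h * f)) * x4)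
      = sc (A' * B') * x5 + sc (A' * (h * d')) * x6 + (sc (h * e' * z) * x3 + sc (h * e' * (h * f)) * x4)"
    using assms by (simp only: distrib_left sc_sc)
  ultimately show ?thesis
    by (simp only: add_diff_eq diff_add_eq) (simp add: algebra_simps)
qed

lemma S_reflection:
  assumes I: "i \<in> rows" "a \<in> rows" "j \<in> rows" "b \<in> rows"
  shows "sc (q ^ (of_bool (a = j) + of_bool (i = j))) * S_mat i a * S_mat j b
      - sc (q ^ (of_bool (a = b) + of_bool (i = b))) * S_mat j b * S_mat i a
      - (sc ((q - qi) * q ^ of_bool (a = i) * (of_bool (b < a) - of_bool (i < j)))
           * S_mat j a * S_mat i b
         + sc (q - qi)
           * (sc (q ^ of_bool (a = b) * of_bool (b < i)) * S_mat j i * S_mat b a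
              - sc (q ^ of_bool (i = j) * of_bool (a < j)) * S_mat i j * S_mat a b)
         + sc ((q - qi)^2 * (of_bool (b < a \<and> a < i) - of_bool (a < i \<and> i < j)))
           * S_mat j i * S_mat a b) = 0"
proof -
  define h where "h = q - qi"
  have "sc (q ^ of_bool (i = j)) * (sc (q ^ of_bool (a = j)) * (S_mat i a * S_mat j b) + sc (h * of_bool (a < j)) * (S_mat i j * S_mat a b))
      + sc (h * of_bool (i < j)) * (sc (q ^ of_bool (a = i)) * (S_mat j a * S_mat i b) + sc (h * of_bool (a < i)) * (S_mat j i * S_mat a b))
    = sc (q ^ of_bool (a = b)) * (sc (q ^ of_bool (i = b)) * (S_mat j b * S_mat i a) + sc (h * of_bool (b < i)) * (S_mat j i * S_mat b a))
      + sc (h * of_bool (b < a)) * (sc (q ^ of_bool (i = a)) * (S_mat j a * S_mat i b) + sc (h * of_bool (a < i)) * (S_mat j i * S_mat a b))"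
    using reflection_S unfolding reflection_def h_def by (metis reflection_left reflection_right I)
  note expand_reflection[OF this[unfolded eq_commute[of i a]]]
  moreover have "of_bool (b < a \<and> a < i) = (of_bool (b < a) * of_bool (a < i) :: 'k)"
    "of_bool (a < i \<and> i < j) = (of_bool (i < j) * of_bool (a < i) :: 'k)"
    by auto
  ultimately show ?thesis
    unfolding h_def[symmetric] by (simp only: power_add mult.assoc)
qed

end

section \<open>A weight for which the generators commute up to smaller terms\<close>

definition zero_pos :: "nat \<Rightarrow> nat \<Rightarrow> bool" where
  "zero_pos i j \<longleftrightarrow> even i \<and> j = i + 1 \<or> j \<ge> i + 2"

definition pbw_pos :: "nat \<Rightarrow> nat \<Rightarrow> nat \<Rightarrow> bool" where
  "pbw_pos n i a \<longleftrightarrow> i \<in> {1..2*n} \<and> a \<in> {1..2*n} \<and> \<not> zero_pos i a \<and> \<not> (even i \<and> i = a + 1)"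

lemma odd_indicesD: "i \<in> odd_indices n \<Longrightarrow> odd i \<and> i \<in> {1..2*n} \<and> Suc i \<in> {1..2*n}"
  by (auto simp: odd_indices_def elim!: oddE) presburger

lemma pbw_pos_unit: "i \<in> odd_indices n \<Longrightarrow> pbw_pos n i (Suc i)"
  using odd_indicesD[of i n] by (auto simp: pbw_pos_def zero_pos_def)

text \<open>Strictly concave, and increasing up to its vertex 2n. In \<open>weight\<close>, the 4n
  of a diagonal letter exceeds every increment of \<open>bump\<close>; 8n + 1 exceeds two diagonal
  letters, so that the determinant relation can eliminate a subdiagonal letter; and 20n keeps the
  other letters below the diagonal heavier than these.\<close>

definition bump :: "nat \<Rightarrow> nat \<Rightarrow> nat" where
  "bump n d = d * (4*n - d)"

text \<open>Concavity of \<open>bump\<close> makes the two uncrossed pairings of four indices lighter than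
  the crossed one.\<close>

fun weight :: "nat \<Rightarrow> gen \<Rightarrow> nat" where
  "weight n (S i a) = (if i = a then 4*n else if a = i + 1 then 0
     else if even i \<and> i = a + 1 then 8*n + 1 else 20*n + bump n (i - a))"
| "weight n (Sinv i) = 0"

lemma int_bump: "d \<le> 4*n \<Longrightarrow> int (bump n d) = int d * (4 * int n - int d)"
  by (simp add: bump_def of_nat_diff)

lemma bump_mono:
  assumes "d < e" "e \<le> 2*n"
  shows "bump n d < bump n e"
proof -
  have "int (bump n e) - int (bump n d) = (int e - int d) * (4 * int n - int d - int e)"
    using assms by (simp add: int_bump algebra_simps)
  also have "\<dots> > 0"
    using assms by (intro mult_pos_pos) auto
  finally show ?thesis by simp
qed

lemma bump_subadditive:
  assumes "x + y \<le> 2*n"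
  shows "bump n (x + y) \<le> bump n x + bump n y"
proof -
  have "int (bump n x) + int (bump n y) - int (bump n (x + y)) = 2 * int x * int y"
    using assms by (simp add: int_bump algebra_simps)
  also have "\<dots> \<ge> 0" by simp
  finally show ?thesis by linarith
qed

lemma bump_step:
  assumes "d < 2*n"
  shows "bump n (Suc d) < bump n d + 4*n"
proof -
  have "int (bump n d) + 4 * int n - int (bump n (Suc d)) = 2 * int d + 1"
    using assms by (simp add: int_bump algebra_simps)
  then show ?thesis by linarith
qed

lemma bump_concave:
  assumes "0 < x" "0 < z" "x + y + z \<le> 2*n"
  shows "bump n (x + y + z) + bump n y < bump n (y + z) + bump n (x + y)"
proof -
  have "int (bump n (y + z)) + int (bump n (x + y)) - int (bump n (x + y + z)) - int (bump n y)
      = 2 * int x * int z"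
    using assms by (simp add: int_bump algebra_simps)
  moreover have "2 * int x * int z > 0" using assms by simp
  ultimately show ?thesis by linarith
qed

lemma weight_below_le: "a < i \<Longrightarrow> n > 0 \<Longrightarrow> weight n (S i a) \<le> 20*n + bump n (i - a)"
  using bump_mono[of 0 1 n] by auto

lemma weight_below: "pbw_pos n i a \<Longrightarrow> a < i \<Longrightarrow> weight n (S i a) = 20*n + bump n (i - a)"
  by (auto simp: pbw_pos_def)

lemma weight_diag: "weight n (S i i) = 4*n"
  by simp

lemma weight_above: "weight n (S i (Suc i)) = 0"
  by simp

lemma not_zero_pos_cases:
  assumes "\<not> zero_pos i j"
  obtains "j < i" | "j = i" | "odd i" "j = Suc i"
  using assms by (fastforce simp: zero_pos_def)

text \<open>Concavity settles the case of s_ja below the diagonal, subadditivity that on the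
  diagonal, and the bound on increments that above it. The excluded case compares s_{j+1,j+1} s_jj
  of weight 8n with s_{j,j+1} s_{j+1,j} of weight 8n + 1.\<close>

lemma weight_exchange:
  assumes ia: "pbw_pos n i a" and jb: "pbw_pos n j b" and "j < i" "b < a"
    and ja: "\<not> zero_pos j a" and ib: "\<not> zero_pos i b"
    and special: "\<not> (odd j \<and> i = Suc j \<and> a = i \<and> b = j)"
  shows "weight n (S j a) + weight n (S i b) < weight n (S i a) + weight n (S j b)"
proof -
  have bounds: "i \<le> 2*n" "b \<ge> 1" "n > 0"
    using ia jb by (auto simp: pbw_pos_def)
  show ?thesis
    using ja
  proof (cases rule: not_zero_pos_cases)
    case 3
    then have bj: "b \<le> j" using \<open>b < a\<close> by simp
    then have wib: "weight n (S i b) \<le> 20*n + bump n (i - b)"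
      using \<open>j < i\<close> bounds by (intro weight_below_le) simp_all
    show ?thesis
    proof (cases "i = Suc j")
      case True
      then have "b < j" using special 3 bj by auto
      moreover have "bump n (Suc (j - b)) < bump n (j - b) + 4*n"
        using bounds True by (intro bump_step) simp
      moreover have "i - b = Suc (j - b)" using True bj by simp
      ultimately show ?thesis
        using 3 True wib weight_below[OF jb] by (simp del: weight.simps add: weight_diag weight_above)
    next
      case False
      then have "a < i" using \<open>j < i\<close> 3 by simp
      note wia = weight_below[OF ia this]
      have eq: "i - b = (i - a) + Suc (j - b)" using 3 \<open>a < i\<close> bj by simp
      have "bump n (i - b) \<le> bump n (i - a) + bump n (Suc (j - b))"
        unfolding eq using bounds eq by (intro bump_subadditive) simp
      moreover have step: "bump n (Suc (j - b)) < bump n (j - b) + 4*n"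
        using bounds \<open>j < i\<close> by (intro bump_step) simp
      ultimately have le: "bump n (i - b) < bump n (i - a) + bump n (j - b) + 4*n" by simp
      show ?thesis
      proof (cases "b = j")
        case True
        have "bump n 0 = 0" by (simp add: bump_def)
        then show ?thesis using le True wia wib 3
          by (simp del: weight.simps add: weight_diag weight_above)
      next
        case False
        then show ?thesis
          using le wia wib 3 bj weight_below[OF jb] bounds
          by (simp del: weight.simps add: weight_above)
      qed
    qed
  next
    case 1
    then have wia: "weight n (S i a) = 20*n + bump n (i - a)"
      and wjb: "weight n (S j b) = 20*n + bump n (j - b)"
      and wib: "weight n (S i b) \<le> 20*n + bump n (i - b)"
      and wja: "weight n (S j a) \<le> 20*n + bump n (j - a)"
      using \<open>j < i\<close> \<open>b < a\<close> weight_below[OF ia] weight_below[OF jb] weight_below_le bounds by simp_all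
    have eqs: "(a - b) + (j - a) + (i - j) = i - b" "(j - a) + (i - j) = i - a"
      "(a - b) + (j - a) = j - b"
      using 1 \<open>j < i\<close> \<open>b < a\<close> by auto
    have "bump n (i - b) + bump n (j - a) < bump n (i - a) + bump n (j - b)"
      using bump_concave[of "a - b" "i - j" "j - a" n] bounds 1 \<open>j < i\<close> \<open>b < a\<close>
      unfolding eqs by simp
    then show ?thesis
      using wia wjb wib wja by linarith
  next
    case 2
    then have wia: "weight n (S i a) = 20*n + bump n (i - a)"
      and wjb: "weight n (S j b) = 20*n + bump n (j - b)"
      and wib: "weight n (S i b) \<le> 20*n + bump n (i - b)"
      and wja: "weight n (S j a) = 4*n"
      using \<open>j < i\<close> \<open>b < a\<close> weight_below[OF ia] weight_below[OF jb] weight_below_le bounds by simp_all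
    have eq: "(i - a) + (j - b) = i - b"
      using 2 \<open>j < i\<close> \<open>b < a\<close> by simp
    have "bump n (i - b) \<le> bump n (i - a) + bump n (j - b)"
      using bump_subadditive[of "i - a" "j - b" n] bounds unfolding eq by simp
    then show ?thesis
      using wia wjb wib wja bounds by linarith
  qed
qed

text \<open>Each new factor is compared with the old one in its row or column: s_ij lies nearer to
  the diagonal than s_ia in row i, and s_ab higher than s_jb in column b.\<close>

lemma weight_rows_below:
  assumes ia: "pbw_pos n i a" and jb: "pbw_pos n j b" and "j \<le> i" "a < j"
    and ab: "\<not> zero_pos a b"
  shows "weight n (S i j) + weight n (S a b) < weight n (S i a) + weight n (S j b)"
proof -
  have bounds: "i \<le> 2*n" "b \<ge> 1" "a \<ge> 1" "n > 0"
    using ia jb by (auto simp: pbw_pos_def)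
  have wia: "weight n (S i a) = 20*n + bump n (i - a)"
    using weight_below[OF ia] assms by simp
  have "bump n (i - j) < bump n (i - a)"
    using bounds assms by (intro bump_mono) auto
  then have wij: "weight n (S i j) < weight n (S i a)"
    using weight_below_le[of j i n] assms bounds unfolding wia
    by (cases "i = j") (auto simp del: weight.simps simp: weight_diag)
  show ?thesis
    using ab
  proof (cases rule: not_zero_pos_cases)
    case 1
    then have "weight n (S j b) = 20*n + bump n (j - b)"
      using weight_below[OF jb] assms by simp
    moreover have "bump n (a - b) < bump n (j - b)"
      using bounds assms 1 by (intro bump_mono) auto
    ultimately show ?thesis
      using wij weight_below_le[OF 1 bounds(4)] by linarith
  next
    case 2
    then have "weight n (S j b) = 20*n + bump n (j - b)"
      using weight_below[OF jb] assms by simp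
    then show ?thesis using wij weight_diag[of n b] bounds unfolding 2 by linarith
  next
    case 3
    then show ?thesis using wij weight_above[of n a] by simp
  qed
qed

text \<open>For j < i a nonzero s_ji must be the letter of weight 0 above the diagonal; for i = j
  the same holds for s_ba.\<close>

lemma weight_swap_indices:
  assumes ia: "pbw_pos n i a" and jb: "pbw_pos n j b" and "j \<le> i" "b < i"
    and ji: "\<not> zero_pos j i" and ba: "\<not> zero_pos b a" and order: "i = j \<Longrightarrow> b < a"
  shows "weight n (S j i) + weight n (S b a) < weight n (S i a) + weight n (S j b)"
proof -
  have bounds: "i \<le> 2*n" "b \<ge> 1" "a \<ge> 1" "n > 0"
    using ia jb by (auto simp: pbw_pos_def)
  show ?thesis
  proof (cases "i = j")
    case True
    then have "a = Suc b" using order ba by (auto simp: zero_pos_def)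
    then show ?thesis
      using True weight_below[OF jb] \<open>b < i\<close> bounds weight_diag[of n i] weight_above[of n b] by simp
  next
    case False
    then have i: "odd j" "i = Suc j"
      using ji \<open>j \<le> i\<close> by (auto simp: zero_pos_def)
    have wji: "weight n (S j i) = 0" using i weight_above by simp
    have pos: "weight n (S i a) > 0"
      using ia i bounds by (auto simp: pbw_pos_def zero_pos_def)
    have "weight n (S b a) < weight n (S i a)"
      using ba
    proof (cases rule: not_zero_pos_cases)
      case 1
      then have "weight n (S i a) = 20*n + bump n (i - a)"
        using weight_below[OF ia] \<open>b < i\<close> by simp
      moreover have "bump n (b - a) < bump n (i - a)"
        using bounds 1 \<open>b < i\<close> by (intro bump_mono) auto
      ultimately show ?thesis using weight_below_le[OF 1 bounds(4)] by linarith
    next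
      case 2
      then have "weight n (S i a) = 20*n + bump n (i - a)"
        using weight_below[OF ia] \<open>b < i\<close> by simp
      then show ?thesis using weight_diag[of n b] bounds unfolding 2 by simp
    next
      case 3
      then show ?thesis using pos weight_above[of n b] by simp
    qed
    then show ?thesis using wji by simp
  qed
qed

lemma weight_cubic:
  assumes ia: "pbw_pos n i a" and jb: "pbw_pos n j b" and "j \<le> i" "b < a" "a < i"
    and ji: "\<not> zero_pos j i"
  shows "weight n (S j i) + weight n (S a b) < weight n (S i a) + weight n (S j b)"
proof -
  have bounds: "i \<le> 2*n" "b \<ge> 1" "a \<ge> 1" "n > 0"
    using ia jb by (auto simp: pbw_pos_def)
  have wab: "weight n (S a b) \<le> 20*n + bump n (a - b)"
    using \<open>b < a\<close> bounds by (intro weight_below_le) simp_all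
  have wia: "weight n (S i a) = 20*n + bump n (i - a)"
    using weight_below[OF ia \<open>a < i\<close>] .
  show ?thesis
  proof (cases "i = j")
    case True
    have "weight n (S j b) = 20*n + bump n (j - b)"
      using weight_below[OF jb] True assms by simp
    moreover have "bump n (a - b) < bump n (j - b)"
      using bounds assms True by (intro bump_mono) auto
    ultimately show ?thesis
      using wab wia weight_diag[of n i] True by simp
  next
    case False
    then have i: "odd j" "i = Suc j"
      using ji \<open>j \<le> i\<close> by (auto simp: zero_pos_def)
    have "a \<noteq> j" using ia i by (auto simp: pbw_pos_def)
    then have "a < j" using i \<open>a < i\<close> by simp
    then have "weight n (S j b) = 20*n + bump n (j - b)"
      using weight_below[OF jb] assms by simp
    moreover have "bump n (a - b) < bump n (j - b)"
      using bounds assms i \<open>a < j\<close> by (intro bump_mono) auto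
    ultimately show ?thesis
      using wab wia weight_above[of n j] i by simp
  qed
qed

section \<open>Spanning\<close>

definition pbw_word :: "nat \<Rightarrow> (nat \<times> nat \<Rightarrow> int) \<Rightarrow> gen list" where
  "pbw_word n k = concat (map (\<lambda>(i, j).
     if k (i, j) \<ge> 0 then replicate (nat (k (i, j))) (S i j) else replicate (nat (- k (i, j))) (Sinv i))
     (pbw_positions n))"

abbreviation word_weight :: "nat \<Rightarrow> gen list \<Rightarrow> nat" where
  "word_weight n w \<equiv> sum_list (map (weight n) w)"

text \<open>The defining relations modulo \<open>J\<close>. It is instantiated with the relation
  ideal inside the free algebra, and with J = {0} for the Heisenberg representation. Closure is
  asked only for letters in \<open>gens n\<close>, because the type of the free algebra contains
  further letters.\<close>

locale sp_relations = coefficient_hom sc for sc :: "'k::comm_ring_1 \<Rightarrow> 'r::ring_1" +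
  fixes n :: nat and q qi :: 'k and g :: "gen \<Rightarrow> 'r" and J :: "'r set"
  assumes q_qi: "q * qi = 1"
    and J_0: "0 \<in> J"
    and J_add: "x \<in> J \<Longrightarrow> y \<in> J \<Longrightarrow> x + y \<in> J"
    and J_scale: "x \<in> J \<Longrightarrow> sc c * x \<in> J"
    and J_left: "x \<in> J \<Longrightarrow> u \<in> gens n \<Longrightarrow> g u * x \<in> J"
    and J_right: "x \<in> J \<Longrightarrow> u \<in> gens n \<Longrightarrow> x * g u \<in> J"
    and J_zero: "i \<in> {1..2*n} \<Longrightarrow> j \<in> {1..2*n} \<Longrightarrow> zero_pos i j \<Longrightarrow> g (S i j) \<in> J"
    and J_inv_right: "i \<in> odd_indices n \<Longrightarrow> g (S i (i+1)) * g (Sinv i) - 1 \<in> J"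
    and J_inv_left: "i \<in> odd_indices n \<Longrightarrow> g (Sinv i) * g (S i (i+1)) - 1 \<in> J"
    and J_det: "i \<in> odd_indices n \<Longrightarrow>
      g (S (i+1) (i+1)) * g (S i i) - sc (q^2) * g (S (i+1) i) * g (S i (i+1)) - sc (q^3) \<in> J"
    and J_refl: "i \<in> {1..2*n} \<Longrightarrow> a \<in> {1..2*n} \<Longrightarrow> j \<in> {1..2*n} \<Longrightarrow> b \<in> {1..2*n} \<Longrightarrow>
      sc (q ^ (of_bool (a = j) + of_bool (i = j))) * g (S i a) * g (S j b)
      - sc (q ^ (of_bool (a = b) + of_bool (i = b))) * g (S j b) * g (S i a)
      - (sc ((q - qi) * q ^ of_bool (a = i) * (of_bool (b < a) - of_bool (i < j)))
           * g (S j a) * g (S i b)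
         + sc (q - qi)
           * (sc (q ^ of_bool (a = b) * of_bool (b < i)) * g (S j i) * g (S b a)
              - sc (q ^ of_bool (i = j) * of_bool (a < j)) * g (S i j) * g (S a b))
         + sc ((q - qi)^2 * (of_bool (b < a \<and> a < i) - of_bool (a < i \<and> i < j)))
           * g (S j i) * g (S a b)) \<in> J"
begin

definition val :: "gen list \<Rightarrow> 'r" where
  "val w = prod_list (map g w)"

lemma val_simps [simp]: "val [] = 1" "val (x # w) = g x * val w" "val (u @ v) = val u * val v"
  by (simp_all add: val_def)

lemma J_minus: "x \<in> J \<Longrightarrow> - x \<in> J"
  using J_scale[of x "-1"] by (simp add: hom_minus)

lemma J_diff: "x \<in> J \<Longrightarrow> y \<in> J \<Longrightarrow> x - y \<in> J"
  using J_add[OF _ J_minus, of x y] by simp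

lemma J_val_left: "x \<in> J \<Longrightarrow> set w \<subseteq> gens n \<Longrightarrow> val w * x \<in> J"
  by (induction w) (auto simp: mult.assoc J_left)

lemma J_val_right: "x \<in> J \<Longrightarrow> set w \<subseteq> gens n \<Longrightarrow> x * val w \<in> J"
  by (induction w arbitrary: x) (auto simp: mult.assoc[symmetric] J_right)

lemma gens_S: "i \<in> {1..2*n} \<Longrightarrow> j \<in> {1..2*n} \<Longrightarrow> S i j \<in> gens n"
  by (simp add: gens_def)

lemma pbw_pos_gens: "pbw_pos n i a \<Longrightarrow> S i a \<in> gens n"
  by (simp add: pbw_pos_def gens_S)

section \<open>The filtration by weight and commutation up to units\<close>

inductive_set lower :: "nat \<Rightarrow> 'r set" for m where
  lower_J: "x \<in> J \<Longrightarrow> x \<in> lower m"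
| lower_word: "set w \<subseteq> gens n \<Longrightarrow> word_weight n w < m \<Longrightarrow> val w \<in> lower m"
| lower_add: "x \<in> lower m \<Longrightarrow> y \<in> lower m \<Longrightarrow> x + y \<in> lower m"
| lower_scale: "x \<in> lower m \<Longrightarrow> sc c * x \<in> lower m"

lemma lower_minus: "x \<in> lower m \<Longrightarrow> - x \<in> lower m"
  using lower_scale[of x m "-1"] by (simp add: hom_minus)

lemma lower_diff: "x \<in> lower m \<Longrightarrow> y \<in> lower m \<Longrightarrow> x - y \<in> lower m"
  using lower_add[OF _ lower_minus, of x m y] by simp

lemma lower_left: "x \<in> lower m \<Longrightarrow> u \<in> gens n \<Longrightarrow> g u * x \<in> lower (weight n u + m)"
proof (induction rule: lower.induct)
  case (lower_word w)
  then show ?case using lower.lower_word[of "u # w" "weight n u + m"] by simp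
next
  case (lower_scale x c)
  then show ?case
    using lower.lower_scale[of "g u * x" "weight n u + m" c] by (metis hom_central mult.assoc)
qed (auto intro: lower.intros J_left simp: distrib_left)

lemma lower_right: "x \<in> lower m \<Longrightarrow> u \<in> gens n \<Longrightarrow> x * g u \<in> lower (m + weight n u)"
proof (induction rule: lower.induct)
  case (lower_word w)
  then show ?case using lower.lower_word[of "w @ [u]" "m + weight n u"] by simp
next
  case (lower_scale x c)
  then show ?case
    using lower.lower_scale[of "x * g u" "m + weight n u" c] by (simp add: mult.assoc)
qed (auto intro: lower.intros J_right simp: distrib_right)

lemma lower_val_left: "x \<in> lower m \<Longrightarrow> set w \<subseteq> gens n \<Longrightarrow> val w * x \<in> lower (word_weight n w + m)"
  by (induction w) (auto simp: mult.assoc add.assoc lower_left)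

lemma lower_val_right: "x \<in> lower m \<Longrightarrow> set w \<subseteq> gens n \<Longrightarrow> x * val w \<in> lower (m + word_weight n w)"
proof (induction w arbitrary: x m)
  case (Cons u w)
  from Cons.IH[OF lower_right[OF Cons.prems(1), of u]] Cons.prems show ?case
    by (simp add: mult.assoc add.assoc)
qed simp

text \<open>The witness \<open>d\<close> records that the factor is a unit: over the Laurent
  polynomials a merely nonzero factor could not be divided out.\<close>

definition q_commute :: "gen \<Rightarrow> gen \<Rightarrow> 'r set \<Rightarrow> bool" where
  "q_commute x y A \<longleftrightarrow> (\<exists>c d. c * d = 1 \<and> g x * g y - sc c * (g y * g x) \<in> A)"

lemma q_commute_mono: "q_commute x y A \<Longrightarrow> A \<subseteq> B \<Longrightarrow> q_commute x y B"
  by (auto simp: q_commute_def)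

lemma q_commute_sym:
  assumes "q_commute x y A" and "\<And>c z. z \<in> A \<Longrightarrow> sc c * z \<in> A"
  shows "q_commute y x A"
proof -
  from assms(1) obtain c d where cd: "c * d = 1" "g x * g y - sc c * (g y * g x) \<in> A"
    by (auto simp: q_commute_def)
  have "sc (- d) * (g x * g y - sc c * (g y * g x)) = sc (d * c) * (g y * g x) - sc d * (g x * g y)"
    by (simp add: hom_mult hom_minus right_diff_distrib mult.assoc)
  also have "\<dots> = g y * g x - sc d * (g x * g y)"
    using cd(1) by (simp add: mult.commute)
  finally have "g y * g x - sc d * (g x * g y) \<in> A"
    using assms(2)[OF cd(2)] by metis
  moreover have "d * c = 1" using cd(1) by (simp add: mult.commute)
  ultimately show ?thesis by (auto simp: q_commute_def)
qed

lemma q_commuteI: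
  assumes "c * c' = 1" "d * d' = 1" and "\<And>c z. z \<in> A \<Longrightarrow> sc c * z \<in> A"
    and "sc c * (g x * g y) - sc d * (g y * g x) \<in> A"
  shows "q_commute x y A"
proof -
  have "sc c' * (sc c * (g x * g y) - sc d * (g y * g x))
      = sc (c' * c) * (g x * g y) - sc (c' * d) * (g y * g x)"
    by (simp add: hom_mult right_diff_distrib mult.assoc)
  also have "\<dots> = g x * g y - sc (c' * d) * (g y * g x)"
    using assms(1) by (simp add: mult.commute)
  finally have "g x * g y - sc (c' * d) * (g y * g x) \<in> A"
    using assms(3)[OF assms(4), of c'] by metis
  moreover have "(c' * d) * (c * d') = 1"
    using assms(1,2) by (metis (no_types, lifting) mult.assoc mult.commute mult.right_neutral)
  ultimately show ?thesis by (auto simp: q_commute_def)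
qed

lemma qi_q: "qi * q = 1"
  using q_qi by (simp add: mult.commute)

lemma power_q_qi: "q ^ k * qi ^ k = 1"
  using q_qi by (metis power_mult_distrib power_one)

text \<open>Moving \<open>(q - q\<^sup>-\<^sup>1) q\<^sup>k\<close> to the other side leaves the unit \<open>q\<^sup>k q\<^sup>-\<^sup>1\<close>.\<close>

lemma shifted_unit: "(q ^ k * qi) * (qi ^ k * q) = 1"
  using power_q_qi[of k] q_qi by (metis mult.assoc mult.commute mult.right_neutral)

lemma term_J:
  assumes "c \<noteq> 0 \<Longrightarrow> g x \<in> J \<or> g y \<in> J" "x \<in> gens n" "y \<in> gens n"
  shows "sc c * g x * g y \<in> J"
  using assms J_scale[of "g x * g y" c] J_left[of "g y" x] J_right[of "g x" y] J_0
  by (cases "c = 0") (auto simp: mult.assoc)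

text \<open>A correction term can be dismissed in three ways: zero coefficient, a letter that is
  itself a relator, or smaller weight. The last hypothesis asks for the weight only when the first
  two fail.\<close>

lemma term_lower:
  assumes "i \<in> {1..2*n}" "a \<in> {1..2*n}" "j \<in> {1..2*n}" "b \<in> {1..2*n}"
    and "c \<noteq> 0 \<Longrightarrow> \<not> zero_pos i a \<Longrightarrow> \<not> zero_pos j b \<Longrightarrow> weight n (S i a) + weight n (S j b) < m"
  shows "sc c * g (S i a) * g (S j b) \<in> lower m"
proof (cases "c = 0 \<or> zero_pos i a \<or> zero_pos j b")
  case True
  then have "sc c * g (S i a) * g (S j b) \<in> J"
    using assms by (intro term_J gens_S) (auto intro: J_zero)
  then show ?thesis by (rule lower_J)
next
  case False
  then have "val [S i a, S j b] \<in> lower m"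
    using assms by (intro lower_word) (auto simp: gens_S simp del: weight.simps)
  from lower_scale[OF this, of c] show ?thesis by (simp add: mult.assoc)
qed

text \<open>The reflection relation with its terms named, so that each can be treated separately.\<close>

lemma refl_terms:
  fixes i a j b :: nat
  defines "t1 \<equiv> sc ((q - qi) * q ^ of_bool (a = i) * (of_bool (b < a) - of_bool (i < j))) * g (S j a) * g (S i b)"
    and "t2 \<equiv> sc ((q - qi) * (q ^ of_bool (a = b) * of_bool (b < i))) * g (S j i) * g (S b a)"
    and "t3 \<equiv> sc ((q - qi) * (q ^ of_bool (i = j) * of_bool (a < j))) * g (S i j) * g (S a b)"
    and "t4 \<equiv> sc ((q - qi)^2 * (of_bool (b < a \<and> a < i) - of_bool (a < i \<and> i < j))) * g (S j i) * g (S a b)"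
  assumes "i \<in> {1..2*n}" "a \<in> {1..2*n}" "j \<in> {1..2*n}" "b \<in> {1..2*n}"
  shows "sc (q ^ (of_bool (a = j) + of_bool (i = j))) * (g (S i a) * g (S j b))
      - sc (q ^ (of_bool (a = b) + of_bool (i = b))) * (g (S j b) * g (S i a)) - (t1 + t2 - t3 + t4) \<in> J"
proof -
  have "t2 - t3 = sc (q - qi)
           * (sc (q ^ of_bool (a = b) * of_bool (b < i)) * g (S j i) * g (S b a)
              - sc (q ^ of_bool (i = j) * of_bool (a < j)) * g (S i j) * g (S a b))"
    by (simp add: t2_def t3_def hom_mult[of "q - qi"] mult.assoc right_diff_distrib)
  then show ?thesis
    using J_refl[OF assms(5-8)] by (simp only: t1_def t4_def mult.assoc add_diff_eq[symmetric])
qed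

text \<open>All four correction terms of the reflection relation are lighter than the product; each
  is covered by one of the weight inequalities.\<close>

lemma q_commute_rows:
  assumes ia: "pbw_pos n i a" and jb: "pbw_pos n j b" and "j < i"
    and special: "\<not> (odd j \<and> i = Suc j \<and> a = i \<and> b = j)"
  shows "q_commute (S i a) (S j b) (lower (weight n (S i a) + weight n (S j b)))"
proof -
  define m where "m = weight n (S i a) + weight n (S j b)"
  have range: "i \<in> {1..2*n}" "a \<in> {1..2*n}" "j \<in> {1..2*n}" "b \<in> {1..2*n}"
    using ia jb by (auto simp: pbw_pos_def)
  define t1 where "t1 = sc ((q - qi) * q ^ of_bool (a = i) * (of_bool (b < a) - of_bool (i < j))) * g (S j a) * g (S i b)"
  define t2 where "t2 = sc ((q - qi) * (q ^ of_bool (a = b) * of_bool (b < i))) * g (S j i) * g (S b a)"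
  define t3 where "t3 = sc ((q - qi) * (q ^ of_bool (i = j) * of_bool (a < j))) * g (S i j) * g (S a b)"
  define t4 where "t4 = sc ((q - qi)^2 * (of_bool (b < a \<and> a < i) - of_bool (a < i \<and> i < j))) * g (S j i) * g (S a b)"
  have "t1 \<in> lower m"
    unfolding t1_def m_def using \<open>j < i\<close> range special weight_exchange[OF ia jb \<open>j < i\<close>]
    by (intro term_lower) (auto simp: of_bool_def simp del: weight.simps split: if_splits)
  moreover have "t2 \<in> lower m"
    unfolding t2_def m_def using \<open>j < i\<close> range weight_swap_indices[OF ia jb]
    by (intro term_lower) (auto simp: of_bool_def simp del: weight.simps split: if_splits)
  moreover have "t3 \<in> lower m"
    unfolding t3_def m_def using \<open>j < i\<close> range weight_rows_below[OF ia jb]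
    by (intro term_lower) (auto simp: of_bool_def simp del: weight.simps split: if_splits)
  moreover have "t4 \<in> lower m"
    unfolding t4_def m_def using \<open>j < i\<close> range weight_cubic[OF ia jb]
    by (intro term_lower) (auto simp: of_bool_def simp del: weight.simps split: if_splits)
  ultimately have "t1 + t2 - t3 + t4 \<in> lower m"
    by (intro lower_add lower_diff)
  from lower_add[OF lower_J[OF refl_terms[OF range, folded t1_def t2_def t3_def t4_def]] this]
  show ?thesis
    unfolding m_def[symmetric]
    by (intro q_commuteI[OF power_q_qi power_q_qi lower_scale]) simp_all
qed

text \<open>Within a row the exchange term \<open>t1\<close> is a multiple of the product itself, so
  it is moved to the other side and changes the factor to that of
  \<open>shifted_unit\<close>.\<close>

lemma q_commute_row:
  assumes ia: "pbw_pos n i a" and ib: "pbw_pos n i b" and "b < a"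
  shows "q_commute (S i a) (S i b) (lower (weight n (S i a) + weight n (S i b)))"
proof -
  define m where "m = weight n (S i a) + weight n (S i b)"
  have range: "i \<in> {1..2*n}" "a \<in> {1..2*n}" "i \<in> {1..2*n}" "b \<in> {1..2*n}"
    using ia ib by (auto simp: pbw_pos_def)
  define t1 where "t1 = sc ((q - qi) * q ^ of_bool (a = i) * (of_bool (b < a) - of_bool (i < i))) * g (S i a) * g (S i b)"
  define t2 where "t2 = sc ((q - qi) * (q ^ of_bool (a = b) * of_bool (b < i))) * g (S i i) * g (S b a)"
  define t3 where "t3 = sc ((q - qi) * (q ^ of_bool (i = i) * of_bool (a < i))) * g (S i i) * g (S a b)"
  define t4 where "t4 = sc ((q - qi)^2 * (of_bool (b < a \<and> a < i) - of_bool (a < i \<and> i < i))) * g (S i i) * g (S a b)"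
  have "t2 \<in> lower m"
    unfolding t2_def m_def using \<open>b < a\<close> range weight_swap_indices[OF ia ib]
    by (intro term_lower) (auto simp: of_bool_def simp del: weight.simps split: if_splits)
  moreover have "t3 \<in> lower m"
    unfolding t3_def m_def using \<open>b < a\<close> range weight_rows_below[OF ia ib]
    by (intro term_lower) (auto simp: of_bool_def simp del: weight.simps split: if_splits)
  moreover have "t4 \<in> lower m"
    unfolding t4_def m_def using \<open>b < a\<close> range weight_cubic[OF ia ib]
    by (intro term_lower) (auto simp: of_bool_def simp del: weight.simps split: if_splits)
  ultimately have "t2 - t3 + t4 \<in> lower m"
    by (intro lower_add lower_diff)
  from lower_add[OF lower_J[OF refl_terms[OF range, folded t1_def t2_def t3_def t4_def]] this]
  have "sc (q ^ (of_bool (a = i) + of_bool (i = i))) * (g (S i a) * g (S i b)) - t1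
      - sc (q ^ (of_bool (a = b) + of_bool (i = b))) * (g (S i b) * g (S i a)) \<in> lower m"
    by (simp add: algebra_simps)
  moreover have "sc (q ^ (of_bool (a = i) + of_bool (i = i))) * (g (S i a) * g (S i b)) - t1
      = sc (q ^ of_bool (a = i) * qi) * (g (S i a) * g (S i b))"
  proof -
    have "q ^ of_bool (a = i) * qi = q ^ (of_bool (a = i) + of_bool (i = i)) - (q - qi) * q ^ of_bool (a = i)"
      by (simp add: algebra_simps)
    then show ?thesis
      using \<open>b < a\<close> by (simp only: t1_def hom_diff left_diff_distrib mult.assoc) simp
  qed
  ultimately show ?thesis
    unfolding m_def[symmetric]
    by (intro q_commuteI[OF shifted_unit power_q_qi lower_scale]) simp_all
qed

text \<open>No lighter words are left over: a correction term either lies in \<open>J\<close> or is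
  a multiple of one of the two products. Commutation modulo \<open>J\<close> alone is what can be
  passed on to the inverse letter.\<close>

lemma q_commute_unit:
  assumes i: "i \<in> odd_indices n" and jb: "pbw_pos n j b"
  shows "q_commute (S i (Suc i)) (S j b) J"
proof -
  have range: "i \<in> {1..2*n}" "Suc i \<in> {1..2*n}" "j \<in> {1..2*n}" "b \<in> {1..2*n}"
    and nz: "\<not> zero_pos j b" and "odd i"
    using odd_indicesD[OF i] jb by (auto simp: pbw_pos_def)
  define t1 where "t1 = sc ((q - qi) * q ^ of_bool (Suc i = i) * (of_bool (b < Suc i) - of_bool (i < j))) * g (S j (Suc i)) * g (S i b)"
  define t2 where "t2 = sc ((q - qi) * (q ^ of_bool (Suc i = b) * of_bool (b < i))) * g (S j i) * g (S b (Suc i))"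
  define t3 where "t3 = sc ((q - qi) * (q ^ of_bool (i = j) * of_bool (Suc i < j))) * g (S i j) * g (S (Suc i) b)"
  define t4 where "t4 = sc ((q - qi)^2 * (of_bool (b < Suc i \<and> Suc i < i) - of_bool (Suc i < i \<and> i < j))) * g (S j i) * g (S (Suc i) b)"
  have "t2 \<in> J"
    unfolding t2_def using range \<open>odd i\<close>
    by (intro term_J gens_S disjI2 J_zero) (auto simp: zero_pos_def of_bool_def split: if_splits)
  moreover have "t3 \<in> J"
    unfolding t3_def using range \<open>odd i\<close>
    by (intro term_J gens_S disjI1 J_zero) (auto simp: zero_pos_def of_bool_def split: if_splits)
  moreover have "t4 \<in> J" by (simp add: t4_def J_0)
  ultimately have "t2 - t3 + t4 \<in> J" by (intro J_add J_diff)
  from J_add[OF refl_terms[OF range, folded t1_def t2_def t3_def t4_def] this]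
  have E: "sc (q ^ (of_bool (Suc i = j) + of_bool (i = j))) * (g (S i (Suc i)) * g (S j b)) - t1
      - sc (q ^ (of_bool (Suc i = b) + of_bool (i = b))) * (g (S j b) * g (S i (Suc i))) \<in> J"
    by (simp add: algebra_simps)
  consider "i = j" "b = Suc i" | "i = j" "b \<noteq> Suc i" | "i < j" "b = Suc i" | "i \<noteq> j" "\<not> (i < j \<and> b = Suc i)"
    by auto
  then show ?thesis
  proof cases
    case 1
    then show ?thesis by (auto simp: q_commute_def intro!: exI[of _ 1] J_0)
  next
    case 2
    then have "b < Suc i"
      using nz \<open>odd i\<close> by (auto simp: zero_pos_def)
    then have "sc qi * (g (S i (Suc i)) * g (S j b))
        - sc (q ^ (of_bool (Suc i = b) + of_bool (i = b))) * (g (S j b) * g (S i (Suc i))) \<in> J"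
      using E 2 by (simp add: t1_def hom_diff left_diff_distrib mult.assoc)
    then show ?thesis
      by (intro q_commuteI[OF qi_q power_q_qi J_scale])
  next
    case 3
    then have "sc (q ^ (of_bool (Suc i = j) + of_bool (i = j))) * (g (S i (Suc i)) * g (S j b))
        - sc qi * (g (S j b) * g (S i (Suc i))) \<in> J"
      using E by (simp add: t1_def hom_diff hom_minus left_diff_distrib mult.assoc algebra_simps)
    then show ?thesis
      by (intro q_commuteI[OF power_q_qi qi_q J_scale])
  next
    case 4
    \<comment> \<open>The coefficient of \<open>t1\<close> is zero unless exactly one of b \<le> i
      and i < j holds, and then one of its two letters is a relator.\<close>
    have "t1 \<in> J"
    proof (cases "b \<le> i \<longleftrightarrow> i < j")
      case True
      then show ?thesis by (auto simp: t1_def J_0)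
    next
      case False
      then have "zero_pos j (Suc i) \<or> zero_pos i b"
        using 4 \<open>odd i\<close> nz by (auto simp: zero_pos_def)
      then show ?thesis
        unfolding t1_def using range by (intro term_J gens_S) (auto intro: J_zero)
    qed
    from J_add[OF E this] show ?thesis
      by (intro q_commuteI[OF power_q_qi power_q_qi J_scale]) (simp_all add: algebra_simps)
  qed
qed

end

section \<open>Positions and words of the ordered monomials\<close>

lemma set_pairs:
  "(i, a) \<in> set (concat (map (\<lambda>i. map (\<lambda>j. (i, j)) (f i)) xs)) \<longleftrightarrow> i \<in> set xs \<and> a \<in> set (f i)"
  by auto

lemma distinct_pairs:
  "distinct xs \<Longrightarrow> (\<And>i. distinct (f i)) \<Longrightarrow> distinct (concat (map (\<lambda>i. map (\<lambda>j. (i, j)) (f i)) xs))"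
  by (induction xs) (auto simp: distinct_map inj_on_def)

lemma even_rows: "i \<in> set (map (\<lambda>m. 2*m) (rev [1..<n+1])) \<longleftrightarrow> even i \<and> i \<in> {1..2*n}"
proof
  assume "even i \<and> i \<in> {1..2*n}"
  then obtain m where "i = 2*m" "m \<in> {1..n}" by (auto elim!: evenE)
  then show "i \<in> set (map (\<lambda>m. 2*m) (rev [1..<n+1]))"
    unfolding set_map by (intro image_eqI[of _ _ m]) (simp_all del: upt_Suc)
qed auto

lemma odd_rows: "i \<in> set (map (\<lambda>m. 2*m - 1) [1..<n+1]) \<longleftrightarrow> odd i \<and> i \<in> {1..2*n}"
proof
  assume "odd i \<and> i \<in> {1..2*n}"
  then obtain m where "i = 2 * Suc m - 1" "Suc m \<in> {1..n}" by (auto elim!: oddE)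
  then show "i \<in> set (map (\<lambda>m. 2*m - 1) [1..<n+1])"
    unfolding set_map by (intro image_eqI[of _ _ "Suc m"]) (simp_all del: upt_Suc)
qed auto

lemma set_pbw_positions: "(i, a) \<in> set (pbw_positions n) \<longleftrightarrow> pbw_pos n i a"
proof -
  have "(i, a) \<in> set (pbw_positions n) \<longleftrightarrow>
     (even i \<and> i \<in> {1..2*n}) \<and> a \<in> set ([1..<i-1] @ [i]) \<or>
     (odd i \<and> i \<in> {1..2*n}) \<and> a \<in> set [1..<i+2]"
    unfolding pbw_positions_def set_append Un_iff set_pairs even_rows odd_rows ..
  also have "\<dots> \<longleftrightarrow> pbw_pos n i a"
    unfolding pbw_pos_def zero_pos_def by (cases "even i") (auto, presburger)
  finally show ?thesis .
qed

lemma distinct_pbw_positions: "distinct (pbw_positions n)"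
proof -
  have rows: "distinct (map (\<lambda>m. 2*m) (rev [1..<n+1]))" "distinct (map (\<lambda>m. 2*m - 1) [1..<n+1])"
    by (auto simp: distinct_map inj_on_def)
  show ?thesis
    unfolding pbw_positions_def distinct_append
  proof (intro conjI)
    show "distinct [(i, j). i \<leftarrow> map (\<lambda>m. 2*m) (rev [1..<n+1]), j \<leftarrow> [1..<i-1] @ [i]]"
      by (rule distinct_pairs[OF rows(1)]) auto
    show "distinct [(i, j). i \<leftarrow> map (\<lambda>m. 2*m - 1) [1..<n+1], j \<leftarrow> [1..<i+2]]"
      by (rule distinct_pairs[OF rows(2)]) auto
    show "set [(i, j). i \<leftarrow> map (\<lambda>m. 2*m) (rev [1..<n+1]), j \<leftarrow> [1..<i-1] @ [i]]
        \<inter> set [(i, j). i \<leftarrow> map (\<lambda>m. 2*m - 1) [1..<n+1], j \<leftarrow> [1..<i+2]] = {}"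
    proof (rule equals0I, elim IntE)
      fix p :: "nat \<times> nat"
      obtain i j where p: "p = (i, j)" by (cases p)
      assume "p \<in> set [(i, j). i \<leftarrow> map (\<lambda>m. 2*m) (rev [1..<n+1]), j \<leftarrow> [1..<i-1] @ [i]]"
        "p \<in> set [(i, j). i \<leftarrow> map (\<lambda>m. 2*m - 1) [1..<n+1], j \<leftarrow> [1..<i+2]]"
      then show False unfolding p set_pairs even_rows odd_rows by simp
    qed
  qed
qed

lemma count_concat_map: "count (mset (concat (map f xs))) x = (\<Sum>p\<leftarrow>xs. count (mset (f p)) x)"
  by (induction xs) auto

text \<open>Each position contributes copies of a single letter. Admissibility confines negative
  exponents to the positions (i, i + 1), so copies of \<open>Sinv i\<close> come only from
  there.\<close>

lemma count_pbw_word: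
  assumes k: "k \<in> pbw_exponents n"
  shows "count (mset (pbw_word n k)) (S i j) = nat (k (i, j))"
    and "count (mset (pbw_word n k)) (Sinv i) = nat (- k (i, Suc i))"
proof -
  define f where "f = (\<lambda>(i, j). if k (i, j) \<ge> 0 then replicate (nat (k (i, j))) (S i j)
    else replicate (nat (- k (i, j))) (Sinv i))"
  have word: "pbw_word n k = concat (map f (pbw_positions n))"
    by (simp add: pbw_word_def f_def)
  have sum: "count (mset (pbw_word n k)) x = (\<Sum>p\<in>set (pbw_positions n). count (mset (f p)) x)" for x
    unfolding word count_concat_map
    by (simp add: sum_list_distinct_conv_sum_set distinct_pbw_positions)
  have off: "k p = 0" if "p \<notin> set (pbw_positions n)" for p
    using k that by (cases p) (simp add: pbw_exponents_def)
  have neg: "odd i \<and> j = Suc i" if "k (i, j) < 0" for i j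
    using k that off[of "(i, j)"] by (fastforce simp: pbw_exponents_def)
  have "count (mset (f p)) (S i j) = (if p = (i, j) then nat (k (i, j)) else 0)" for p
    by (cases p) (auto simp: f_def)
  then show "count (mset (pbw_word n k)) (S i j) = nat (k (i, j))"
    using off[of "(i, j)"] by (simp add: sum)
  have "count (mset (f p)) (Sinv i) = (if p = (i, Suc i) then nat (- k (i, Suc i)) else 0)" for p
    using neg by (cases p) (force simp: f_def)
  then show "count (mset (pbw_word n k)) (Sinv i) = nat (- k (i, Suc i))"
    using off[of "(i, Suc i)"] by (simp add: sum)
qed

context sp_relations
begin

text \<open>The exceptional pair: exchanging \<open>Xm\<close> and \<open>Y\<close> produces U Z,
  which is heavier. Up to q-commutation of U and Z the determinant relation turns it back into Xm Y
  and a constant. The coefficient of Xm Y becomes 1 - h qi = qi^2, still a unit.\<close>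

lemma q_commute_diagonal:
  assumes i: "i \<in> odd_indices n"
  shows "q_commute (S (Suc i) (Suc i)) (S i i) (lower (weight n (S (Suc i) (Suc i)) + weight n (S i i)))"
proof -
  have range: "i \<in> {1..2*n}" "Suc i \<in> {1..2*n}" and n: "n > 0"
    using odd_indicesD[OF i] by auto
  define Xm where "Xm = g (S (Suc i) (Suc i))"
  define Y where "Y = g (S i i)"
  define U where "U = g (S i (Suc i))"
  define Z where "Z = g (S (Suc i) i)"
  define h where "h = q - qi"
  note defs = Xm_def Y_def U_def Z_def h_def
  have E: "Xm * Y - Y * Xm - sc (h * q) * (U * Z) - sc h * (U * U) \<in> J"
    using refl_terms[of "Suc i" "Suc i" i i] range by (simp add: defs mult.assoc diff_diff_add add.assoc)
  have C: "sc q * (U * Z) - sc q * (Z * U) \<in> J"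
    using refl_terms[of i "Suc i" "Suc i" i] range by (simp add: defs)
  have D: "Xm * Y - sc (q^2) * (Z * U) - sc (q^3) \<in> J"
    using J_det[OF i] by (simp add: defs mult.assoc)
  have hq: "h * qi * q^2 = h * q"
    using q_qi by (simp add: power2_eq_square) (metis mult.assoc mult.commute mult.right_neutral)
  have "(Xm * Y - Y * Xm - sc (h * q) * (U * Z) - sc h * (U * U))
      + sc h * (sc q * (U * Z) - sc q * (Z * U))
      - sc (h * qi) * (Xm * Y - sc (q^2) * (Z * U) - sc (q^3))
    = Xm * Y - Y * Xm - sc h * (U * U) - sc (h * qi) * (Xm * Y)
      + (sc (h * qi * q^2) - sc (h * q)) * (Z * U) + sc (h * qi * q^3)"
    by (simp only: hom_mult right_diff_distrib left_diff_distrib mult.assoc) (simp add: algebra_simps)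
  also have "\<dots> = (Xm * Y - sc (h * qi) * (Xm * Y)) - Y * Xm - sc h * (U * U) + sc (h * qi * q^3)"
    unfolding hq by simp
  also have "Xm * Y - sc (h * qi) * (Xm * Y) = sc (1 - h * qi) * (Xm * Y)"
    by (simp add: hom_diff left_diff_distrib)
  also have "1 - h * qi = qi ^ 2"
    using q_qi by (simp add: h_def left_diff_distrib power2_eq_square)
  finally have "sc (qi ^ 2) * (Xm * Y) - Y * Xm - sc h * (U * U) + sc (h * qi * q^3) \<in> J"
    using J_diff[OF J_add[OF E J_scale[OF C]] J_scale[OF D]] by metis
  moreover have "sc h * (U * U) - sc (h * qi * q^3) \<in> lower (8 * n)"
  proof (intro lower_diff)
    show "sc h * (U * U) \<in> lower (8*n)"
      using lower_scale[OF lower_word[of "[S i (Suc i), S i (Suc i)]" "8*n"], of h] range n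
      by (simp add: gens_S U_def)
    show "sc (h * qi * q^3) \<in> lower (8*n)"
      using lower_scale[OF lower_word[of "[]" "8*n"], of "h * qi * q^3"] n by simp
  qed
  ultimately have "sc (qi ^ 2) * (Xm * Y) - Y * Xm - sc h * (U * U) + sc (h * qi * q^3)
      + (sc h * (U * U) - sc (h * qi * q^3)) \<in> lower (8 * n)"
    using lower_J lower_add by blast
  then have "sc (qi ^ 2) * (Xm * Y) - sc 1 * (Y * Xm) \<in> lower (8 * n)"
    by (simp add: algebra_simps)
  moreover have "qi ^ 2 * q ^ 2 = 1"
    using power_q_qi[of 2] by (simp add: mult.commute)
  ultimately show ?thesis
    using q_commuteI[of "qi^2" "q^2" 1 1, OF _ _ lower_scale, of "8*n" "S (Suc i) (Suc i)" "S i i"]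
    by (simp add: Xm_def Y_def)
qed

text \<open>The commutation relation is multiplied by the inverse letter on both sides, and the
  inverse relations cancel the resulting pairs modulo \<open>J\<close>.\<close>

lemma q_commute_inverse:
  assumes i: "i \<in> odd_indices n" and y: "y \<in> gens n" and xy: "q_commute (S i (Suc i)) y J"
  shows "q_commute (Sinv i) y J"
proof -
  define Xm where "Xm = g (S i (Suc i))"
  define I where "I = g (Sinv i)"
  define Y where "Y = g y"
  have gens: "S i (Suc i) \<in> gens n" "Sinv i \<in> gens n"
    using i odd_indicesD[OF i] by (auto simp: gens_def)
  from xy obtain c d where cd: "c * d = 1" and J: "Xm * Y - sc c * (Y * Xm) \<in> J"
    by (auto simp: q_commute_def Xm_def Y_def)
  have "I * (Xm * Y - sc c * (Y * Xm)) * I \<in> J"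
    unfolding I_def by (intro J_left J_right gens J)
  moreover have "(I * Xm - 1) * Y * I \<in> J"
    unfolding I_def Xm_def Y_def using J_inv_left[OF i] by (intro J_right gens y) simp
  moreover have "sc c * (I * (Y * (Xm * I - 1))) \<in> J"
    unfolding I_def Xm_def Y_def using J_inv_right[OF i] by (intro J_left J_scale gens y) simp
  ultimately have "I * (Xm * Y - sc c * (Y * Xm)) * I - (I * Xm - 1) * Y * I
      + sc c * (I * (Y * (Xm * I - 1))) \<in> J"
    by (intro J_add J_diff)
  moreover have "I * (sc c * z) = sc c * (I * z)" for z
    by (metis hom_central mult.assoc)
  ultimately have "Y * I - sc c * (I * Y) \<in> J"
    by (simp add: algebra_simps)
  then have "q_commute y (Sinv i) J"
    using cd by (auto simp: q_commute_def Y_def I_def)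
  then show ?thesis by (rule q_commute_sym) (rule J_scale)
qed

definition reduced :: "gen \<Rightarrow> bool" where
  "reduced x \<longleftrightarrow> (\<exists>i a. x = S i a \<and> pbw_pos n i a) \<or> (\<exists>i\<in>odd_indices n. x = Sinv i)"

lemma reduced_gens: "reduced x \<Longrightarrow> x \<in> gens n"
  by (auto simp: reduced_def pbw_pos_gens) (auto simp: gens_def)

lemma q_commute_below:
  assumes ia: "pbw_pos n i a" and jb: "pbw_pos n j b" and less: "j < i \<or> i = j \<and> b < a"
  shows "q_commute (S i a) (S j b) (lower (weight n (S i a) + weight n (S j b)))"
proof -
  consider "odd j" "i = Suc j" "a = i" "b = j" | "j < i" "\<not> (odd j \<and> i = Suc j \<and> a = i \<and> b = j)"
    | "i = j" "b < a"
    using less by blast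
  then show ?thesis
  proof cases
    case 1
    then have "j \<in> odd_indices n"
      using jb by (auto simp: odd_indices_def pbw_pos_def)
    from q_commute_diagonal[OF this] 1 show ?thesis by (simp del: weight.simps)
  next
    case 2
    then show ?thesis by (rule q_commute_rows[OF ia jb])
  next
    case 3
    with q_commute_row[OF ia] jb show ?thesis by blast
  qed
qed

lemma q_commute_reduced:
  assumes "reduced x" "reduced y"
  shows "q_commute x y (lower (weight n x + weight n y))"
proof -
  have J_lower: "J \<subseteq> lower m" for m by (auto intro: lower_J)
  have inv: "q_commute (Sinv i) y J" if "i \<in> odd_indices n" "reduced y" for i y
  proof (rule q_commute_inverse[OF that(1) reduced_gens[OF that(2)]])
    show "q_commute (S i (Suc i)) y J"
      using that(2) unfolding reduced_def
    proof (elim disjE exE conjE bexE)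
      fix j b assume "y = S j b" "pbw_pos n j b"
      then show ?thesis using q_commute_unit[OF that(1)] by simp
    next
      fix j assume j: "j \<in> odd_indices n" "y = Sinv j"
      have "q_commute (S j (Suc j)) (S i (Suc i)) J"
        using j that by (intro q_commute_unit pbw_pos_unit)
      then have "q_commute (Sinv j) (S i (Suc i)) J"
        using j that by (intro q_commute_inverse pbw_pos_gens pbw_pos_unit)
      then show ?thesis unfolding j(2) by (rule q_commute_sym) (rule J_scale)
    qed
  qed
  consider i where "i \<in> odd_indices n" "x = Sinv i" | i where "i \<in> odd_indices n" "y = Sinv i"
    | i a j b where "x = S i a" "y = S j b" "pbw_pos n i a" "pbw_pos n j b"
    using assms unfolding reduced_def by blast
  then show ?thesis
  proof cases
    case 1
    then show ?thesis using inv[OF 1(1) assms(2)] q_commute_mono J_lower by blast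
  next
    case 2
    then have "q_commute y x J" using inv[OF 2(1) assms(1)] by simp
    then have "q_commute x y J" by (rule q_commute_sym) (rule J_scale)
    then show ?thesis using q_commute_mono J_lower by blast
  next
    case 3
    consider "j < i \<or> i = j \<and> b < a" | "i < j \<or> j = i \<and> a < b" | "i = j" "a = b"
      by linarith
    then show ?thesis
    proof cases
      case 1
      then show ?thesis using q_commute_below 3 by blast
    next
      case 2
      from q_commute_below[OF 3(4,3) 2] have "q_commute y x (lower (weight n x + weight n y))"
        unfolding 3(1,2) by (simp only: add.commute)
      then show ?thesis by (rule q_commute_sym) (rule lower_scale)
    next
      case eq: 3
      then show ?thesis using 3
        by (auto simp: q_commute_def intro!: exI[of _ 1] lower_J J_0)
    qed
  qed
qed

section \<open>Straightening of words into ordered monomials\<close>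

inductive_set spanned :: "'r set" where
  spanned_J: "x \<in> J \<Longrightarrow> x \<in> spanned"
| spanned_word: "k \<in> pbw_exponents n \<Longrightarrow> val (pbw_word n k) \<in> spanned"
| spanned_add: "x \<in> spanned \<Longrightarrow> y \<in> spanned \<Longrightarrow> x + y \<in> spanned"
| spanned_scale: "x \<in> spanned \<Longrightarrow> sc c * x \<in> spanned"

lemma spanned_diff: "x \<in> spanned \<Longrightarrow> y \<in> spanned \<Longrightarrow> x - y \<in> spanned"
  using spanned_add[OF _ spanned_scale, of x y "-1"] by (simp add: hom_minus)

lemma spanned_cong: "x - y \<in> spanned \<Longrightarrow> x \<in> spanned \<longleftrightarrow> y \<in> spanned"
  using spanned_add[of "x - y" y] spanned_diff[of x "x - y"] by auto

lemma spanned_lower: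
  assumes "\<And>w. set w \<subseteq> gens n \<Longrightarrow> word_weight n w < m \<Longrightarrow> val w \<in> spanned"
  shows "lower m \<subseteq> spanned"
proof
  fix x assume "x \<in> lower m"
  then show "x \<in> spanned"
    by (induction rule: lower.induct) (auto intro: spanned.intros assms)
qed

text \<open>The two words differ by a unit factor and by lighter words, already spanned by
  hypothesis. The equivalence form lets swaps be chained without recording the factors.\<close>

lemma spanned_swap:
  assumes low: "lower (word_weight n (u @ x # y # v)) \<subseteq> spanned"
    and red: "\<forall>z\<in>set (u @ x # y # v). reduced z"
  shows "val (u @ x # y # v) \<in> spanned \<longleftrightarrow> val (u @ y # x # v) \<in> spanned"
proof -
  have gens: "set u \<subseteq> gens n" "set v \<subseteq> gens n"
    using red reduced_gens by auto
  obtain c d where cd: "c * d = 1" and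
    xy: "g x * g y - sc c * (g y * g x) \<in> lower (weight n x + weight n y)"
    using q_commute_reduced[of x y] red by (auto simp: q_commute_def)
  have "val u * (g x * g y - sc c * (g y * g x)) * val v
      \<in> lower (word_weight n u + (weight n x + weight n y) + word_weight n v)"
    by (intro lower_val_right lower_val_left xy gens)
  also have "val u * (g x * g y - sc c * (g y * g x)) * val v
      = val (u @ x # y # v) - sc c * val (u @ y # x # v)"
    by (simp add: right_diff_distrib left_diff_distrib mult.assoc) (metis hom_central mult.assoc)
  also have "word_weight n u + (weight n x + weight n y) + word_weight n v = word_weight n (u @ x # y # v)"
    by simp
  finally have "val (u @ x # y # v) - sc c * val (u @ y # x # v) \<in> spanned"
    using low by blast
  then have "val (u @ x # y # v) \<in> spanned \<longleftrightarrow> sc c * val (u @ y # x # v) \<in> spanned"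
    by (rule spanned_cong)
  also have "\<dots> \<longleftrightarrow> val (u @ y # x # v) \<in> spanned"
  proof
    assume "sc c * val (u @ y # x # v) \<in> spanned"
    from spanned_scale[OF this, of d] cd show "val (u @ y # x # v) \<in> spanned"
      by (simp add: mult.assoc[symmetric] hom_mult[symmetric] mult.commute del: val_simps)
  qed (rule spanned_scale)
  finally show ?thesis .
qed

lemma spanned_move:
  assumes "lower (word_weight n (t @ x # u @ v)) \<subseteq> spanned"
    and "\<forall>z\<in>set (t @ x # u @ v). reduced z"
  shows "val (t @ x # u @ v) \<in> spanned \<longleftrightarrow> val (t @ u @ x # v) \<in> spanned"
  using assms
proof (induction u arbitrary: t)
  case (Cons y u)
  have "val (t @ x # y # (u @ v)) \<in> spanned \<longleftrightarrow> val (t @ y # x # (u @ v)) \<in> spanned"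
    using Cons.prems by (intro spanned_swap) simp_all
  moreover have "val ((t @ [y]) @ x # u @ v) \<in> spanned \<longleftrightarrow> val ((t @ [y]) @ u @ x # v) \<in> spanned"
    using Cons.prems by (intro Cons.IH) (simp_all add: add_ac)
  ultimately show ?case by (simp del: val_simps)
qed simp

text \<open>The induction passes letters of \<open>w\<close> to the prefix \<open>t\<close>, where
  they stay fixed, and afterwards moves each to its place in w'.\<close>

lemma spanned_permute:
  assumes "lower (word_weight n (t @ w)) \<subseteq> spanned"
    and "\<forall>z\<in>set (t @ w). reduced z" and "mset w = mset w'"
  shows "val (t @ w) \<in> spanned \<longleftrightarrow> val (t @ w') \<in> spanned"
  using assms
proof (induction w arbitrary: t w')
  case (Cons x w)
  from Cons.prems(3) have "x \<in> set w'" by (metis list.set_intros(1) set_mset_mset)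
  then obtain u v where w': "w' = u @ x # v" by (meson split_list)
  with Cons.prems(3) have eq: "mset w = mset (u @ v)" by simp
  have weight: "word_weight n w = word_weight n (u @ v)"
    using eq by (metis mset_map sum_mset_sum_list)
  have "val ((t @ [x]) @ w) \<in> spanned \<longleftrightarrow> val ((t @ [x]) @ u @ v) \<in> spanned"
    using Cons.prems eq by (intro Cons.IH) simp_all
  moreover have "val (t @ x # u @ v) \<in> spanned \<longleftrightarrow> val (t @ u @ x # v) \<in> spanned"
  proof (rule spanned_move)
    show "lower (word_weight n (t @ x # u @ v)) \<subseteq> spanned"
      using Cons.prems(1) weight by simp
    show "\<forall>z\<in>set (t @ x # u @ v). reduced z"
      using Cons.prems(2) eq by (metis Un_iff list.set_intros(1,2) set_append set_mset_mset set_ConsD)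
  qed
  ultimately show ?case by (simp add: w' del: val_simps)
qed simp

end

text \<open>The exponent is the difference of the counts of a letter and its inverse; it determines
  both counts because the two never occur together.\<close>

lemma pbw_exponent_word:
  assumes letters: "\<And>i a. S i a \<in> set w \<Longrightarrow> pbw_pos n i a" "\<And>i. Sinv i \<in> set w \<Longrightarrow> i \<in> odd_indices n"
    and cancelled: "\<And>i. S i (Suc i) \<in> set w \<Longrightarrow> Sinv i \<notin> set w"
  obtains k where "k \<in> pbw_exponents n" "mset w = mset (pbw_word n k)"
proof -
  define k where "k = (\<lambda>(i, j). int (count (mset w) (S i j))
    - (if j = Suc i then int (count (mset w) (Sinv i)) else 0))"
  have odd: "odd i" "pbw_pos n i (Suc i)" if "count (mset w) (Sinv i) > 0" for i
    using letters(2)[of i] that pbw_pos_unit[of i] by (auto simp: odd_indices_def)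
  have zero: "count (mset w) (S i j) = 0" if "\<not> pbw_pos n i j" for i j
    using letters(1)[of i j] that by (simp add: count_eq_zero_iff) blast
  have k: "k \<in> pbw_exponents n"
  proof -
    have inv: "int (count (mset w) (Sinv i)) = 0" if "\<not> pbw_pos n i (Suc i)" for i
      using odd(2)[of i] that by (cases "count (mset w) (Sinv i) = 0") auto
    have "k (i, j) = 0" if ij: "\<not> pbw_pos n i j" for i j
    proof -
      have z: "int (count (mset w) (S i j)) = 0" using zero[OF ij] by (simp only: of_nat_0)
      show ?thesis
      proof (cases "j = Suc i")
        case True
        then have "int (count (mset w) (Sinv i)) = 0" using inv ij by blast
        then show ?thesis unfolding k_def prod.case z by simp
      next
        case False
        then show ?thesis unfolding k_def prod.case z by simp
      qed
    qed
    moreover have "odd i \<and> j = i + 1 \<or> k (i, j) \<ge> 0" if "pbw_pos n i j" for i j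
      using that by (auto simp: k_def pbw_pos_def zero_pos_def)
    ultimately have "\<forall>i j. \<not> pbw_pos n i j \<longrightarrow> k (i, j) = 0"
      "\<forall>i j. pbw_pos n i j \<longrightarrow> odd i \<and> j = i + 1 \<or> k (i, j) \<ge> 0"
      by blast+
    then show ?thesis
      unfolding pbw_exponents_def mem_Collect_eq split_paired_All set_pbw_positions Ball_def prod.case
      by simp
  qed
  have disjoint: "count (mset w) (S i (Suc i)) = 0 \<or> count (mset w) (Sinv i) = 0" for i
    using cancelled[of i] by (auto simp: count_eq_zero_iff)
  have split: "nat (int a - (if P then int b else 0)) = a" if "P \<Longrightarrow> a = 0 \<or> b = 0" for a b P
    using that by auto
  have split': "nat (- (int a - int b)) = b" if "a = 0 \<or> b = 0" for a b
    using that by auto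
  have "count (mset w) x = count (mset (pbw_word n k)) x" for x
  proof (cases x)
    case (S i j)
    show ?thesis
      unfolding S count_pbw_word[OF k] unfolding k_def prod.case by (rule split[symmetric]) (metis disjoint)
  next
    case (Sinv i)
    show ?thesis
      unfolding Sinv count_pbw_word[OF k] unfolding k_def prod.case if_P[OF refl]
      by (rule split'[symmetric]) (rule disjoint)
  qed
  then have "mset w = mset (pbw_word n k)" by (simp add: multiset_eq_iff)
  with k that show ?thesis by blast
qed

context sp_relations
begin

text \<open>The determinant relation times the inverse of s_{i,i+1} expresses the letter by words of
  weights 8n and 0, below its own 8n + 1.\<close>

lemma eliminate_subdiagonal:
  assumes i: "i \<in> odd_indices n"
  shows "g (S (Suc i) i) - (sc (qi^2) * val [S (Suc i) (Suc i), S i i, Sinv i] - sc (qi^2 * q^3) * val [Sinv i]) \<in> J"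
proof -
  define Xm where "Xm = g (S (Suc i) (Suc i)) * g (S i i)"
  define U where "U = g (S i (Suc i))"
  define Z where "Z = g (S (Suc i) i)"
  define I where "I = g (Sinv i)"
  have gens: "S (Suc i) i \<in> gens n" "Sinv i \<in> gens n"
    using i odd_indicesD[OF i] by (auto simp: gens_def)
  have "Xm - sc (q^2) * (Z * U) - sc (q^3) \<in> J"
    using J_det[OF i] by (simp add: Xm_def Z_def U_def mult.assoc)
  then have D: "(Xm - sc (q^2) * (Z * U) - sc (q^3)) * I \<in> J"
    unfolding I_def by (rule J_right) (rule gens)
  have C: "sc (q^2) * (Z * (U * I - 1)) \<in> J"
    unfolding Z_def U_def I_def using J_inv_right[OF i] by (intro J_scale J_left gens) simp
  have "sc (- (qi^2)) * ((Xm - sc (q^2) * (Z * U) - sc (q^3)) * I + sc (q^2) * (Z * (U * I - 1)))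
      = sc (qi^2 * q^2) * Z - (sc (qi^2) * (Xm * I) - sc (qi^2 * q^3) * I)"
    by (simp add: hom_minus hom_mult[of "qi^2"] left_diff_distrib right_diff_distrib mult.assoc)
  also have "qi^2 * q^2 = 1"
    using power_q_qi[of 2] by (simp add: mult.commute)
  finally show ?thesis
    using J_scale[OF J_add[OF D C], of "- (qi^2)"] by (simp add: Xm_def Z_def I_def mult.assoc)
qed

text \<open>Length is the second component of the measure because s_{i,i+1} and its inverse have
  weight 0, so cancelling them only shortens the word. Eliminating a subdiagonal letter may lengthen
  the word but lowers the weight.\<close>

theorem word_spanned: "set w \<subseteq> gens n \<Longrightarrow> val w \<in> spanned"
proof (induction w rule: wf_induct[OF wf_measures[of "[word_weight n, length]"]])
  case (1 w)
  have IH: "val w' \<in> spanned"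
    if "set w' \<subseteq> gens n"
      "word_weight n w' < word_weight n w \<or> word_weight n w' = word_weight n w \<and> length w' < length w" for w'
    using 1 that by auto
  have low: "lower (word_weight n w) \<subseteq> spanned"
    by (rule spanned_lower) (rule IH; simp)
  consider (zero) i j where "S i j \<in> set w" "zero_pos i j"
    | (sub) i where "S (Suc i) i \<in> set w" "odd i" "\<forall>z\<in>set w. \<forall>i j. z = S i j \<longrightarrow> \<not> zero_pos i j"
    | (red) "\<forall>z\<in>set w. reduced z"
  proof -
    have "reduced z" if "z \<in> set w" "\<And>i j. z = S i j \<Longrightarrow> \<not> zero_pos i j" "\<And>i. z = S (Suc i) i \<Longrightarrow> even i" for z
    proof -
      have "z \<in> gens n" using that 1 by auto
      then show ?thesis
        using that(2,3) by (fastforce simp: gens_def reduced_def pbw_pos_def)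
    qed
    then show thesis using zero sub red by metis
  qed
  then show ?case
  proof cases
    case zero
    then obtain u v where w: "w = u @ S i j # v" by (meson split_list)
    have "val u * (g (S i j) * val v) \<in> J"
      using 1(2) zero w by (intro J_val_left J_val_right J_zero) (auto simp: gens_def)
    then show ?thesis by (simp add: w spanned_J)
  next
    case sub
    have "Suc i \<in> {1..2*n}" "i \<in> {1..2*n}"
      using sub 1(2) by (auto simp: gens_def)
    then have i: "i \<in> odd_indices n" "n > 0" using \<open>odd i\<close> by (auto simp: odd_indices_def)
    obtain u v where w: "w = u @ S (Suc i) i # v" using sub(1) by (meson split_list)
    have gens: "set u \<subseteq> gens n" "set v \<subseteq> gens n" using 1(2) w by auto
    have i_gens: "S (Suc i) (Suc i) \<in> gens n" "S i i \<in> gens n" "Sinv i \<in> gens n"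
      using i odd_indicesD[OF i(1)] by (auto simp: gens_def)
    define t where "t = sc (qi^2) * val [S (Suc i) (Suc i), S i i, Sinv i] - sc (qi^2 * q^3) * val [Sinv i]"
    have "val u * (g (S (Suc i) i) - t) * val v \<in> J"
      unfolding t_def by (intro J_val_left J_val_right eliminate_subdiagonal i gens)
    moreover have "val u * t * val v \<in> spanned"
    proof -
      have "val (u @ [S (Suc i) (Suc i), S i i, Sinv i] @ v) \<in> spanned" "val (u @ [Sinv i] @ v) \<in> spanned"
        by (rule IH; use w gens i_gens \<open>odd i\<close> i(2) in simp)+
      then have "sc (qi^2) * val (u @ [S (Suc i) (Suc i), S i i, Sinv i] @ v)
          - sc (qi^2 * q^3) * val (u @ [Sinv i] @ v) \<in> spanned"
        by (intro spanned_diff spanned_scale)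
      also have "sc (qi^2) * val (u @ [S (Suc i) (Suc i), S i i, Sinv i] @ v)
          - sc (qi^2 * q^3) * val (u @ [Sinv i] @ v) = val u * t * val v"
      proof -
        have "val u * (sc c * y) = sc c * (val u * y)" for c y
          by (metis hom_central mult.assoc)
        then show ?thesis
          by (simp add: t_def left_diff_distrib right_diff_distrib mult.assoc)
      qed
      finally show ?thesis .
    qed
    ultimately have "val u * (g (S (Suc i) i) - t) * val v + val u * t * val v \<in> spanned"
      using spanned_J spanned_add by blast
    then show ?thesis by (simp add: w algebra_simps)
  next
    case red
    show ?thesis
    proof (cases "\<exists>i. S i (Suc i) \<in> set w \<and> Sinv i \<in> set w")
      case True
      then obtain i where i: "S i (Suc i) \<in> set w" "Sinv i \<in> set w" by blast
      from i(1) obtain u v where w: "w = u @ S i (Suc i) # v" by (meson split_list)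
      with i(2) have "Sinv i \<in> set (u @ v)" by auto
      then obtain u' v' where uv: "u @ v = u' @ Sinv i # v'" by (meson split_list)
      define w' where "w' = u' @ v'"
      have "mset w = add_mset (S i (Suc i)) (mset (u @ v))" by (simp add: w)
      then have eq: "mset w = mset (S i (Suc i) # Sinv i # w')"
        unfolding uv by (simp add: w'_def)
      have odd: "i \<in> odd_indices n"
        using red i(2) by (auto simp: reduced_def)
      have "set w = set (S i (Suc i) # Sinv i # w')" using eq by (metis set_mset_mset)
      then have gens: "set w' \<subseteq> gens n" using 1(2) by auto
      have "word_weight n w = word_weight n (S i (Suc i) # Sinv i # w')" "length w = length (S i (Suc i) # Sinv i # w')"
        using eq by (metis mset_map sum_mset_sum_list, metis size_mset)
      then have "val w' \<in> spanned"
        using gens by (intro IH) simp_all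
      moreover have "(g (S i (Suc i)) * g (Sinv i) - 1) * val w' \<in> J"
        using J_inv_right[OF odd] gens by (intro J_val_right) simp_all
      ultimately have "(g (S i (Suc i)) * g (Sinv i) - 1) * val w' + val w' \<in> spanned"
        using spanned_J spanned_add by blast
      then have "val ([] @ S i (Suc i) # Sinv i # w') \<in> spanned"
        by (simp add: left_diff_distrib mult.assoc)
      then show ?thesis
        using spanned_permute[of "[]" w "S i (Suc i) # Sinv i # w'"] low red eq by simp
    next
      case False
      obtain k where "k \<in> pbw_exponents n" "mset w = mset (pbw_word n k)"
        using red False by (elim pbw_exponent_word[rotated 3]) (auto simp: reduced_def)
      then show ?thesis
        using spanned_permute[of "[]" w] low red spanned_word by simp
    qed
  qed
qed

end

section \<open>Products of oscillator matrices and the resulting representation\<close>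

definition osc_matrix :: "nat \<Rightarrow> bool \<Rightarrow> nat \<Rightarrow> nat \<Rightarrow> heis_alg" where
  "osc_matrix m u = q_oscillator.entry laurent_heis (osc_a m) (osc_ai m) (osc_xi m) (osc_eta m) u"

lemma osc_matrix_simps:
  "osc_matrix m True i j = (if i = j then osc_a m i else if j < i then osc_xi m i * osc_eta m j else 0)"
  "osc_matrix m False i j = (if i = j then osc_ai m i else if i < j then - (osc_xi m i * osc_eta m j) else 0)"
proof -
  interpret q_oscillator laurent_heis zl zli "osc_a m" "osc_ai m" "osc_xi m" "osc_eta m"
    by (rule q_oscillator_osc)
  show "osc_matrix m True i j = (if i = j then osc_a m i else if j < i then osc_xi m i * osc_eta m j else 0)"
    "osc_matrix m False i j = (if i = j then osc_ai m i else if i < j then - (osc_xi m i * osc_eta m j) else 0)"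
    by (simp_all add: osc_matrix_def entry_def diag_def coef_def laurent_heis.hom_minus)
qed

text \<open>The lower and the upper product use the same oscillators in the same order; factors with
  different oscillators commute entrywise, as \<open>exchange_comp\<close> demands.\<close>

fun osc_product :: "nat \<Rightarrow> nat \<Rightarrow> bool \<Rightarrow> nat \<Rightarrow> nat \<Rightarrow> heis_alg" where
  "osc_product n 0 u = (\<lambda>i j. of_bool (i = j))"
| "osc_product n (Suc M) u = mat_mult {1..2*n} (osc_product n M u) (osc_matrix M u)"

lemma r_matrix_rows: "r_matrix laurent_heis {1..2*n}"
  by (intro r_matrix.intro laurent_heis.coefficient_hom_axioms r_matrix_axioms.intro) simp

context
  fixes n :: nat
begin

interpretation r_matrix laurent_heis "{1..2*n}" zl "zl - zli"
  by (rule r_matrix_rows)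

lemma exchange_osc_matrix: "(u \<Longrightarrow> t) \<Longrightarrow> exchange (osc_matrix m u) (osc_matrix m t)"
proof -
  assume ut: "u \<Longrightarrow> t"
  interpret osc: q_oscillator laurent_heis zl zli "osc_a m" "osc_ai m" "osc_xi m" "osc_eta m"
    by (rule q_oscillator_osc)
  show ?thesis
    unfolding exchange_def osc_matrix_def
    using osc.exchanged_all[of u t, OF ut] unfolding osc.exchanged_def by blast
qed

lemma entries_commute_osc_matrix:
  assumes "m \<noteq> m'"
  shows "entries_commute (osc_matrix m u) (osc_matrix m' t)"
proof -
  define E where "E m i a = {osc_a m i, osc_ai m i, 0, osc_xi m i * osc_eta m a, - (osc_xi m i * osc_eta m a)}" for m i a
  have mem: "osc_matrix m u i a \<in> E m i a" for m u i a
    by (cases u) (auto simp: osc_matrix_simps E_def)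
  have left: "x * y * z = z * (x * y)" if "x * z = z * x" "y * z = z * y" for x y z :: heis_alg
  proof -
    have "x * y * z = x * (z * y)" by (simp only: mult.assoc that)
    also have "\<dots> = z * (x * y)" by (simp only: mult.assoc[symmetric] that)
    finally show ?thesis .
  qed
  have right: "z * (x * y) = x * y * z" if "z * x = x * z" "z * y = y * z" for x y z :: heis_alg
    using left[of x z y] that by simp
  have minus: "z * (- x) = - x * z" "- x * z = z * (- x)" if "z * x = x * z" for x z :: heis_alg
    using that by simp_all
  have zero: "z * 0 = 0 * z" "0 * z = z * 0" for z :: heis_alg by simp_all
  note c = osc_commute[OF assms]
  have atom: "x * z = z * x" if "x \<in> {osc_a m i, osc_ai m i, osc_xi m i, osc_eta m a}"
    "z \<in> {osc_a m' j, osc_ai m' j, osc_xi m' j, osc_eta m' b}" for x z i a j b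
    using that by (elim insertE emptyE; hypsubst) (rule c; blast)+
  have half: "x * z = z * x" if "x \<in> {osc_a m i, osc_ai m i, osc_xi m i, osc_eta m a}" "z \<in> E m' j b" for x z i a j b
    using that(2) unfolding E_def
    by (elim insertE emptyE; hypsubst) ((rule minus(1))?, (rule right | rule zero)?; rule atom[OF that(1)]; blast)+
  have "x * z = z * x" if "x \<in> E m i a" "z \<in> E m' j b" for x z i a j b
    using that(1) unfolding E_def
    by (elim insertE emptyE; hypsubst) ((rule minus(2)[OF sym])?, (rule left | rule zero)?; rule half[OF _ that(2)]; blast)+
  then show ?thesis
    unfolding entries_commute_def using mem by blast
qed

lemma entries_commute_mult:
  assumes "entries_commute A C" "entries_commute B C"
  shows "entries_commute (mat_mult {1..2*n} A B) C"
  unfolding entries_commute_def mat_mult_def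
proof (intro ballI)
  fix i a j b assume *: "i \<in> {1..2*n}" "a \<in> {1..2*n}" "j \<in> {1..2*n}" "b \<in> {1..2*n}"
  have "A i s * B s a * C j b = C j b * (A i s * B s a)" if "s \<in> {1..2*n}" for s
  proof -
    have "A i s * C j b = C j b * A i s" "B s a * C j b = C j b * B s a"
      using assms * that unfolding entries_commute_def by blast+
    have "A i s * B s a * C j b = A i s * C j b * B s a"
      by (simp only: mult.assoc \<open>B s a * C j b = C j b * B s a\<close>)
    also have "\<dots> = C j b * (A i s * B s a)" by (simp only: \<open>A i s * C j b = C j b * A i s\<close> mult.assoc[symmetric])
    finally show ?thesis .
  qed
  then show "(\<Sum>s\<in>{1..2*n}. A i s * B s a) * C j b = C j b * (\<Sum>s\<in>{1..2*n}. A i s * B s a)"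
    unfolding sum_distrib_left sum_distrib_right by (rule sum.cong[OF refl])
qed

lemma entries_commute_sym: "entries_commute A B \<Longrightarrow> entries_commute B A"
  unfolding entries_commute_def by metis

lemma entries_commute_product:
  "M \<le> m \<Longrightarrow> entries_commute (osc_product n M u) (osc_matrix m t)"
proof (induction M)
  case 0
  then show ?case unfolding entries_commute_def osc_product.simps by simp
next
  case (Suc M)
  then show ?case
    unfolding osc_product.simps by (intro entries_commute_mult entries_commute_osc_matrix) simp_all
qed

lemma exchange_product: "(u \<Longrightarrow> t) \<Longrightarrow> exchange (osc_product n M u) (osc_product n M t)"
proof (induction M)
  case 0
  show ?case unfolding exchange_def by auto
next
  case (Suc M)
  then show ?case
    unfolding osc_product.simps
    by (intro exchange_comp exchange_osc_matrix entries_commute_sym[OF entries_commute_product]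
        entries_commute_product) simp_all
qed

end

lemma osc_product_triangular:
  "i < j \<Longrightarrow> osc_product n M True i j = 0" "j < i \<Longrightarrow> osc_product n M False i j = 0"
proof (induction M arbitrary: i j)
  case 0
  { case 1 then show ?case by simp }
  { case 2 then show ?case by simp }
next
  case (Suc M)
  { case 1
    then show ?case using Suc(1)
      by (auto simp: mat_mult_def osc_matrix_simps intro!: sum.neutral) }
  { case 2
    then show ?case using Suc(2)
      by (auto simp: mat_mult_def osc_matrix_simps intro!: sum.neutral) }
qed

lemma osc_product_diag:
  assumes "i \<in> {1..2*n}"
  shows "osc_product n (Suc M) u i i = osc_product n M u i i * osc_matrix M u i i"
proof -
  have "osc_product n M u i s * osc_matrix M u s i = 0" if "s \<noteq> i" for s
    using that osc_product_triangular[of i s n M] osc_product_triangular(2)[of s i n M]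
    by (cases u; cases i s rule: linorder_cases) (simp_all add: osc_matrix_simps)
  then show ?thesis
    using assms by (simp add: mat_mult_def sum.remove[of _ i] sum.neutral)
qed

lemma osc_product_inverse:
  assumes "i \<in> {1..2*n}"
  shows "osc_product n M True i i * osc_product n M False i i = 1"
proof (induction M)
  case (Suc M)
  define A B where "A = osc_product n M True i i" and "B = osc_product n M False i i"
  have "B * osc_matrix M True i i = osc_matrix M True i i * B"
    using r_matrix.entries_commute_def[OF r_matrix_rows] entries_commute_product[of M M n False True] assms
    unfolding B_def by blast
  then have "A * osc_matrix M True i i * (B * osc_matrix M False i i)
      = A * B * (osc_matrix M True i i * osc_matrix M False i i)"
    by (simp only: mult.assoc[symmetric]) (simp only: mult.assoc)
  also have "\<dots> = 1"
    using Suc by (simp add: A_def B_def osc_matrix_simps osc_inverse)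
  finally show ?case
    using assms by (simp only: osc_product_diag A_def B_def)
qed simp

lemma twisted_osc:
  "twisted_matrices laurent_heis n zl zli (osc_product n M True) (osc_product n M False)"
  by (intro twisted_matrices.intro r_matrix_rows twisted_matrices_axioms.intro zl_zli exchange_product
      osc_product_triangular osc_product_inverse) simp_all

text \<open>There are 4n oscillators because the classical points constructed later spend two on
  each of the 2n columns.\<close>

definition osc_S :: "nat \<Rightarrow> nat \<Rightarrow> nat \<Rightarrow> heis_alg" where
  "osc_S n = twisted_matrices.S_mat laurent_heis n zl (osc_product n (4*n) True) (osc_product n (4*n) False)"

definition osc_rep :: "nat \<Rightarrow> gen \<Rightarrow> heis_alg" where
  "osc_rep n x = (case x of S i j \<Rightarrow> osc_S n i j
     | Sinv i \<Rightarrow> twisted_matrices.S_inv laurent_heis zli (osc_product n (4*n) True) (osc_product n (4*n) False) i)"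

lemma osc_rep_relations: "sp_relations laurent_heis n zl zli (osc_rep n) {0}"
proof -
  interpret twisted_matrices laurent_heis n zl zli "osc_product n (4*n) True" "osc_product n (4*n) False"
    by (rule twisted_osc)
  have S: "osc_rep n (S i j) = S_mat i j" and Sinv: "osc_rep n (Sinv i) = S_inv i" for i j
    by (simp_all add: osc_rep_def osc_S_def)
  note odd = odd_indicesD
  show ?thesis
  proof (intro sp_relations.intro laurent_heis.coefficient_hom_axioms sp_relations_axioms.intro)
    show "zl * zli = 1" by (rule zl_zli)
    show "osc_rep n (S i j) \<in> {0}" if "zero_pos i j" for i j
      using that S_zero[of i j] by (simp add: S zero_pos_def)
    show "osc_rep n (S i (i + 1)) * osc_rep n (Sinv i) - 1 \<in> {0}" if "i \<in> odd_indices n" for i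
      using odd[OF that] S_inverse(1)[of i] by (simp add: S Sinv)
    show "osc_rep n (Sinv i) * osc_rep n (S i (i + 1)) - 1 \<in> {0}" if "i \<in> odd_indices n" for i
      using odd[OF that] S_inverse(2)[of i] by (simp add: S Sinv)
    show "osc_rep n (S (i + 1) (i + 1)) * osc_rep n (S i i)
        - laurent_heis (zl\<^sup>2) * osc_rep n (S (i + 1) i) * osc_rep n (S i (i + 1)) - laurent_heis (zl ^ 3) \<in> {0}"
      if "i \<in> odd_indices n" for i
      using odd[OF that] S_determinant[of i] by (simp add: S)
  qed (simp_all only: S S_reflection singleton_iff, simp_all)
qed

section \<open>Classical points\<close>

definition mon :: "('i \<Rightarrow> complex) \<Rightarrow> ('i \<Rightarrow>\<^sub>0 int) \<Rightarrow> complex" where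
  "mon p u = (\<Prod>k\<in>Poly_Mapping.keys u. p k powi Poly_Mapping.lookup u k)"

lemma mon_superset:
  assumes "finite K" "Poly_Mapping.keys u \<subseteq> K"
  shows "mon p u = (\<Prod>k\<in>K. p k powi Poly_Mapping.lookup u k)"
  unfolding mon_def using assms by (intro prod.mono_neutral_left) (auto simp: in_keys_iff)

lemma mon_add:
  assumes "\<And>k. p k \<noteq> 0"
  shows "mon p (u + u') = mon p u * mon p u'"
proof -
  define K where "K = Poly_Mapping.keys u \<union> Poly_Mapping.keys u'"
  have K: "finite K" "Poly_Mapping.keys u \<subseteq> K" "Poly_Mapping.keys u' \<subseteq> K"
    "Poly_Mapping.keys (u + u') \<subseteq> K"
    using Poly_Mapping.keys_add[of u u'] by (auto simp: K_def)
  show ?thesis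
    by (simp add: mon_superset[OF K(1)] K lookup_add power_int_add assms prod.distrib)
qed

lemma mon_zero [simp]: "mon p 0 = 1"
  by (simp add: mon_def)

lemma mon_nonzero: "(\<And>k. p k \<noteq> 0) \<Longrightarrow> mon p u \<noteq> 0"
  by (simp add: mon_def)

lemma mon_minus: "(\<And>k. p k \<noteq> 0) \<Longrightarrow> mon p (- u) = inverse (mon p u)"
  using mon_add[of p u "- u"] by (simp add: inverse_unique)

lemma mon_unit: "mon p (unit_vec m i) = p (m, i)"
  by (simp add: mon_def unit_vec_def)

definition laurent_eval :: "complex \<Rightarrow> laurent \<Rightarrow> complex" where
  "laurent_eval q = extend_linear (\<lambda>c. c) (\<lambda>c. q powi c)"

lemma coefficient_hom_id: "coefficient_hom (\<lambda>c::complex. c)"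
  by standard simp_all

lemma algebra_hom_laurent_eval: "q \<noteq> 0 \<Longrightarrow> algebra_hom (\<lambda>c::complex. c) (\<lambda>c. q powi c)"
  by (intro algebra_hom.intro coefficient_hom_id algebra_hom_axioms.intro) (simp_all add: power_int_add)

text \<open>A point of the torus obtained by setting \<open>z\<close> to 1. Since
  \<open>heis_value\<close> ignores the exponent of \<open>z\<close>, the cocycle \<open>dot\<close>
  disappears and the value becomes multiplicative.\<close>

locale heis_point =
  fixes \<rho> \<alpha> :: "nat \<times> nat \<Rightarrow> complex"
  assumes \<rho>: "\<rho> k \<noteq> 0" and \<alpha>: "\<alpha> k \<noteq> 0"
begin

definition heis_value :: "heis \<Rightarrow> complex" where
  "heis_value g = (case g of Heis v u c \<Rightarrow> mon \<rho> u * mon \<alpha> v)"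

lemma algebra_hom_heis_value: "algebra_hom (\<lambda>c::complex. c) heis_value"
proof (intro algebra_hom.intro coefficient_hom_id algebra_hom_axioms.intro)
  show "heis_value 0 = 1" by (simp add: heis_value_def zero_heis_def)
  show "heis_value (g + h) = heis_value g * heis_value h" for g h
    by (cases g; cases h) (simp add: heis_value_def mon_add \<rho> \<alpha>)
qed

definition value_at :: "heis_alg \<Rightarrow> complex" where
  "value_at = extend_linear (\<lambda>c. c) heis_value"

lemma value_at_add: "value_at (x + y) = value_at x + value_at y" and value_at_diff: "value_at (x - y) = value_at x - value_at y"
  and value_at_minus: "value_at (- x) = - value_at x" and value_at_mult: "value_at (x * y) = value_at x * value_at y"
  and value_at_0: "value_at 0 = 0" and value_at_1: "value_at 1 = 1" and value_at_sum: "value_at (sum F A) = (\<Sum>a\<in>A. value_at (F a))"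
  and value_at_prod_list: "value_at (prod_list xs) = prod_list (map value_at xs)"
  unfolding value_at_def
  by (rule coefficient_hom.extend_linear_add coefficient_hom.extend_linear_diff
      coefficient_hom.extend_linear_minus coefficient_hom.extend_linear_0 coefficient_hom.extend_linear_sum
      coefficient_hom_id algebra_hom.extend_mult algebra_hom.extend_1 algebra_hom.extend_prod_list
      algebra_hom_heis_value)+

lemma value_at_hmono: "value_at (hmono v u c) = mon \<rho> u * mon \<alpha> v"
  by (simp add: value_at_def hmono_def heis_value_def coefficient_hom.extend_linear_single[OF coefficient_hom_id])

lemma value_at_laurent: "value_at (laurent_heis p) = laurent_eval 1 p"
proof (induction p rule: poly_mapping_single_induct)
  case (single c d)
  have "value_at (const_alg d) = d"
    unfolding value_at_def by (rule algebra_hom.extend_const[OF algebra_hom_heis_value])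
  then show ?case
    by (simp add: laurent_heis_single value_at_mult value_at_hmono laurent_eval_def
        coefficient_hom.extend_linear_single[OF coefficient_hom_id])
qed (simp_all add: laurent_heis.hom_add value_at_add value_at_0 laurent_eval_def
    coefficient_hom.extend_linear_add[OF coefficient_hom_id] coefficient_hom.extend_linear_0[OF coefficient_hom_id])

lemma value_at_zl: "value_at (laurent_heis zl) = 1" "value_at (laurent_heis zli) = 1"
  by (simp_all add: laurent_heis_zl value_at_hmono)

lemma value_at_osc:
  "value_at (osc_a m i) = \<alpha> (m, i)" "value_at (osc_ai m i) = inverse (\<alpha> (m, i))"
  "value_at (osc_xi m i) = \<rho> (m, i) * mon \<alpha> (partial_sum m i)"
  "value_at (osc_eta m i) = (\<alpha> (m, i) - inverse (\<alpha> (m, i))) / (\<rho> (m, i) * mon \<alpha> (partial_sum m i))"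
  by (simp_all add: osc_defs osc_eta_def value_at_mult value_at_diff value_at_hmono mon_unit mon_minus \<rho> \<alpha> divide_inverse)

end

section \<open>Prescribing classical values column by column\<close>

definition col_mat :: "nat \<Rightarrow> complex \<Rightarrow> (nat \<Rightarrow> complex) \<Rightarrow> nat \<Rightarrow> nat \<Rightarrow> complex" where
  "col_mat j A v i l = (if i = l then if i = j then A else 1 else if l = j then v i else 0)"

lemma mat_mult_col:
  assumes "finite P" "l \<in> P"
  shows "mat_mult P Y (col_mat j A v) i l = (if l = j then Y i j * A + (\<Sum>s\<in>P - {j}. Y i s * v s) else Y i l)"
proof -
  have "mat_mult P Y (col_mat j A v) i l = Y i l * col_mat j A v l l + (\<Sum>s\<in>P - {l}. Y i s * col_mat j A v s l)"
    unfolding mat_mult_def using assms by (rule sum.remove)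
  moreover have "(\<Sum>s\<in>P - {l}. Y i s * col_mat j A v s l) = (\<Sum>s\<in>P - {l}. if l = j then Y i s * v s else 0)"
    by (rule sum.cong) (auto simp: col_mat_def)
  ultimately show ?thesis by (auto simp: col_mat_def)
qed

lemma mat_mult_two_cols:
  assumes "finite P" "l \<in> P"
  shows "mat_mult P (mat_mult P Y (col_mat j A v)) (col_mat j B w) i l =
    (if l = j then Y i j * (A * B) + (\<Sum>s\<in>P - {j}. Y i s * (v s * B + w s)) else Y i l)"
proof (cases "l = j")
  case True
  have "(\<Sum>s\<in>P - {j}. mat_mult P Y (col_mat j A v) i s * w s) = (\<Sum>s\<in>P - {j}. Y i s * w s)"
    by (rule sum.cong) (simp_all add: mat_mult_col[OF assms(1)])
  with True assms show ?thesis
    by (simp add: mat_mult_col[OF assms(1), of _ _ j B w] mat_mult_col[OF assms(1), of j Y j A v] distrib_left distrib_right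
        sum_distrib_right sum.distrib mult.assoc add.assoc)
qed (simp add: mat_mult_col assms)

text \<open>Both the diagonal entry and the column of a product of two column matrices are
  unrestricted, although the columns of the factors have no zero entries and their diagonal
  entries are different from \<open>1\<close> and \<open>-1\<close>.\<close>

lemma column_factorization:
  fixes d :: complex and y :: "nat \<Rightarrow> complex"
  assumes d: "d \<noteq> 0"
  obtains A B r t where "A * B = d" "A \<noteq> 0" "B \<noteq> 0"
    "\<And>i. r i \<noteq> 0" "\<And>i. t i \<noteq> 0" "r j = A - inverse A" "t j = B - inverse B"
    "\<And>i. j < i \<Longrightarrow> r i * B + t i = y i" "\<And>i. i < j \<Longrightarrow> - (r i * inverse B) - t i = y i"
proof -
  \<comment> \<open>Both diagonal entries must differ from 1 and -1, since
    \<open>A - inverse A\<close> and \<open>B - inverse B\<close> have to be nonzero. For A = d / B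
    this excludes d and -d as values of B.\<close>
  have "infinite (UNIV - {0, 1, -1, d, -d})"
    by (simp add: infinite_UNIV_char_0)
  then obtain B where "B \<in> UNIV - {0, 1, -1, d, -d}"
    by (metis ex_in_conv finite.emptyI)
  then have B: "B \<noteq> 0" "B \<noteq> 1" "B \<noteq> -1" "d \<noteq> B" "d \<noteq> - B" by auto
  define A where "A = d / B"
  have A: "A \<noteq> 0" "A \<noteq> 1" "A \<noteq> -1" "A * B = d"
    using B d by (auto simp: A_def field_simps)
  have square: "x - inverse x \<noteq> 0" if "x \<noteq> 0" "x \<noteq> 1" "x \<noteq> -1" for x :: complex
  proof
    assume "x - inverse x = 0"
    then have "x * x = 1" using that by (simp add: field_simps)
    then have "(x - 1) * (x + 1) = 0" by (simp add: algebra_simps)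
    then show False using that by (auto simp: eq_neg_iff_add_eq_0)
  qed
  \<comment> \<open>Two unknowns for one equation leave room to avoid zero in both.\<close>
  have solve: "\<exists>a b. a \<noteq> 0 \<and> b \<noteq> 0 \<and> a * c + b = z" if "c \<noteq> 0" for c z :: complex
  proof -
    have "infinite (UNIV - {0, z / c})" by (simp add: infinite_UNIV_char_0)
    then obtain a where "a \<in> UNIV - {0, z / c}" by (metis ex_in_conv finite.emptyI)
    then have "a \<noteq> 0" "z - a * c \<noteq> 0" using that by (auto simp: field_simps)
    then show ?thesis by (intro exI[of _ a] exI[of _ "z - a * c"]) simp
  qed
  have "\<exists>a b. a \<noteq> 0 \<and> b \<noteq> 0 \<and> (i = j \<longrightarrow> a = A - inverse A \<and> b = B - inverse B) \<and>
    (j < i \<longrightarrow> a * B + b = y i) \<and> (i < j \<longrightarrow> - (a * inverse B) - b = y i)" for i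
  proof (cases i j rule: linorder_cases)
    case less
    obtain a b where "a \<noteq> 0" "b \<noteq> 0" "a * inverse B + b = - y i"
      using solve[of "inverse B" "- y i"] B by auto
    moreover have "- (a * inverse B) - b = - (a * inverse B + b)" by simp
    ultimately show ?thesis using less by (intro exI[of _ a] exI[of _ b]) simp
  next
    case equal
    then show ?thesis using square[of A] square[of B] A B by auto
  next
    case greater
    then show ?thesis using solve[of B "y i"] B by auto
  qed
  then obtain r t where "\<And>i. r i \<noteq> 0 \<and> t i \<noteq> 0 \<and> (i = j \<longrightarrow> r i = A - inverse A \<and> t i = B - inverse B) \<and>
    (j < i \<longrightarrow> r i * B + t i = y i) \<and> (i < j \<longrightarrow> - (r i * inverse B) - t i = y i)"
    by metis
  with A B show ?thesis by (intro that[of A B r t]) auto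
qed

text \<open>Oscillators \<open>2j - 2\<close> and \<open>2j - 1\<close> are used for column \<open>j\<close>.\<close>

lemma classical_columns:
  fixes d :: "nat \<Rightarrow> complex" and y :: "nat \<Rightarrow> nat \<Rightarrow> complex"
  assumes d: "\<And>j. d j \<noteq> 0"
  obtains \<rho> \<alpha> where "heis_point \<rho> \<alpha>"
    "\<And>J i l. l \<in> {1..2*n} \<Longrightarrow> heis_point.value_at \<rho> \<alpha> (osc_product n (2 * Suc J) True i l) =
      (if l = Suc J then heis_point.value_at \<rho> \<alpha> (osc_product n (2*J) True i l) * d l
         + (\<Sum>s\<in>{1..2*n} - {l}. heis_point.value_at \<rho> \<alpha> (osc_product n (2*J) True i s) * (if l < s then y l s else 0))
       else heis_point.value_at \<rho> \<alpha> (osc_product n (2*J) True i l))"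
    "\<And>J i l. l \<in> {1..2*n} \<Longrightarrow> heis_point.value_at \<rho> \<alpha> (osc_product n (2 * Suc J) False i l) =
      (if l = Suc J then heis_point.value_at \<rho> \<alpha> (osc_product n (2*J) False i l) * inverse (d l)
         + (\<Sum>s\<in>{1..2*n} - {l}. heis_point.value_at \<rho> \<alpha> (osc_product n (2*J) False i s) * (if s < l then y l s else 0))
       else heis_point.value_at \<rho> \<alpha> (osc_product n (2*J) False i l))"
proof -
  have "\<exists>A B r t. A * B = d j \<and> A \<noteq> 0 \<and> B \<noteq> 0 \<and> (\<forall>i. r i \<noteq> 0) \<and> (\<forall>i. t i \<noteq> 0) \<and>
    r j = A - inverse A \<and> t j = B - inverse B \<and>
    (\<forall>i. j < i \<longrightarrow> r i * B + t i = y j i) \<and> (\<forall>i. i < j \<longrightarrow> - (r i * inverse B) - t i = y j i)" for j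
    using column_factorization[OF d[of j], of j "y j"] by metis
  then obtain A B r t where AB: "\<And>j. A j * B j = d j" "\<And>j. A j \<noteq> 0" "\<And>j. B j \<noteq> 0"
    and rt: "\<And>j i. r j i \<noteq> 0" "\<And>j i. t j i \<noteq> 0" "\<And>j. r j j = A j - inverse (A j)" "\<And>j. t j j = B j - inverse (B j)"
      "\<And>j i. j < i \<Longrightarrow> r j i * B j + t j i = y j i" "\<And>j i. i < j \<Longrightarrow> - (r j i * inverse (B j)) - t j i = y j i"
    by metis
  define col where "col m = Suc (m div 2)" for m
  define D where "D m = (if even m then A (col m) else B (col m))" for m
  define R where "R m = (if even m then r (col m) else t (col m))" for m
  \<comment> \<open>Away from column \<open>col m\<close> the value 1 makes a_i - a_i^{-1} zero and
    hence kills \<open>eta\<close>, so a single column of the rank-one matrix remains. The choice of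
    \<rho> cancels the factor from \<open>partial_sum\<close> and gives \<open>xi\<close> the values
    \<open>R m i\<close>; by \<open>R_col\<close> the remaining value of \<open>eta\<close> is
    1.\<close>
  define \<alpha> where "\<alpha> = (\<lambda>(m, i). if i = col m then D m else 1)"
  define \<rho> where "\<rho> = (\<lambda>(m, i). R m i / mon \<alpha> (partial_sum m i))"
  have \<alpha>_nz: "\<alpha> k \<noteq> 0" for k
    using AB by (cases k) (simp add: \<alpha>_def D_def)
  have \<rho>_nz: "\<rho> k \<noteq> 0" for k
    using rt(1,2) mon_nonzero[of \<alpha>, OF \<alpha>_nz] by (cases k) (simp add: \<rho>_def R_def)
  interpret heis_point \<rho> \<alpha> by unfold_locales (rule \<alpha>_nz \<rho>_nz)+
  have \<alpha>_val: "\<alpha> (m, i) = (if i = col m then D m else 1)" for m i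
    by (simp add: \<alpha>_def)
  have R_col: "R m (col m) = D m - inverse (D m)" for m
    using rt(3,4) by (simp add: R_def D_def)
  have R_nz: "R m i \<noteq> 0" for m i
    using rt(1,2) by (simp add: R_def)
  have xi: "value_at (osc_xi m i) = R m i" for m i
    using mon_nonzero[of \<alpha>, OF \<alpha>_nz] unfolding value_at_osc by (simp add: \<rho>_def)
  have eta: "value_at (osc_eta m i) = of_bool (i = col m)" for m i
    using mon_nonzero[of \<alpha>, OF \<alpha>_nz] R_col[of m] R_nz[of m "col m"]
    unfolding value_at_osc by (simp add: \<rho>_def) (simp add: \<alpha>_def)
  have matT: "(\<lambda>i l. value_at (osc_matrix m True i l)) = col_mat (col m) (D m) (\<lambda>i. if col m < i then R m i else 0)" for m
    by (intro ext) (auto simp: osc_matrix_simps value_at_mult value_at_0 value_at_osc(1) xi eta col_mat_def \<alpha>_val)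
  have matF: "(\<lambda>i l. value_at (osc_matrix m False i l)) = col_mat (col m) (inverse (D m)) (\<lambda>i. if i < col m then - R m i else 0)" for m
    by (intro ext) (auto simp: osc_matrix_simps value_at_mult value_at_minus value_at_0 value_at_osc(2) xi eta col_mat_def \<alpha>_val)
  have step: "(\<lambda>i l. value_at (osc_product n (Suc M) u i l))
      = mat_mult {1..2*n} (\<lambda>i l. value_at (osc_product n M u i l)) (\<lambda>i l. value_at (osc_matrix M u i l))" for M u
    by (intro ext) (simp add: mat_mult_def value_at_sum value_at_mult)
  have two: "(\<lambda>i l. value_at (osc_product n (2 * Suc J) u i l))
      = mat_mult {1..2*n} (mat_mult {1..2*n} (\<lambda>i l. value_at (osc_product n (2*J) u i l))
          (\<lambda>i l. value_at (osc_matrix (2*J) u i l))) (\<lambda>i l. value_at (osc_matrix (Suc (2*J)) u i l))" for J u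
    using step[of "Suc (2*J)" u] step[of "2*J" u] by simp
  have cols: "col (2*J) = Suc J" "col (Suc (2*J)) = Suc J" "D (2*J) = A (Suc J)" "D (Suc (2*J)) = B (Suc J)"
    "R (2*J) = r (Suc J)" "R (Suc (2*J)) = t (Suc J)" for J
    by (simp_all add: col_def D_def R_def)
  have T: "value_at (osc_product n (2 * Suc J) True i l) =
      (if l = Suc J then value_at (osc_product n (2*J) True i l) * d l
         + (\<Sum>s\<in>{1..2*n} - {l}. value_at (osc_product n (2*J) True i s) * (if l < s then y l s else 0))
       else value_at (osc_product n (2*J) True i l))" if l: "l \<in> {1..2*n}" for J i l
  proof -
    have "value_at (osc_product n (2 * Suc J) True i l) =
      (if l = Suc J then value_at (osc_product n (2*J) True i l) * (A l * B l)
         + (\<Sum>s\<in>{1..2*n} - {l}. value_at (osc_product n (2*J) True i s)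
             * ((if l < s then r l s else 0) * B l + (if l < s then t l s else 0)))
       else value_at (osc_product n (2*J) True i l))"
      unfolding fun_cong[OF fun_cong[OF two]] matT cols mat_mult_two_cols[OF finite_atLeastAtMost l]
      by auto
    moreover have "(if l < s then r l s else 0) * B l + (if l < s then t l s else 0) = (if l < s then y l s else 0)" for s
      using rt(5)[of l s] by simp
    ultimately show ?thesis by (simp only: AB)
  qed
  have F: "value_at (osc_product n (2 * Suc J) False i l) =
      (if l = Suc J then value_at (osc_product n (2*J) False i l) * inverse (d l)
         + (\<Sum>s\<in>{1..2*n} - {l}. value_at (osc_product n (2*J) False i s) * (if s < l then y l s else 0))
       else value_at (osc_product n (2*J) False i l))" if l: "l \<in> {1..2*n}" for J i l
  proof -
    have "value_at (osc_product n (2 * Suc J) False i l) =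
      (if l = Suc J then value_at (osc_product n (2*J) False i l) * (inverse (A l) * inverse (B l))
         + (\<Sum>s\<in>{1..2*n} - {l}. value_at (osc_product n (2*J) False i s)
             * ((if s < l then - r l s else 0) * inverse (B l) + (if s < l then - t l s else 0)))
       else value_at (osc_product n (2*J) False i l))"
      unfolding fun_cong[OF fun_cong[OF two]] matF cols mat_mult_two_cols[OF finite_atLeastAtMost l]
      by auto
    moreover have "(if s < l then - r l s else 0) * inverse (B l) + (if s < l then - t l s else 0)
        = (if s < l then y l s else 0)" for s
      using rt(6)[of s l] by simp
    moreover have "inverse (A l) * inverse (B l) = inverse (d l)"
      by (simp only: AB(1)[symmetric] inverse_mult_distrib)
    ultimately show ?thesis by (simp only:)
  qed
  show ?thesis
    by (rule that[OF heis_point_axioms]) (rule T F; assumption)+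
qed

text \<open>Let U be supported on the diagonal and on the entries (j, j + 1) with j odd. At z = 1,
  S_ij is then T_{i,j-1} U_jj for even j and T_ij U_{j,j+1} - T_{i,j+1} U_jj for odd j, and these
  equations can be solved successively for T and U.\<close>

lemma classical_surjective:
  assumes \<sigma>: "\<And>p. \<sigma> p \<noteq> 0"
  obtains \<rho> \<alpha> where "heis_point \<rho> \<alpha>"
    "\<And>i j. pbw_pos n i j \<Longrightarrow> heis_point.value_at \<rho> \<alpha> (osc_rep n (S i j)) = \<sigma> (i, j)"
proof -
  \<comment> \<open>The solution with U_jj = 1 for even j. For even k, \<open>t i k\<close> is the
    minor of \<sigma> with rows k - 1, i and columns k - 1, k.\<close>
  define d where "d j = (if odd j then \<sigma> (j, Suc j) else 1)" for j
  define t where "t i k = (if odd k then \<sigma> (i, Suc k)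
    else \<sigma> (i, k) * \<sigma> (k - 1, k - 1) - \<sigma> (k - 1, k) * \<sigma> (i, k - 1))" for i k
  define y where "y l s = (if l < s then t s l else if even l \<and> Suc s = l then \<sigma> (s, s) else 0)" for l s
  have d: "d j \<noteq> 0" for j using \<sigma> by (simp add: d_def)
  obtain \<rho> \<alpha> where pt: "heis_point \<rho> \<alpha>" and
    stepT: "\<And>J i l. l \<in> {1..2*n} \<Longrightarrow> heis_point.value_at \<rho> \<alpha> (osc_product n (2 * Suc J) True i l) =
      (if l = Suc J then heis_point.value_at \<rho> \<alpha> (osc_product n (2*J) True i l) * d l
         + (\<Sum>s\<in>{1..2*n} - {l}. heis_point.value_at \<rho> \<alpha> (osc_product n (2*J) True i s) * (if l < s then y l s else 0))
       else heis_point.value_at \<rho> \<alpha> (osc_product n (2*J) True i l))" and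
    stepU: "\<And>J i l. l \<in> {1..2*n} \<Longrightarrow> heis_point.value_at \<rho> \<alpha> (osc_product n (2 * Suc J) False i l) =
      (if l = Suc J then heis_point.value_at \<rho> \<alpha> (osc_product n (2*J) False i l) * inverse (d l)
         + (\<Sum>s\<in>{1..2*n} - {l}. heis_point.value_at \<rho> \<alpha> (osc_product n (2*J) False i s) * (if s < l then y l s else 0))
       else heis_point.value_at \<rho> \<alpha> (osc_product n (2*J) False i l))"
    using classical_columns[where d = d and y = y and n = n, OF d] by blast
  interpret heis_point \<rho> \<alpha> by (rule pt)
  define T where "T J i l = value_at (osc_product n (2*J) True i l)" for J i l
  define U where "U J i l = value_at (osc_product n (2*J) False i l)" for J i l
  note stepT = stepT[folded T_def] and stepU = stepU[folded U_def]
  have zero: "T 0 i l = of_bool (i = l)" "U 0 i l = of_bool (i = l)" for i l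
    by (simp_all add: T_def U_def value_at_0 value_at_1)
  \<comment> \<open>The columns to the right of l are still those of the identity, so the lower part
    of column l is \<open>y l\<close> itself.\<close>
  have T: "T J i l = (if l \<le> J then if i = l then d l else if l < i then t i l else 0 else of_bool (i = l))"
    if "i \<in> {1..2*n}" "l \<in> {1..2*n}" for J i l
    using that
  proof (induction J arbitrary: l)
    case 0
    then show ?case by (simp add: zero)
  next
    case (Suc J)
    show ?case
    proof (cases "l = Suc J")
      case True
      have "(\<Sum>s\<in>{1..2*n} - {l}. T J i s * (if l < s then y l s else 0))
        = (\<Sum>s\<in>{1..2*n} - {l}. if i = s then if l < i then t i l else 0 else 0)"
        by (rule sum.cong[OF refl]) (simp add: Suc.IH[OF Suc.prems(1)] True y_def)
      also have "\<dots> = (if l < i then t i l else 0)"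
        using Suc.prems by (simp only: sum.delta' finite_Diff finite_atLeastAtMost) auto
      finally show ?thesis
        using Suc by (simp only: stepT True) (auto simp: True)
    next
      case False
      then show ?thesis
        using Suc by (simp only: stepT) auto
    qed
  qed
  \<comment> \<open>The columns to the left of l are already final, but only column l - 1 enters,
    and only for even l; its diagonal entry brings in \<open>inverse (d i)\<close>.\<close>
  have U: "U J i l = (if l \<le> J then if i = l then inverse (d l)
      else if even l \<and> Suc i = l then inverse (d i) * \<sigma> (i, i) else 0 else of_bool (i = l))"
    if "i \<in> {1..2*n}" "l \<in> {1..2*n}" for J i l
    using that
  proof (induction J arbitrary: l)
    case 0
    then show ?case by (simp add: zero)
  next
    case (Suc J)
    show ?case
    proof (cases "l = Suc J")
      case True
      have "U J i s * (if s < l then y l s else 0)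
          = (if J = s then if even l \<and> i = J then inverse (d i) * \<sigma> (i, i) else 0 else 0)"
        if s: "s \<in> {1..2*n} - {l}" for s
      proof (cases "s = J \<and> even l")
        case even_l: True
        then have "U J i J = (if i = J then inverse (d J) else 0)"
          using Suc.IH[OF Suc.prems(1), of J] s True by auto
        then show ?thesis using even_l True by (simp add: y_def)
      qed (auto simp: y_def True)
      then have "(\<Sum>s\<in>{1..2*n} - {l}. U J i s * (if s < l then y l s else 0))
        = (\<Sum>s\<in>{1..2*n} - {l}. if J = s then if even l \<and> i = J then inverse (d i) * \<sigma> (i, i) else 0 else 0)"
        by (rule sum.cong[OF refl])
      also have "\<dots> = (if even l \<and> i = J then inverse (d i) * \<sigma> (i, i) else 0)"
        using Suc.prems True by (simp only: sum.delta' finite_Diff finite_atLeastAtMost) auto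
      finally show ?thesis
        using Suc by (simp only: stepU True) (auto simp: True)
    next
      case False
      then show ?thesis
        using Suc by (simp only: stepU) auto
    qed
  qed
  define Tv where "Tv i k = (if i = k then d k else if k < i then t i k else 0)" for i k
  define Uv where "Uv j l = (if j = l then inverse (d l) else if even l \<and> Suc j = l then inverse (d j) * \<sigma> (j, j) else 0)" for j l
  have Tv: "value_at (osc_product n (4*n) True i k) = Tv i k" if "i \<in> {1..2*n}" "k \<in> {1..2*n}" for i k
    using T[OF that, of "2*n"] that by (simp add: T_def Tv_def)
  have Uv: "value_at (osc_product n (4*n) False i k) = Uv i k" if "i \<in> {1..2*n}" "k \<in> {1..2*n}" for i k
    using U[OF that, of "2*n"] that by (simp add: U_def Uv_def)
  interpret tw: twisted_matrices laurent_heis n zl zli "osc_product n (4*n) True" "osc_product n (4*n) False"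
    by (rule twisted_osc)
  have rows: "odd k \<Longrightarrow> Suc k \<in> {1..2*n}" "even k \<Longrightarrow> k - 1 \<in> {1..2*n}" if "k \<in> {1..2*n}" for k
    using that by (auto elim!: evenE oddE) presburger+
  have parity: "even k \<Longrightarrow> k \<in> {1..2*n} \<Longrightarrow> odd (k - 1)" for k
    by (cases k) auto
  have S: "value_at (osc_rep n (S i j)) = (\<Sum>k\<in>{1..2*n}. Tv i k * (if odd k then Uv j (Suc k) else - Uv j (k - 1)))"
    if "i \<in> {1..2*n}" "j \<in> {1..2*n}" for i j
  proof -
    have "value_at (osc_rep n (S i j)) = (\<Sum>k\<in>{1..2*n}. value_at (osc_product n (4*n) True i k) * value_at (tw.V_entry j k))"
      by (simp only: osc_rep_def gen.case osc_S_def tw.S_mat_sum value_at_sum value_at_mult)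
    also have "\<dots> = (\<Sum>k\<in>{1..2*n}. Tv i k * (if odd k then Uv j (Suc k) else - Uv j (k - 1)))"
    proof (rule sum.cong[OF refl])
      fix k assume k: "k \<in> {1..2*n}"
      have "value_at (tw.V_entry j k) = (if odd k then Uv j (Suc k) else - Uv j (k - 1))"
        unfolding tw.V_entry_def using Uv[OF that(2) rows(1)[OF k]] Uv[OF that(2) rows(2)[OF k]]
        by (auto simp: value_at_mult value_at_zl value_at_minus)
      then show "value_at (osc_product n (4*n) True i k) * value_at (tw.V_entry j k)
          = Tv i k * (if odd k then Uv j (Suc k) else - Uv j (k - 1))"
        by (simp only: Tv[OF that(1) k])
    qed
    finally show ?thesis .
  qed
  have "value_at (osc_rep n (S i j)) = \<sigma> (i, j)" if pos: "pbw_pos n i j" for i j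
  proof -
    have ij: "i \<in> {1..2*n}" "j \<in> {1..2*n}" and nz: "\<not> zero_pos i j" "\<not> (even i \<and> i = j + 1)"
      using pos by (auto simp: pbw_pos_def)
    show ?thesis
    proof (cases "odd j")
      case True
      have sub: "{j, Suc j} \<subseteq> {1..2*n}" using rows(1)[OF ij(2) True] ij by blast
      have "value_at (osc_rep n (S i j)) = (\<Sum>k\<in>{j, Suc j}. Tv i k * (if odd k then Uv j (Suc k) else - Uv j (k - 1)))"
        unfolding S[OF ij]
      proof (rule sum.mono_neutral_right[OF finite_atLeastAtMost sub], rule ballI)
        fix k assume k: "k \<in> {1..2*n} - {j, Suc j}"
        show "Tv i k * (if odd k then Uv j (Suc k) else - Uv j (k - 1)) = 0"
          using k True parity[of k] by (cases "odd k") (auto simp: Uv_def)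
      qed
      also have "\<dots> = Tv i j * (inverse (d j) * \<sigma> (j, j)) - Tv i (Suc j) * inverse (d j)"
        using True by (simp add: Uv_def)
      also have "\<dots> = \<sigma> (i, j)"
      proof -
        consider "i = j" | "Suc j < i"
          using nz True unfolding zero_pos_def by (cases "i < j"; cases "i = j"; cases "i = Suc j") (auto, presburger)
        then show ?thesis
        proof cases
          case 1
          then show ?thesis using d[of j] by (simp add: Tv_def)
        next
          case 2
          then show ?thesis
            using True d[of j] \<sigma>[of "(j, Suc j)"] by (simp add: Tv_def t_def d_def field_simps)
        qed
      qed
      finally show ?thesis .
    next
      case False
      have sub: "{j - 1} \<subseteq> {1..2*n}" using rows(2)[OF ij(2)] False by blast
      have j: "Suc (j - 1) = j" using ij by simp
      have "value_at (osc_rep n (S i j)) = (\<Sum>k\<in>{j - 1}. Tv i k * (if odd k then Uv j (Suc k) else - Uv j (k - 1)))"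
        unfolding S[OF ij]
      proof (rule sum.mono_neutral_right[OF finite_atLeastAtMost sub], rule ballI)
        fix k assume k: "k \<in> {1..2*n} - {j - 1}"
        show "Tv i k * (if odd k then Uv j (Suc k) else - Uv j (k - 1)) = 0"
          using k False parity[of k] by (cases "odd k") (auto simp: Uv_def)
      qed
      also have "\<dots> = Tv i (j - 1)"
        using False j by (simp add: Uv_def d_def)
      also have "\<dots> = \<sigma> (i, j)"
        using False j nz by (auto simp: Tv_def d_def t_def zero_pos_def)
      finally show ?thesis .
    qed
  qed
  then show ?thesis using that pt by blast
qed

text \<open>Artin's argument: the point is multiplied by \<tau>, which is 2 at a coordinate where k
  and k0 differ and 1 elsewhere. Subtracting a multiple of the original relation removes k0 and
  multiplies the coefficient of k by a nonzero number.\<close>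

lemma characters_independent:
  fixes c :: "('p \<Rightarrow> int) \<Rightarrow> complex"
  assumes "finite K" "finite P" "\<And>k p. k \<in> K \<Longrightarrow> p \<notin> P \<Longrightarrow> k p = 0"
    "\<And>\<sigma>. (\<And>p. \<sigma> p \<noteq> 0) \<Longrightarrow> (\<Sum>k\<in>K. c k * (\<Prod>p\<in>P. \<sigma> p powi k p)) = 0"
  shows "\<forall>k\<in>K. c k = 0"
  using assms
proof (induction K arbitrary: c rule: finite_induct)
  case (insert k0 K)
  define chi where "chi \<sigma> k = (\<Prod>p\<in>P. \<sigma> p powi k p)" for \<sigma> :: "'p \<Rightarrow> complex" and k :: "'p \<Rightarrow> int"
  have zero: "c k0 * chi \<sigma> k0 + (\<Sum>k\<in>K. c k * chi \<sigma> k) = 0" if "\<And>p. \<sigma> p \<noteq> 0" for \<sigma>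
    using insert.prems(3)[OF that] insert.hyps by (simp add: chi_def)
  have "c k = 0" if k: "k \<in> K" for k
  proof -
    have "k \<noteq> k0" using insert.hyps k by blast
    then obtain p where p: "k p \<noteq> k0 p" by blast
    then have "p \<in> P" using insert.prems(2)[of k p] insert.prems(2)[of k0 p] k by (cases "p \<in> P") auto
    define \<tau> :: "'p \<Rightarrow> complex" where "\<tau> x = (if x = p then 2 else 1)" for x
    have chi_\<tau>: "chi \<tau> l = 2 powi l p" for l
    proof -
      have "chi \<tau> l = (\<Prod>x\<in>P. if x = p then 2 powi l p else 1)"
        unfolding chi_def by (rule prod.cong) (simp_all add: \<tau>_def)
      then show ?thesis using \<open>p \<in> P\<close> insert.prems(1) by simp
    qed
    have "\<forall>k\<in>K. c k * (chi \<tau> k - chi \<tau> k0) = 0"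
    proof (rule insert.IH[OF insert.prems(1)])
      fix \<sigma> :: "'p \<Rightarrow> complex" assume \<sigma>: "\<And>p. \<sigma> p \<noteq> 0"
      have prod: "chi (\<lambda>x. \<sigma> x * \<tau> x) l = chi \<sigma> l * chi \<tau> l" for l
        by (simp add: chi_def power_int_mult_distrib prod.distrib)
      have "(\<Sum>k\<in>K. c k * (chi \<tau> k - chi \<tau> k0) * chi \<sigma> k)
        = (c k0 * chi (\<lambda>x. \<sigma> x * \<tau> x) k0 + (\<Sum>k\<in>K. c k * chi (\<lambda>x. \<sigma> x * \<tau> x) k))
          - chi \<tau> k0 * (c k0 * chi \<sigma> k0 + (\<Sum>k\<in>K. c k * chi \<sigma> k))"
        by (simp add: prod algebra_simps sum_subtractf sum_distrib_left)
      also have "\<dots> = 0"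
      proof -
        have "c k0 * chi (\<lambda>x. \<sigma> x * \<tau> x) k0 + (\<Sum>k\<in>K. c k * chi (\<lambda>x. \<sigma> x * \<tau> x) k) = 0"
          by (rule zero) (simp add: \<sigma> \<tau>_def)
        with zero[OF \<sigma>] show ?thesis by simp
      qed
      finally show "(\<Sum>k\<in>K. c k * (chi \<tau> k - chi \<tau> k0) * (\<Prod>p\<in>P. \<sigma> p powi k p)) = 0"
        by (simp add: chi_def)
    qed (use insert.prems(2) in blast)
    then have "c k * (2 powi k p - 2 powi k0 p) = 0" using k by (simp add: chi_\<tau>)
    moreover have "(2::complex) powi k p \<noteq> 2 powi k0 p"
    proof
      assume "(2::complex) powi k p = 2 powi k0 p"
      then have "(2::real) powi k p = 2 powi k0 p"
        by (metis norm_numeral norm_power_int)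
      then show False
        using p power_int_strict_increasing[of "k p" "k0 p" "2::real"] power_int_strict_increasing[of "k0 p" "k p" "2::real"]
        by (cases "k p" "k0 p" rule: linorder_cases) auto
    qed
    ultimately show ?thesis by simp
  qed
  moreover from this have "c k0 = 0"
    using zero[of "\<lambda>_. 1"] by (simp add: chi_def)
  ultimately show ?case by simp
qed simp

lemma prod_pbw_word:
  fixes f :: "gen \<Rightarrow> complex"
  assumes k: "k \<in> pbw_exponents n"
    and f: "\<And>i j. pbw_pos n i j \<Longrightarrow> f (S i j) = \<sigma> (i, j)"
    and f_inv: "\<And>i. i \<in> odd_indices n \<Longrightarrow> f (Sinv i) = inverse (\<sigma> (i, Suc i))"
  shows "prod_list (map f (pbw_word n k)) = (\<Prod>p\<in>set (pbw_positions n). \<sigma> p powi k p)"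
proof -
  define F where "F = (\<lambda>(i, j). if k (i, j) \<ge> 0 then replicate (nat (k (i, j))) (S i j)
    else replicate (nat (- k (i, j))) (Sinv i))"
  have concat: "prod_list (map f (concat (map F ps))) = prod_list (map (\<lambda>p. prod_list (map f (F p))) ps)" for ps
    by (induction ps) simp_all
  have F: "prod_list (map f (F p)) = \<sigma> p powi k p" if p: "p \<in> set (pbw_positions n)" for p
  proof (cases p)
    case (Pair i j)
    then have pos: "pbw_pos n i j" using p by (simp add: set_pbw_positions)
    show ?thesis
    proof (cases "k p \<ge> 0")
      case True
      then show ?thesis using Pair f[OF pos] by (simp add: F_def power_int_def)
    next
      case False
      then have "odd i \<and> j = Suc i" using k p Pair by (fastforce simp: pbw_exponents_def)
      moreover from this have "i \<in> odd_indices n" using pos by (simp add: pbw_pos_def odd_indices_def)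
      ultimately show ?thesis using False Pair f_inv[of i] by (simp add: F_def power_int_def)
    qed
  qed
  have "prod_list (map f (pbw_word n k)) = prod_list (map (\<lambda>p. prod_list (map f (F p))) (pbw_positions n))"
    unfolding pbw_word_def F_def[symmetric] by (rule concat)
  also have "map (\<lambda>p. prod_list (map f (F p))) (pbw_positions n) = map (\<lambda>p. \<sigma> p powi k p) (pbw_positions n)"
    using F by simp
  finally show ?thesis
    by (simp add: prod.distinct_set_conv_list distinct_pbw_positions)
qed

definition osc_word :: "nat \<Rightarrow> (nat \<times> nat \<Rightarrow> int) \<Rightarrow> heis_alg" where
  "osc_word n k = prod_list (map (osc_rep n) (pbw_word n k))"

text \<open>As \<open>classical_surjective\<close> realizes every \<sigma>, the ordered words turn
  at z = 1 into distinct characters of the full torus of values.\<close>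

lemma classical_independent:
  assumes "finite K" "K \<subseteq> pbw_exponents n" and zero: "(\<Sum>k\<in>K. laurent_heis (d k) * osc_word n k) = 0"
  shows "\<forall>k\<in>K. laurent_eval 1 (d k) = 0"
proof (rule characters_independent[where P = "set (pbw_positions n)"])
  fix \<sigma> :: "nat \<times> nat \<Rightarrow> complex" assume \<sigma>: "\<And>p. \<sigma> p \<noteq> 0"
  obtain \<rho> \<alpha> where pt: "heis_point \<rho> \<alpha>" and
    val: "\<And>i j. pbw_pos n i j \<Longrightarrow> heis_point.value_at \<rho> \<alpha> (osc_rep n (S i j)) = \<sigma> (i, j)"
    by (rule classical_surjective[where n = n and \<sigma> = \<sigma>, OF \<sigma>]) (rule that)
  interpret heis_point \<rho> \<alpha> by (rule pt)
  have inv: "value_at (osc_rep n (Sinv i)) = inverse (\<sigma> (i, Suc i))" if i: "i \<in> odd_indices n" for i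
  proof -
    have unit: "osc_rep n (S i (i + 1)) * osc_rep n (Sinv i) = 1"
      using sp_relations.J_inv_right[OF osc_rep_relations i] by simp
    have "\<sigma> (i, Suc i) * value_at (osc_rep n (Sinv i)) = 1"
      using val[OF pbw_pos_unit[OF i]] arg_cong[of _ _ value_at, OF unit]
      by (simp only: Suc_eq_plus1 value_at_1 value_at_mult)
    then show ?thesis by (simp add: inverse_unique)
  qed
  have "value_at (osc_word n k) = (\<Prod>p\<in>set (pbw_positions n). \<sigma> p powi k p)" if "k \<in> K" for k
    unfolding osc_word_def value_at_prod_list map_map
    using that assms(2) val inv by (intro prod_pbw_word) auto
  then have "(\<Sum>k\<in>K. laurent_eval 1 (d k) * (\<Prod>p\<in>set (pbw_positions n). \<sigma> p powi k p))
    = value_at (\<Sum>k\<in>K. laurent_heis (d k) * osc_word n k)"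
    by (simp add: value_at_sum value_at_mult value_at_laurent)
  then show "(\<Sum>k\<in>K. laurent_eval 1 (d k) * (\<Prod>p\<in>set (pbw_positions n). \<sigma> p powi k p)) = 0"
    by (simp only: zero value_at_0)
qed (use assms(1,2) in \<open>auto simp: pbw_exponents_def\<close>)

section \<open>Independence over the Laurent polynomials\<close>

lemma laurent_eval_rules:
  assumes "q \<noteq> 0"
  shows "laurent_eval q (p + r) = laurent_eval q p + laurent_eval q r"
    "laurent_eval q (p * r) = laurent_eval q p * laurent_eval q r"
    "laurent_eval q (const_alg c) = c" "laurent_eval q zl = q" "laurent_eval q zli = inverse q"
proof -
  note single = coefficient_hom.extend_linear_single[OF coefficient_hom_id]
  show "laurent_eval q (p + r) = laurent_eval q p + laurent_eval q r"
    unfolding laurent_eval_def by (rule coefficient_hom.extend_linear_add[OF coefficient_hom_id])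
  show "laurent_eval q (p * r) = laurent_eval q p * laurent_eval q r"
    unfolding laurent_eval_def by (rule algebra_hom.extend_mult[OF algebra_hom_laurent_eval[OF assms]])
  show "laurent_eval q (const_alg c) = c" "laurent_eval q zl = q" "laurent_eval q zli = inverse q"
    by (simp_all add: laurent_eval_def const_alg_def zl_def zli_def single)
qed

text \<open>Division by z - q with remainder. Negative exponents are reached by downward induction,
  multiplying by \<open>zli\<close>.\<close>

lemma laurent_remainder:
  assumes q: "q \<noteq> 0"
  shows "\<exists>r. p = const_alg (laurent_eval q p) + (zl - const_alg q) * r"
proof (induction p rule: poly_mapping_single_induct)
  case zero
  show ?case by (intro exI[of _ 0]) (simp add: laurent_eval_def coefficient_hom.extend_linear_0[OF coefficient_hom_id])
next
  case (single c d)
  have "\<exists>r. Poly_Mapping.single c 1 = const_alg (q powi c) + (zl - const_alg q) * r" for c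
  proof (induction c rule: int_induct[where k = 0])
    case base
    show ?case by (intro exI[of _ 0]) (simp add: const_alg_def)
  next
    case (step1 c)
    then obtain r where r: "Poly_Mapping.single c 1 = const_alg (q powi c) + (zl - const_alg q) * r" by blast
    have "Poly_Mapping.single (c + 1) 1 = zl * Poly_Mapping.single c (1::complex)"
      by (simp add: zl_def mult_single add.commute)
    also have "\<dots> = const_alg (q powi (c + 1)) + (zl - const_alg q) * (const_alg (q powi c) + zl * r)"
      by (simp add: r power_int_add q const_alg_mult algebra_simps)
    finally show ?case by blast
  next
    case (step2 c)
    then obtain r where r: "Poly_Mapping.single c 1 = const_alg (q powi c) + (zl - const_alg q) * r" by blast
    define e where "e = (const_alg (q powi (c - 1)) :: laurent)"
    have e: "const_alg (q powi c) = const_alg q * e"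
      using power_int_add[of q 1 "c - 1"] q by (simp add: e_def const_alg_mult[symmetric])
    have "zli * ((zl - const_alg q) * r + const_alg q * e)
      = e + (zl - const_alg q) * (zli * r - zli * e) + (zl * zli - 1) * e"
      by (simp add: algebra_simps)
    moreover have "Poly_Mapping.single (c - 1) 1 = zli * Poly_Mapping.single c (1::complex)"
      by (simp add: zli_def mult_single)
    ultimately show ?case
      unfolding e_def[symmetric] by (intro exI[of _ "zli * r - zli * e"]) (simp add: r e zl_zli add.commute)
  qed
  then obtain r where r: "Poly_Mapping.single c 1 = const_alg (q powi c) + (zl - const_alg q) * r" by blast
  have "Poly_Mapping.single c d = const_alg d * Poly_Mapping.single c 1"
    by (simp add: const_alg_single)
  also have "\<dots> = const_alg (d * q powi c) + (zl - const_alg q) * (const_alg d * r)"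
    by (simp only: r) (simp add: const_alg_mult algebra_simps)
  finally have "Poly_Mapping.single c d = const_alg (d * q powi c) + (zl - const_alg q) * (const_alg d * r)" .
  moreover have "laurent_eval q (Poly_Mapping.single c d) = d * q powi c"
    unfolding laurent_eval_def by (rule coefficient_hom.extend_linear_single[OF coefficient_hom_id])
  ultimately show ?case by (intro exI[of _ "const_alg d * r"]) (simp only:)
next
  case (add p r)
  then obtain a b where "p = const_alg (laurent_eval q p) + (zl - const_alg q) * a"
    "r = const_alg (laurent_eval q r) + (zl - const_alg q) * b" by blast
  then have "p + r = (const_alg (laurent_eval q p) + (zl - const_alg q) * a)
      + (const_alg (laurent_eval q r) + (zl - const_alg q) * b)" by simp
  then have "p + r = const_alg (laurent_eval q (p + r)) + (zl - const_alg q) * (a + b)"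
    unfolding laurent_eval_rules(1)[OF q] const_alg_add distrib_left by (simp only: add_ac)
  then show ?case by blast
qed

text \<open>Otherwise y = z y, so the support of y would be stable under translation of the last
  exponent and therefore infinite.\<close>

lemma laurent_heis_zl_cancel:
  assumes "laurent_heis (zl - 1) * y = 0"
  shows "y = 0"
proof (rule ccontr)
  assume "y \<noteq> 0"
  then obtain g where "Poly_Mapping.lookup y g \<noteq> 0" by (metis poly_mapping_eqI lookup_zero)
  then obtain v u c where nz: "Poly_Mapping.lookup y (Heis v u c) \<noteq> 0" by (cases g) auto
  have shift: "Poly_Mapping.lookup (laurent_heis zl * x) (Heis v u c) = Poly_Mapping.lookup x (Heis v u (c - 1))" for x c
  proof (induction x rule: poly_mapping_single_induct)
    case (single g e)
    then show ?case
      by (cases g) (auto simp: laurent_heis_zl hmono_def mult_single lookup_single when_def)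
  qed (simp_all add: distrib_left lookup_add)
  have "laurent_heis zl * y = y"
    using assms by (simp add: laurent_heis.hom_diff left_diff_distrib)
  then have same: "Poly_Mapping.lookup y (Heis v u c) = Poly_Mapping.lookup y (Heis v u (c - 1))" for c
    using shift[of y c] by simp
  have "Poly_Mapping.lookup y (Heis v u (c - int m)) \<noteq> 0" for m
  proof (induction m)
    case (Suc m)
    have "c - int (Suc m) = c - int m - 1" by simp
    then show ?case using Suc same[of "c - int m"] by (simp only:) simp
  qed (simp add: nz)
  then have "range (\<lambda>m. Heis v u (c - int m)) \<subseteq> Poly_Mapping.keys y"
    by (auto simp: in_keys_iff)
  moreover have "infinite (range (\<lambda>m. Heis v u (c - int m)))"
    by (intro range_inj_infinite injI) simp
  ultimately show False by (meson finite_keys finite_subset)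
qed

text \<open>A degree unaffected by powers of z. It grows with every factor z - 1 and so bounds the
  number of such factors.\<close>

definition laurent_width :: "laurent \<Rightarrow> int" where
  "laurent_width p = Max (Poly_Mapping.keys p) - Min (Poly_Mapping.keys p)"

lemma laurent_width_mult:
  assumes "r \<noteq> 0"
  shows "(zl - 1) * r \<noteq> 0" "laurent_width ((zl - 1) * r) \<ge> laurent_width r + 1"
proof -
  have lookup: "Poly_Mapping.lookup ((zl - 1) * x) c = Poly_Mapping.lookup x (c - 1) - Poly_Mapping.lookup x c" for x c
  proof (induction x rule: poly_mapping_single_induct)
    case (single g e)
    have "(zl - 1) * Poly_Mapping.single g e = Poly_Mapping.single (1 + g) e - Poly_Mapping.single g e"
      by (simp add: left_diff_distrib zl_def mult_single)
    then show ?case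
      by (auto simp: lookup_minus lookup_single when_def)
  qed (simp_all add: distrib_left lookup_add)
  define K where "K = Poly_Mapping.keys r"
  have K: "finite K" "K \<noteq> {}" using assms by (auto simp: K_def)
  have "Max K + 1 \<notin> K" "Min K - 1 \<notin> K"
    using Max_ge[OF K(1), of "Max K + 1"] Min_le[OF K(1), of "Min K - 1"] by auto
  with Max_in[OF K] Min_in[OF K] have keys: "Max K + 1 \<in> Poly_Mapping.keys ((zl - 1) * r)"
    "Min K \<in> Poly_Mapping.keys ((zl - 1) * r)"
    by (simp_all add: in_keys_iff lookup K_def)
  then show "(zl - 1) * r \<noteq> 0" by auto
  have "Max K + 1 \<le> Max (Poly_Mapping.keys ((zl - 1) * r))" "Min (Poly_Mapping.keys ((zl - 1) * r)) \<le> Min K"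
    using keys by (simp_all add: Max_ge Min_le)
  then show "laurent_width ((zl - 1) * r) \<ge> laurent_width r + 1"
    by (simp add: laurent_width_def K_def)
qed

lemma laurent_width_power:
  assumes "r \<noteq> 0"
  shows "(zl - 1) ^ N * r \<noteq> 0" "laurent_width ((zl - 1) ^ N * r) \<ge> int N"
proof -
  have "(zl - 1) ^ N * r \<noteq> 0 \<and> laurent_width ((zl - 1) ^ N * r) \<ge> int N"
  proof (induction N)
    case 0
    have "Min (Poly_Mapping.keys r) \<le> Max (Poly_Mapping.keys r)"
      using assms by (intro Min_le Max_in) auto
    then show ?case using assms by (simp add: laurent_width_def)
  next
    case (Suc N)
    then show ?case
      using laurent_width_mult[of "(zl - 1) ^ N * r"] by (simp add: mult.assoc)
  qed
  then show "(zl - 1) ^ N * r \<noteq> 0" "laurent_width ((zl - 1) ^ N * r) \<ge> int N" by blast+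
qed

theorem laurent_independent:
  assumes K: "finite K" "K \<subseteq> pbw_exponents n"
    and zero: "(\<Sum>k\<in>K. laurent_heis (d k) * osc_word n k) = 0" and k: "k \<in> K"
  shows "d k = 0"
proof (rule ccontr)
  assume nz: "d k \<noteq> 0"
  have "\<exists>e. (\<forall>k\<in>K. d k = (zl - 1) ^ N * e k) \<and> (\<Sum>k\<in>K. laurent_heis (e k) * osc_word n k) = 0" for N
  proof (induction N)
    case 0
    show ?case using zero by (intro exI[of _ d]) simp
  next
    case (Suc N)
    then obtain e where e: "\<And>k. k \<in> K \<Longrightarrow> d k = (zl - 1) ^ N * e k"
      "(\<Sum>k\<in>K. laurent_heis (e k) * osc_word n k) = 0" by blast
    have "\<exists>r. e k = (zl - 1) * r" if "k \<in> K" for k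
      using classical_independent[OF K e(2)] that laurent_remainder[of 1 "e k"] by simp
    then obtain r where r: "\<And>k. k \<in> K \<Longrightarrow> e k = (zl - 1) * r k" by metis
    have "laurent_heis (zl - 1) * (\<Sum>k\<in>K. laurent_heis (r k) * osc_word n k)
      = (\<Sum>k\<in>K. laurent_heis (e k) * osc_word n k)"
      unfolding sum_distrib_left
      by (rule sum.cong[OF refl]) (simp only: r laurent_heis.hom_mult mult.assoc)
    then have "(\<Sum>k\<in>K. laurent_heis (r k) * osc_word n k) = 0"
      by (rule laurent_heis_zl_cancel[OF trans[OF _ e(2)]])
    then show ?case
      using e(1) r by (intro exI[of _ r] conjI ballI) (simp_all only: power_Suc2 mult.assoc)
  qed
  \<comment> \<open>One factor more than the width of \<open>d k\<close> permits.\<close>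
  then obtain e where "d k = (zl - 1) ^ nat (laurent_width (d k) + 1) * e k" using k by blast
  with nz laurent_width_power(2)[of "e k" "nat (laurent_width (d k) + 1)"] show False
    by (cases "e k = 0") (auto split: if_splits)
qed

section \<open>The basis\<close>

lemma set_pbw_word:
  assumes "k \<in> pbw_exponents n"
  shows "set (pbw_word n k) \<subseteq> gens n"
proof
  fix x assume "x \<in> set (pbw_word n k)"
  then obtain i j where p: "(i, j) \<in> set (pbw_positions n)" and
    x: "x \<in> set (if k (i, j) \<ge> 0 then replicate (nat (k (i, j))) (S i j) else replicate (nat (- k (i, j))) (Sinv i))"
    unfolding pbw_word_def by auto
  have pos: "pbw_pos n i j" using p by (simp add: set_pbw_positions)
  show "x \<in> gens n"
  proof (cases "k (i, j) \<ge> 0")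
    case True
    then have "x = S i j" using x by simp
    then show ?thesis using pos by (auto simp: gens_def pbw_pos_def)
  next
    case False
    then have "x = Sinv i" using x by simp
    moreover have "odd i" using False p assms by (fastforce simp: pbw_exponents_def)
    ultimately show ?thesis using pos by (auto simp: gens_def pbw_pos_def odd_indices_def)
  qed
qed

context sp_relations
begin

text \<open>Replaces the inductive description by a sum with one coefficient for each exponent, as
  needed for comparing coefficients.\<close>

lemma spanned_sum:
  assumes "x \<in> spanned"
  shows "\<exists>K d. finite K \<and> K \<subseteq> pbw_exponents n \<and> x - (\<Sum>k\<in>K. sc (d k) * val (pbw_word n k)) \<in> J"
  using assms
proof induction
  case (spanned_J x)
  then show ?case by (intro exI[of _ "{}"]) simp
next
  case (spanned_word k)
  then show ?case by (intro exI[of _ "{k}"] exI[of _ "\<lambda>_. 1"]) (simp add: J_0)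
next
  case (spanned_add x y)
  then obtain K d K' d' where K: "finite K" "K \<subseteq> pbw_exponents n" "x - (\<Sum>k\<in>K. sc (d k) * val (pbw_word n k)) \<in> J"
    and K': "finite K'" "K' \<subseteq> pbw_exponents n" "y - (\<Sum>k\<in>K'. sc (d' k) * val (pbw_word n k)) \<in> J" by blast
  define e where "e k = (if k \<in> K then d k else 0) + (if k \<in> K' then d' k else 0)" for k
  have "(\<Sum>k\<in>K \<union> K'. sc (e k) * val (pbw_word n k))
    = (\<Sum>k\<in>K \<union> K'. sc (if k \<in> K then d k else 0) * val (pbw_word n k))
      + (\<Sum>k\<in>K \<union> K'. sc (if k \<in> K' then d' k else 0) * val (pbw_word n k))"
    by (simp only: e_def hom_add distrib_right sum.distrib)
  moreover have "(\<Sum>k\<in>K \<union> K'. sc (if k \<in> K then d k else 0) * val (pbw_word n k))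
    = (\<Sum>k\<in>K. sc (d k) * val (pbw_word n k))"
    using K(1) K'(1) by (intro sum.mono_neutral_cong_right) auto
  moreover have "(\<Sum>k\<in>K \<union> K'. sc (if k \<in> K' then d' k else 0) * val (pbw_word n k))
    = (\<Sum>k\<in>K'. sc (d' k) * val (pbw_word n k))"
    using K(1) K'(1) by (intro sum.mono_neutral_cong_right) auto
  ultimately have "x + y - (\<Sum>k\<in>K \<union> K'. sc (e k) * val (pbw_word n k)) \<in> J"
    using J_add[OF K(3) K'(3)] by (simp only: add_diff_add)
  then show ?case using K K' by (intro exI[of _ "K \<union> K'"] exI[of _ e]) simp
next
  case (spanned_scale x c)
  then obtain K d where K: "finite K" "K \<subseteq> pbw_exponents n" "x - (\<Sum>k\<in>K. sc (d k) * val (pbw_word n k)) \<in> J"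
    by blast
  have "sc c * (x - (\<Sum>k\<in>K. sc (d k) * val (pbw_word n k)))
    = sc c * x - (\<Sum>k\<in>K. sc (c * d k) * val (pbw_word n k))"
    by (simp only: right_diff_distrib sum_distrib_left hom_mult mult.assoc)
  then have "sc c * x - (\<Sum>k\<in>K. sc (c * d k) * val (pbw_word n k)) \<in> J"
    using J_scale[OF K(3), of c] by simp
  then show ?case using K(1,2) by (intro exI[of _ K] exI[of _ "\<lambda>k. c * d k"]) simp
qed

end

text \<open>The set \<open>spanned\<close> of \<open>osc_rep_relations\<close> is the subalgebra generated by the image of
  the generators over the Laurent polynomials; \<open>laurent_remainder\<close> allows one to replace
  the central element \<open>z\<close> by the number \<open>q\<close> modulo \<open>z - q\<close>.\<close>

locale specialization =
  fixes n :: nat and q :: complex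
  assumes q: "q \<noteq> 0"
begin

sublocale osc: sp_relations laurent_heis n zl zli "osc_rep n" "{0}"
  by (rule osc_rep_relations)

abbreviation B :: "heis_alg set" where "B \<equiv> osc.spanned"

text \<open>The ideal is formed in \<open>B\<close> and not in the whole group algebra: its elements
  are z - q times combinations of ordered words, so coefficients can be compared.\<close>

definition N :: "heis_alg set" where
  "N = {laurent_heis (zl - const_alg q) * y | y. y \<in> B}"

lemma B_one: "1 \<in> B"
  using osc.word_spanned[of "[]"] by simp

lemma B_gen: "x \<in> gens n \<Longrightarrow> osc_rep n x \<in> B"
  using osc.word_spanned[of "[x]"] by simp

text \<open>A product of two ordered words is again a word in the generators, hence covered by
  \<open>word_spanned\<close> over the Laurent polynomials.\<close>

lemma B_mult:
  assumes "x \<in> B" "y \<in> B"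
  shows "x * y \<in> B"
  using assms
proof (induction arbitrary: y)
  case (spanned_word k)
  show ?case using \<open>y \<in> B\<close>
  proof induction
    case (spanned_word l)
    have "set (pbw_word n k @ pbw_word n l) \<subseteq> gens n"
      using set_pbw_word[OF \<open>k \<in> pbw_exponents n\<close>] set_pbw_word[OF \<open>l \<in> pbw_exponents n\<close>] by simp
    then show ?case using osc.word_spanned[of "pbw_word n k @ pbw_word n l"] by simp
  next
    case (spanned_scale x c)
    have "osc.val (pbw_word n k) * (laurent_heis c * x) = laurent_heis c * (osc.val (pbw_word n k) * x)"
      using laurent_heis.hom_central[of c "osc.val (pbw_word n k)"] by (simp only: mult.assoc[symmetric])
    then show ?case using spanned_scale by (simp add: osc.spanned_scale)
  qed (simp_all add: osc.spanned_J distrib_left osc.spanned_add)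
qed (simp_all add: osc.spanned_J distrib_right osc.spanned_add osc.spanned_scale mult.assoc)

lemma B_laurent: "laurent_heis p \<in> B"
  using osc.spanned_scale[OF B_one, of p] by simp

lemma laurent_heis_const: "laurent_heis (const_alg c) = const_alg c"
  using laurent_heis_single[of 0 c] by (simp add: const_alg_def[of c] hmono_one)

lemma N_zero: "0 \<in> N" and N_add: "x \<in> N \<Longrightarrow> y \<in> N \<Longrightarrow> x + y \<in> N"
  and N_diff: "x \<in> N \<Longrightarrow> y \<in> N \<Longrightarrow> x - y \<in> N"
  and N_left: "x \<in> N \<Longrightarrow> b \<in> B \<Longrightarrow> b * x \<in> N"
  and N_right: "x \<in> N \<Longrightarrow> b \<in> B \<Longrightarrow> x * b \<in> N"
proof -
  show "0 \<in> N" unfolding N_def using osc.spanned_J[of 0] by (intro CollectI exI[of _ 0]) simp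
  show "x + y \<in> N" if "x \<in> N" "y \<in> N"
    using that osc.spanned_add unfolding N_def by (auto simp: distrib_left[symmetric])
  show "x - y \<in> N" if "x \<in> N" "y \<in> N"
    using that osc.spanned_diff unfolding N_def by (auto simp: right_diff_distrib[symmetric])
  show "b * x \<in> N" if x: "x \<in> N" and b: "b \<in> B"
  proof -
    obtain y where y: "x = laurent_heis (zl - const_alg q) * y" "y \<in> B" using x by (auto simp: N_def)
    have "b * x = laurent_heis (zl - const_alg q) * (b * y)"
      using laurent_heis.hom_central[of "zl - const_alg q" b] by (simp only: y mult.assoc[symmetric])
    then show ?thesis using B_mult[OF b y(2)] by (auto simp: N_def)
  qed
  show "x * b \<in> N" if "x \<in> N" "b \<in> B"
    using that B_mult unfolding N_def by (auto simp: mult.assoc)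
qed

text \<open>Congruence modulo \<open>N\<close> inside \<open>B\<close>. It respects sums and
  products, so \<open>zl\<close> can be traded for \<open>q\<close> coefficient by
  coefficient.\<close>

definition rel :: "heis_alg \<Rightarrow> heis_alg \<Rightarrow> bool" where
  "rel x y \<longleftrightarrow> x \<in> B \<and> y \<in> B \<and> x - y \<in> N"

lemma rel_gen: "x \<in> gens n \<Longrightarrow> rel (osc_rep n x) (osc_rep n x)"
  by (simp add: rel_def B_gen N_zero)

lemma rel_one: "rel 1 1"
  by (simp add: rel_def B_one N_zero)

lemma rel_add: "rel x y \<Longrightarrow> rel x' y' \<Longrightarrow> rel (x + x') (y + y')"
  unfolding rel_def using N_add[of "x - y" "x' - y'"] by (simp add: osc.spanned_add add_diff_add)

lemma rel_diff:
  assumes "rel x y" "rel x' y'"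
  shows "rel (x - x') (y - y')"
proof -
  have "x - x' - (y - y') = (x - y) - (x' - y')" by simp
  then show ?thesis
    using assms N_diff[of "x - y" "x' - y'"] unfolding rel_def by (simp only: osc.spanned_diff)
qed

lemma rel_mult:
  assumes "rel x y" "rel x' y'"
  shows "rel (x * x') (y * y')"
proof -
  have "x * x' - y * y' = x * (x' - y') + (x - y) * y'"
    by (simp add: algebra_simps)
  then show ?thesis
    using assms unfolding rel_def by (simp only: B_mult N_add N_left N_right)
qed

lemma rel_coeff: "laurent_eval q p = c \<Longrightarrow> rel (laurent_heis p) (const_alg c)"
proof -
  assume c: "laurent_eval q p = c"
  obtain r where "p = const_alg (laurent_eval q p) + (zl - const_alg q) * r"
    using laurent_remainder[OF q] by blast
  then have "laurent_heis p = laurent_heis (const_alg c + (zl - const_alg q) * r)"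
    by (simp only: c)
  then have "laurent_heis p - const_alg c = laurent_heis (zl - const_alg q) * laurent_heis r"
    by (simp add: laurent_heis.hom_add laurent_heis.hom_mult laurent_heis_const)
  moreover have "const_alg c \<in> B"
    using B_laurent[of "const_alg c"] by (simp only: laurent_heis_const)
  ultimately show ?thesis using B_laurent by (auto simp: rel_def N_def)
qed

text \<open>Complex coefficients stay constants while the images of the generators obey the
  relations with parameter z; so the relators with parameter q go into \<open>N\<close>, in general
  not to zero.\<close>

definition rep :: "free_elem \<Rightarrow> heis_alg" where
  "rep = extend_linear const_alg (\<lambda>w. prod_list (map (osc_rep n) (letters w)))"

lemma rep_hom: "algebra_hom (const_alg :: complex \<Rightarrow> heis_alg) (\<lambda>w. prod_list (map (osc_rep n) (letters w)))"
  by (intro algebra_hom.intro coefficient_hom_const_alg algebra_hom_axioms.intro)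
    (simp_all add: zero_word_def letters_plus)

lemma rep_simps:
  "rep 0 = 0" "rep 1 = 1" "rep (scalar c) = const_alg c" "rep (letter x) = osc_rep n x"
  "rep (p + r) = rep p + rep r" "rep (p - r) = rep p - rep r" "rep (p * r) = rep p * rep r"
  "rep (sum f A) = (\<Sum>a\<in>A. rep (f a))" "rep (prod_list ps) = prod_list (map rep ps)"
proof -
  interpret algebra_hom "const_alg :: complex \<Rightarrow> heis_alg" "\<lambda>w. prod_list (map (osc_rep n) (letters w))"
    by (rule rep_hom)
  show "rep 0 = 0" "rep 1 = 1" "rep (p + r) = rep p + rep r" "rep (p - r) = rep p - rep r" "rep (p * r) = rep p * rep r"
    "rep (sum f A) = (\<Sum>a\<in>A. rep (f a))" "rep (prod_list ps) = prod_list (map rep ps)"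
    unfolding rep_def
    by (rule extend_linear_0 extend_1 extend_linear_add extend_linear_diff extend_mult extend_linear_sum
        extend_prod_list)+
  show "rep (scalar c) = const_alg c"
    unfolding rep_def scalar_def using extend_const[of c] by (simp only: const_alg_def)
  show "rep (letter x) = osc_rep n x"
    unfolding rep_def letter_def extend_linear_single by simp
qed

lemma rep_carrier: "p \<in> carrier (free_algebra (gens n)) \<Longrightarrow> rep p \<in> B"
proof -
  assume p: "p \<in> carrier (free_algebra (gens n))"
  have words: "const_alg (Poly_Mapping.lookup p w) * prod_list (map (osc_rep n) (letters w)) \<in> B"
    if "w \<in> Poly_Mapping.keys p" for w
  proof -
    have "osc.val (letters w) \<in> B"
      using p that by (intro osc.word_spanned) (auto simp: free_algebra_ops)
    then show ?thesis
      using osc.spanned_scale[of "osc.val (letters w)" "const_alg (Poly_Mapping.lookup p w)"]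
      by (simp add: laurent_heis_const osc.val_def)
  qed
  have sums: "sum f A \<in> B" if "\<And>a. a \<in> A \<Longrightarrow> f a \<in> B" for f :: "gen word \<Rightarrow> heis_alg" and A
    using that by (induction A rule: infinite_finite_induct) (simp_all add: osc.spanned_J osc.spanned_add)
  show ?thesis unfolding rep_def extend_linear_def by (rule sums[OF words])
qed

lemma laurent_eval_simps:
  "laurent_eval q (p - r) = laurent_eval q p - laurent_eval q r"
  "laurent_eval q (p ^ m) = laurent_eval q p ^ m" "laurent_eval q (of_bool P) = of_bool P"
  "laurent_eval q 0 = 0" "laurent_eval q 1 = 1"
  unfolding atomize_conj
proof (intro conjI)
  show one: "laurent_eval q 1 = 1" and zero: "laurent_eval q 0 = 0"
    using laurent_eval_rules(3)[OF q, of 1] laurent_eval_rules(3)[OF q, of 0] by simp_all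
  show "laurent_eval q (p ^ m) = laurent_eval q p ^ m"
    by (induction m) (simp_all add: one laurent_eval_rules[OF q])
  show "laurent_eval q (p - r) = laurent_eval q p - laurent_eval q r"
    using laurent_eval_rules(1)[OF q, of "p - r" r] by simp
  show "laurent_eval q (of_bool P) = of_bool P"
    by (cases P) (simp_all add: one zero)
qed

lemma rep_relator: "rel 0 (rep x) \<Longrightarrow> rep x \<in> N"
  using N_diff[OF N_zero, of "0 - rep x"] by (simp add: rel_def)

lemmas eval_rules = laurent_eval_rules(1,2,4,5)[OF q] laurent_eval_simps

text \<open>Each relator is congruent to its analogue with parameter \<open>zl\<close>, which
  vanishes in the representation.\<close>

lemma relators_in_N:
  assumes "x \<in> relators n q"
  shows "rep x \<in> N"
proof -
  have S: "S i j \<in> gens n" if "i \<in> {1..2*n}" "j \<in> {1..2*n}" for i j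
    using that by (auto simp: gens_def)
  have Sinv: "Sinv i \<in> gens n" if "i \<in> odd_indices n" for i
    using that by (auto simp: gens_def)
  have odd: "i \<in> {1..2*n}" "i + 1 \<in> {1..2*n}" if "i \<in> odd_indices n" for i
    using odd_indicesD[OF that] by simp_all
  note rels = rel_add rel_diff rel_mult rel_one rel_gen rel_coeff
  consider (zero) i j where "x = s i j" "i \<in> {1..2*n}" "j \<in> {1..2*n}" "zero_pos i j"
    | (right) i where "x = s i (i+1) * sinv i - 1" "i \<in> odd_indices n"
    | (left) i where "x = sinv i * s i (i+1) - 1" "i \<in> odd_indices n"
    | (det) i where "x = s (i+1) (i+1) * s i i - scalar (q^2) * s (i+1) i * s i (i+1) - scalar (q^3)" "i \<in> odd_indices n"
    | (refl) i a j b where "x = reflection_lhs q i a j b - reflection_rhs q i a j b"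
        "i \<in> {1..2*n}" "a \<in> {1..2*n}" "j \<in> {1..2*n}" "b \<in> {1..2*n}"
    using assms unfolding relators_def zero_pos_def by blast
  then show ?thesis
  proof cases
    case zero
    then show ?thesis using osc.J_zero[of i j] N_zero by (simp add: rep_simps)
  next
    case right
    then show ?thesis using osc.J_inv_right[of i] N_zero by (simp add: rep_simps)
  next
    case left
    then show ?thesis using osc.J_inv_left[of i] N_zero by (simp add: rep_simps)
  next
    case det
    have "rel (osc_rep n (S (i+1) (i+1)) * osc_rep n (S i i)
        - laurent_heis (zl^2) * osc_rep n (S (i+1) i) * osc_rep n (S i (i+1)) - laurent_heis (zl^3)) (rep x)"
      unfolding det(1) rep_simps
      by (intro rels S odd det(2)) (simp_all only: eval_rules)
    then show ?thesis using osc.J_det[OF det(2)] by (intro rep_relator) simp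
  next
    case refl
    have "rel (laurent_heis (zl ^ (of_bool (a = j) + of_bool (i = j))) * osc_rep n (S i a) * osc_rep n (S j b)
      - laurent_heis (zl ^ (of_bool (a = b) + of_bool (i = b))) * osc_rep n (S j b) * osc_rep n (S i a)
      - (laurent_heis ((zl - zli) * zl ^ of_bool (a = i) * (of_bool (b < a) - of_bool (i < j)))
           * osc_rep n (S j a) * osc_rep n (S i b)
         + laurent_heis (zl - zli)
           * (laurent_heis (zl ^ of_bool (a = b) * of_bool (b < i)) * osc_rep n (S j i) * osc_rep n (S b a)
              - laurent_heis (zl ^ of_bool (i = j) * of_bool (a < j)) * osc_rep n (S i j) * osc_rep n (S a b))
         + laurent_heis ((zl - zli)^2 * (of_bool (b < a \<and> a < i) - of_bool (a < i \<and> i < j)))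
           * osc_rep n (S j i) * osc_rep n (S a b))) (rep x)"
      unfolding refl(1) reflection_lhs_def reflection_rhs_def rep_simps
      by (intro rels S refl(2-)) (simp_all only: eval_rules)
    then show ?thesis using osc.J_refl[OF refl(2-)] by (intro rep_relator) simp
  qed
qed

text \<open>The elements that \<open>rep\<close> sends into \<open>N\<close> form an ideal of the
  free algebra, because \<open>rep\<close> maps that algebra into \<open>B\<close>.\<close>

lemma relation_ideal_in_N:
  assumes "x \<in> relation_ideal n q"
  shows "rep x \<in> N"
proof -
  define A where "A = free_algebra (gens n)"
  interpret A: ring A unfolding A_def by (rule ring_free_algebra)
  define I where "I = {p \<in> carrier A. rep p \<in> N}"
  have "ideal I A"
  proof (rule idealI[OF A.ring_axioms])
    show "subgroup I (add_monoid A)"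
    proof (rule subgroup.intro)
      show "inv\<^bsub>add_monoid A\<^esub> p \<in> I" if "p \<in> I" for p
      proof -
        have "\<ominus>\<^bsub>A\<^esub> p = - p"
          using that by (intro A.minus_equality) (auto simp: I_def A_def free_algebra_ops free_algebra_closed)
        then have eq: "inv\<^bsub>add_monoid A\<^esub> p = 0 - p" by (simp add: a_inv_def)
        have "rep (0 - p) = 0 - rep p" by (simp only: rep_simps)
        then show ?thesis
          unfolding eq using that N_diff[OF N_zero, of "rep p"]
          by (simp add: I_def A_def free_algebra_closed)
      qed
    qed (auto simp: I_def A_def free_algebra_ops(2-) free_algebra_closed rep_simps N_zero N_add)
    show "p \<otimes>\<^bsub>A\<^esub> a \<in> I" "a \<otimes>\<^bsub>A\<^esub> p \<in> I" if "a \<in> I" "p \<in> carrier A" for a p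
      using that N_left N_right rep_carrier
      by (auto simp: I_def A_def free_algebra_ops(2) free_algebra_closed rep_simps)
  qed
  moreover have "relators n q \<subseteq> I"
    using relators_subset relators_in_N by (auto simp: I_def A_def)
  ultimately have "relation_ideal n q \<subseteq> I"
    unfolding relation_ideal_def A_def[symmetric] by (rule A.genideal_minimal)
  then show ?thesis using assms by (auto simp: I_def)
qed

text \<open>The relation becomes \<Sum> c_k w_k = (z - q) y with y in \<open>B\<close>. Expanding y
  in ordered words and applying \<open>laurent_independent\<close> makes each c_k a multiple of z -
  q, and evaluation at q gives c_k = 0.\<close>

lemma free_independent:
  assumes K: "finite K" "K \<subseteq> pbw_exponents n"
    and zero: "(\<Sum>k\<in>K. scalar (c k) * prod_list (map letter (pbw_word n k))) \<in> relation_ideal n q"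
    and k: "k \<in> K"
  shows "c k = 0"
proof -
  have word: "rep (prod_list (map letter (pbw_word n k))) = osc_word n k" for k
    by (simp add: rep_simps osc_word_def o_def)
  have "(\<Sum>k\<in>K. const_alg (c k) * osc_word n k) \<in> N"
    using relation_ideal_in_N[OF zero] by (simp only: rep_simps(3,7,8) word)
  then obtain y where y: "(\<Sum>k\<in>K. const_alg (c k) * osc_word n k) = laurent_heis (zl - const_alg q) * y" "y \<in> B"
    by (auto simp: N_def)
  obtain L d where L: "finite L" "L \<subseteq> pbw_exponents n" "y = (\<Sum>k\<in>L. laurent_heis (d k) * osc_word n k)"
    using osc.spanned_sum[OF y(2)] by (auto simp: osc_word_def osc.val_def)
  define e where "e k = (if k \<in> K then const_alg (c k) else 0) - (if k \<in> L then (zl - const_alg q) * d k else 0)" for k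
  have "(\<Sum>k\<in>K \<union> L. laurent_heis (e k) * osc_word n k)
    = (\<Sum>k\<in>K \<union> L. laurent_heis (if k \<in> K then const_alg (c k) else 0) * osc_word n k)
      - (\<Sum>k\<in>K \<union> L. laurent_heis (if k \<in> L then (zl - const_alg q) * d k else 0) * osc_word n k)"
    by (simp only: e_def laurent_heis.hom_diff left_diff_distrib sum_subtractf)
  also have "(\<Sum>k\<in>K \<union> L. laurent_heis (if k \<in> K then const_alg (c k) else 0) * osc_word n k)
    = (\<Sum>k\<in>K. const_alg (c k) * osc_word n k)"
    using K(1) L(1) by (intro sum.mono_neutral_cong_right) (auto simp: laurent_heis_const)
  also have "(\<Sum>k\<in>K \<union> L. laurent_heis (if k \<in> L then (zl - const_alg q) * d k else 0) * osc_word n k)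
    = (\<Sum>k\<in>L. laurent_heis ((zl - const_alg q) * d k) * osc_word n k)"
    using K(1) L(1) by (intro sum.mono_neutral_cong_right) auto
  also have "(\<Sum>k\<in>L. laurent_heis ((zl - const_alg q) * d k) * osc_word n k) = laurent_heis (zl - const_alg q) * y"
    by (simp only: L(3) sum_distrib_left laurent_heis.hom_mult mult.assoc)
  finally have "(\<Sum>k\<in>K \<union> L. laurent_heis (e k) * osc_word n k) = 0"
    by (simp only: y(1) diff_self)
  then have "e k = 0"
    using K L k by (intro laurent_independent[of "K \<union> L" n e k]) auto
  then have "laurent_eval q (e k) = 0"
    by (simp only: eval_rules)
  then show ?thesis
    using k laurent_eval_rules(3)[OF q] by (simp add: e_def eval_rules split: if_splits)
qed

end

section \<open>Spanning in the free algebra modulo the relation ideal\<close>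

lemma coefficient_hom_scalar: "coefficient_hom scalar"
  by standard (simp_all add: scalar_simps, rule scalar_commute)

lemma relation_ideal_relations:
  assumes q: "q \<noteq> 0"
  shows "sp_relations scalar n q (inverse q) letter (relation_ideal n q)"
proof -
  interpret coefficient_hom scalar by (rule coefficient_hom_scalar)
  interpret ideal "relation_ideal n q" "free_algebra (gens n)" by (rule ideal_relation_ideal)
  have relator: "x \<in> relation_ideal n q" if "x \<in> relators n q" for x
    using ring.genideal_self[OF ring_free_algebra relators_subset[of n q]] that
    unfolding relation_ideal_def by blast
  show ?thesis
  proof (intro sp_relations.intro coefficient_hom_scalar sp_relations_axioms.intro)
    show "q * inverse q = 1" using q by simp
    show "0 \<in> relation_ideal n q"
      using additive_subgroup.zero_closed[OF additive_subgroup_axioms] by (simp add: free_algebra_ops)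
    show "x + y \<in> relation_ideal n q" if "x \<in> relation_ideal n q" "y \<in> relation_ideal n q" for x y
      using additive_subgroup.a_closed[OF additive_subgroup_axioms that] by (simp add: free_algebra_ops)
    show "scalar c * x \<in> relation_ideal n q" if "x \<in> relation_ideal n q" for x c
      using I_l_closed[OF that, of "scalar c"] by (simp add: free_algebra_ops(2) free_algebra_closed)
    show "letter u * x \<in> relation_ideal n q" "x * letter u \<in> relation_ideal n q"
      if "x \<in> relation_ideal n q" "u \<in> gens n" for x u
      using I_l_closed[OF that(1), of "letter u"] I_r_closed[OF that(1), of "letter u"] letter_closed[OF that(2)]
      by (simp_all add: free_algebra_ops(2))
  qed (rule relator; unfold relators_def zero_pos_def reflection_lhs_def reflection_rhs_def; blast)+
qed

lemma poly_mapping_sum_single: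
  "p = (\<Sum>w\<in>Poly_Mapping.keys p. Poly_Mapping.single w (Poly_Mapping.lookup p w))"
  by (rule poly_mapping_eqI) (simp add: lookup_sum lookup_single when_def in_keys_iff)

lemma prod_letter: "prod_list (map letter w) = Poly_Mapping.single (Word w) (1::complex)"
  by (induction w) (simp_all add: letter_def mult_single plus_word_def zero_word_def[symmetric] single_one)

lemma prod_s_power:
  "prod_list (map (\<lambda>(i, j). s_power i j (k (i, j))) (pbw_positions n)) = prod_list (map letter (pbw_word n k))"
proof -
  have "prod_list (map (\<lambda>(i, j). s_power i j (k (i, j))) ps) = prod_list (map letter (concat (map (\<lambda>(i, j).
     if k (i, j) \<ge> 0 then replicate (nat (k (i, j))) (S i j) else replicate (nat (- k (i, j))) (Sinv i)) ps)))" for ps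
    by (induction ps) (auto simp: s_power_def)
  then show ?thesis by (simp only: pbw_word_def)
qed

lemma free_spanned:
  assumes q: "q \<noteq> 0" and p: "p \<in> carrier (free_algebra (gens n))"
  shows "\<exists>K d. finite K \<and> K \<subseteq> pbw_exponents n \<and>
    p - (\<Sum>k\<in>K. scalar (d k) * prod_list (map letter (pbw_word n k))) \<in> relation_ideal n q"
proof -
  interpret sp_relations scalar n q "inverse q" letter "relation_ideal n q"
    by (rule relation_ideal_relations[OF q])
  have words: "Poly_Mapping.single w (Poly_Mapping.lookup p w) \<in> spanned" if "w \<in> Poly_Mapping.keys p" for w
  proof -
    have "val (letters w) \<in> spanned"
      using p that by (intro word_spanned) (auto simp: free_algebra_ops)
    then show ?thesis
      using spanned_scale[of "val (letters w)" "Poly_Mapping.lookup p w"]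
      by (simp add: val_def prod_letter scalar_def mult_single)
  qed
  have sums: "sum f A \<in> spanned" if "\<And>a. a \<in> A \<Longrightarrow> f a \<in> spanned" for f :: "gen word \<Rightarrow> free_elem" and A
    using that by (induction A rule: infinite_finite_induct) (simp_all add: spanned_J J_0 spanned_add)
  have "(\<Sum>w\<in>Poly_Mapping.keys p. Poly_Mapping.single w (Poly_Mapping.lookup p w)) \<in> spanned"
    by (rule sums[OF words])
  then have "p \<in> spanned" by (simp only: poly_mapping_sum_single[symmetric])
  from spanned_sum[OF this] show ?thesis by (simp only: val_def)
qed

section \<open>Transfer to the quotient algebra\<close>

abbreviation coset :: "nat \<Rightarrow> complex \<Rightarrow> free_elem \<Rightarrow> free_elem set" where
  "coset n q p \<equiv> relation_ideal n q +>\<^bsub>free_algebra (gens n)\<^esub> p"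

definition word_elem :: "nat \<Rightarrow> (nat \<times> nat \<Rightarrow> int) \<Rightarrow> free_elem" where
  "word_elem n k = prod_list (map letter (pbw_word n k))"

lemma pbw_monomial_coset: "pbw_monomial n q k = coset n q (word_elem n k)"
  by (simp only: pbw_monomial_def prod_s_power word_elem_def)

lemma word_elem_closed: "k \<in> pbw_exponents n \<Longrightarrow> word_elem n k \<in> carrier (free_algebra (gens n))"
  using set_pbw_word[of k n] by (auto simp: word_elem_def prod_letter free_algebra_ops)

lemma coset_eq:
  assumes "p \<in> carrier (free_algebra (gens n))" "r \<in> carrier (free_algebra (gens n))"
  shows "coset n q p = coset n q r \<longleftrightarrow> p - r \<in> relation_ideal n q"
proof -
  interpret ideal "relation_ideal n q" "free_algebra (gens n)" by (rule ideal_relation_ideal)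
  have minus: "p \<ominus>\<^bsub>free_algebra (gens n)\<^esub> r = p - r"
  proof -
    have "\<ominus>\<^bsub>free_algebra (gens n)\<^esub> r = - r"
      using assms(2) by (intro minus_equality) (auto simp: free_algebra_ops(4,5) free_algebra_closed)
    then show ?thesis by (simp add: a_minus_def free_algebra_ops)
  qed
  show ?thesis
    using quotient_eq_iff_same_a_r_cos[OF ideal_axioms assms] by (simp only: minus)
qed

lemma sum_closed:
  "(\<And>k. k \<in> K \<Longrightarrow> f k \<in> carrier (free_algebra G)) \<Longrightarrow> sum f K \<in> carrier (free_algebra G)"
  by (induction K rule: infinite_finite_induct) (simp_all add: free_algebra_closed)

lemma zero_U_sp: "\<zero>\<^bsub>U_sp n q\<^esub> = coset n q 0"
proof -
  interpret ideal "relation_ideal n q" "free_algebra (gens n)" by (rule ideal_relation_ideal)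
  show ?thesis
    using a_coset_add_zero[OF a_subset]
    by (simp add: U_sp_def quotient_algebra_def FactRing_def free_algebra_ops)
qed

text \<open>\<open>lincomb\<close> sums over a set of vectors; injectivity allows the sum to be
  indexed by exponents instead.\<close>

lemma lincomb_pbw:
  assumes inj: "inj_on (pbw_monomial n q) K" and K: "finite K" "K \<subseteq> pbw_exponents n"
  shows "module.lincomb (U_sp n q) a (pbw_monomial n q ` K)
    = coset n q (\<Sum>k\<in>K. scalar (a (pbw_monomial n q k)) * word_elem n k)"
proof -
  interpret vectorspace complex_field "U_sp n q" by (rule vectorspace_U_sp)
  note closed = word_elem_closed[THEN free_algebra_closed(7)[OF free_algebra_closed(3)]]
  have mem: "coset n q p \<in> carrier (U_sp n q)" if "p \<in> carrier (free_algebra (gens n))" for p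
    using U_sp_coset_ops(1)[OF that that] .
  have scaled: "a (pbw_monomial n q k) \<odot>\<^bsub>U_sp n q\<^esub> pbw_monomial n q k
      = coset n q (scalar (a (pbw_monomial n q k)) * word_elem n k)" if "k \<in> pbw_exponents n" for k
    unfolding pbw_monomial_coset by (rule smult_U_sp_coset[OF word_elem_closed[OF that]])
  have "lincomb a (pbw_monomial n q ` K)
    = (\<Oplus>\<^bsub>U_sp n q\<^esub>k\<in>K. a (pbw_monomial n q k) \<odot>\<^bsub>U_sp n q\<^esub> pbw_monomial n q k)"
    unfolding lincomb_def using K(2) mem closed
    by (intro finsum_reindex[OF _ inj]) (auto simp: scaled subset_eq)
  also have "\<dots> = coset n q (\<Sum>k\<in>K. scalar (a (pbw_monomial n q k)) * word_elem n k)"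
    using K
  proof (induction K rule: finite_induct)
    case empty
    then show ?case by (simp add: zero_U_sp)
  next
    case (insert k K)
    have "(\<Sum>k\<in>K. scalar (a (pbw_monomial n q k)) * word_elem n k) \<in> carrier (free_algebra (gens n))"
      using insert.prems closed by (intro sum_closed) auto
    with insert closed mem show ?case
      by (simp add: finsum_insert scaled Pi_def subset_eq U_sp_coset_ops(2))
  qed
  finally show ?thesis .
qed

theorem theorem3p6:
  fixes n :: nat and q :: complex
  assumes "n \<ge> 1" and "q \<noteq> 0" and "q\<^sup>2 \<noteq> 1"
  shows "inj_on (pbw_monomial n q) (pbw_exponents n) \<and>
    vectorspace.basis complex_field (U_sp n q) (pbw_monomial n q ` pbw_exponents n)"
proof -
  interpret specialization n q by unfold_locales (rule assms(2))
  interpret V: vectorspace complex_field "U_sp n q" by (rule vectorspace_U_sp)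
  note closed = word_elem_closed[THEN free_algebra_closed(7)[OF free_algebra_closed(3)]]
  have complex_carrier: "carrier complex_field = (UNIV :: complex set)" "\<zero>\<^bsub>complex_field\<^esub> = (0::complex)"
    by (simp_all add: ring_of_type_algebra_def)
  have inj: "inj_on (pbw_monomial n q) (pbw_exponents n)"
  proof (rule inj_onI, rule ccontr)
    fix k l assume k: "k \<in> pbw_exponents n" and l: "l \<in> pbw_exponents n"
      and eq: "pbw_monomial n q k = pbw_monomial n q l" and neq: "k \<noteq> l"
    \<comment> \<open>Equal cosets of k and l would give a relation with coefficients 1 and -1,
      against \<open>free_independent\<close>.\<close>
    define c :: "(nat \<times> nat \<Rightarrow> int) \<Rightarrow> complex" where "c m = (if m = k then 1 else - 1)" for m
    have "word_elem n k - word_elem n l \<in> relation_ideal n q"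
      using eq coset_eq[OF word_elem_closed[OF k] word_elem_closed[OF l]] by (simp only: pbw_monomial_coset)
    moreover have "scalar (- 1) = (- 1 :: free_elem)"
      using coefficient_hom.hom_minus[OF coefficient_hom_scalar, of 1] by (simp add: scalar_simps)
    then have "(\<Sum>m\<in>{k, l}. scalar (c m) * word_elem n m) = word_elem n k - word_elem n l"
      using neq by (simp add: c_def scalar_simps)
    ultimately have "c k = 0"
      using k l by (intro free_independent[of "{k, l}" c k]) (simp_all only: word_elem_def, auto)
    then show False by (simp add: c_def)
  qed
  have sub: "pbw_monomial n q ` pbw_exponents n \<subseteq> carrier (U_sp n q)"
    using U_sp_coset_ops(1)[OF word_elem_closed word_elem_closed] by (auto simp: pbw_monomial_coset)
  have lift: "\<exists>K. A = pbw_monomial n q ` K \<and> finite K \<and> K \<subseteq> pbw_exponents n"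
    if "finite A" "A \<subseteq> pbw_monomial n q ` pbw_exponents n" for A
    using finite_subset_image[OF that] by blast
  have "V.lin_indpt (pbw_monomial n q ` pbw_exponents n)"
    unfolding V.lin_dep_def
  proof (intro notI, elim exE conjE)
    fix A a v
    assume A: "finite A" "A \<subseteq> pbw_monomial n q ` pbw_exponents n"
      and zero: "V.lincomb a A = \<zero>\<^bsub>U_sp n q\<^esub>" and v: "v \<in> A" "a v \<noteq> \<zero>\<^bsub>complex_field\<^esub>"
    obtain K where K: "A = pbw_monomial n q ` K" "finite K" "K \<subseteq> pbw_exponents n"
      using lift[OF A] by blast
    obtain k where k: "k \<in> K" "v = pbw_monomial n q k" using v K by blast
    define f where "f = (\<Sum>k\<in>K. scalar (a (pbw_monomial n q k)) * word_elem n k)"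
    have "f \<in> carrier (free_algebra (gens n))"
      unfolding f_def using K(3) closed by (intro sum_closed) auto
    moreover have "coset n q f = coset n q 0"
      using zero lincomb_pbw[OF inj_on_subset[OF inj K(3)] K(2,3), of a]
      by (simp only: K(1) zero_U_sp f_def)
    ultimately have "f \<in> relation_ideal n q"
      using coset_eq[OF _ free_algebra_closed(1)] by simp
    then have "a (pbw_monomial n q k) = 0"
      unfolding f_def word_elem_def by (rule free_independent[OF K(2,3) _ k(1)])
    then show False using v k by (simp add: complex_carrier)
  qed
  moreover have "V.span (pbw_monomial n q ` pbw_exponents n) = carrier (U_sp n q)"
  proof
    show "V.span (pbw_monomial n q ` pbw_exponents n) \<subseteq> carrier (U_sp n q)"
      by (rule V.span_is_subset2[OF sub])
    show "carrier (U_sp n q) \<subseteq> V.span (pbw_monomial n q ` pbw_exponents n)"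
    proof
      fix C assume "C \<in> carrier (U_sp n q)"
      then obtain p where p: "p \<in> carrier (free_algebra (gens n))" "C = coset n q p"
        by (rule carrier_U_spE)
      obtain K d where K: "finite K" "K \<subseteq> pbw_exponents n"
        and d: "p - (\<Sum>k\<in>K. scalar (d k) * word_elem n k) \<in> relation_ideal n q"
        using free_spanned[OF assms(2) p(1)] by (auto simp: word_elem_def)
      \<comment> \<open>\<open>lincomb\<close> wants coefficients as a function of the coset, so
        \<open>d\<close> is transported along the inverse of the injection.\<close>
      define a where "a = d \<circ> inv_into K (pbw_monomial n q)"
      have a: "a (pbw_monomial n q k) = d k" if "k \<in> K" for k
        using inv_into_f_f[OF inj_on_subset[OF inj K(2)] that] by (simp add: a_def)
      have "V.lincomb a (pbw_monomial n q ` K) = coset n q (\<Sum>k\<in>K. scalar (d k) * word_elem n k)"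
        by (simp add: lincomb_pbw[OF inj_on_subset[OF inj K(2)] K] a)
      also have "\<dots> = C"
      proof -
        have "(\<Sum>k\<in>K. scalar (d k) * word_elem n k) \<in> carrier (free_algebra (gens n))"
          using K(2) closed by (intro sum_closed) auto
        from coset_eq[OF p(1) this] d have "coset n q p = coset n q (\<Sum>k\<in>K. scalar (d k) * word_elem n k)"
          by simp
        then show ?thesis by (simp only: p(2))
      qed
      finally show "C \<in> V.span (pbw_monomial n q ` pbw_exponents n)"
        unfolding V.span_def using K
        by (intro CollectI exI[of _ a] exI[of _ "pbw_monomial n q ` K"]) (auto simp: complex_carrier)
    qed
  qed
  ultimately show ?thesis
    unfolding V.basis_def using inj sub by blast
qed

end
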